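(* Let $(\Sigma,\sigma)$ be a two-sided minimal subshift with topological rank $K$. Then its one-sided factor $(\Sigma^+,\sigma)$ has topological rank at least $K$. Furthermore, there exists a two-sided minimal subshift $(\Sigma',\sigma)$ such that $(\Sigma',\sigma)$ is topologically conjugate to $(\Sigma,\sigma)$ and the one-sided factor $({\Sigma'}^{+},\sigma)$ has topological rank $K$.
   Context: **Systems.** A zero-dimensional system is a pair $(X,f)$ with $X$ a compact zero-dimensional metrizable space and $f:X\to X$ a continuous surjection. It is a Cantor system if $X$ has no isolated point. A two-sided subshift is a closed shift-invariant subset $\Sigma\subseteq A^{\mathbb Z}$ ($A$ a finite alphabet) with the left shift $\sigma$. Its one-sided factor $(\Sigma^+,\sigma)$ is the one-sided (minimal) subshift $\Sigma^+=\{(x_0,x_1,x_2,\dots)\mid (x_i)_{i\in\mathbb Z}\in\Sigma\}$ obtained by cutting off the negative coordinates, with the left shift. **Graph coverings.** A graph $G=(V,E)$ is a finite vertex set $V$ with a relation $E\subseteq V\times V$ (no multiple edges) such that every $v\in V$ has edges $(u_1,v),(v,u_2)\in E$. We write $V(G)=V$, $E(G)=E$. A graph homomorphism $\varphi:G_1\to G_2$ is a map of vertices sending edges to edges. It is edge-surjective if $\varphi(E_1)=E_2$, and $+$directional if $(u,v),(u,v')\in E_1$ implies $\varphi(v)=\varphi(v')$. A cover is a $+$directional edge-surjective graph homomorphism. A (graph) covering is a sequence of covers $G_0\xleftarrow{\varphi_1}G_1\xleftarrow{\varphi_2}G_2\xleftarrow{\varphi_3}\cdots$ with $G_n=(V_n,E_n)$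 and $G_0=(\{v_0\},\{(v_0,v_0)\})$. For $m>n$ put $\varphi_{m,n}=\varphi_{n+1}\circ\cdots\circ\varphi_m$. Its inverse limit is the zero-dimensional system $(X,f)$ with $X=\{(x_0,x_1,\dots)\in\prod_n V_n\mid x_i=\varphi_{i+1}(x_{i+1})\ \forall i\}$ (product of discrete topologies) and $f(x)=y$ if and only if $(x_i,y_i)\in E_i$ for all $i$ (this defines a continuous surjection). A walk of length $l$ in $G$ is a sequence $(u_0,\dots,u_l)$ with $(u_i,u_{i+1})\in E$. It is a circuit of period $l$ if $u_0=u_l$ and $u_0,\dots,u_{l-1}$ are mutually distinct. $E(w)$ denotes the set of edges of a walk $w$. **GM-coverings.** A covering is of Gambaudo–Martens type (a GM-covering) if for each $n>0$ there are a vertex $v_{n,0}$ of $G_n$ and finitely many circuits $c_{n,i}$ ($1\le i\le r_n$) of $G_n$, where $\{c_{n,i}\mid 1\le i\le r_n\}$ is the set of all circuits of $G_n$ (listed without repetition, starting at $v_{n,0}$), such that (a) $c_{n,i}=(v_{n,0}=v_{n,i,0},v_{n,i,1},\dots,v_{n,i,l(n,i)}=v_{n,0})$ with $l(n,i)\ge1$; (b) $\bigcup_{i=1}^{r_n}E(c_{n,i})=E(G_n)$; (c) if $v_{n,i,j}=v_{n,i',j'}$ with $j,j'\ge1$, then $v_{n,i,j+k}=v_{n,i',j'+k}$ for $k=0,1,2,\dots$ until $j+k=l(n,i)$ and $j'+k=l(n,i')$ occur at the same time; (d) $\varphi_n(v_{n,0})=v_{n-1,0}$ for all $n\ge1$;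 (e) $\varphi_n(v_{n,i,1})=v_{n-1,1,1}$ for all $n\ge1$ and $1\le i\le r_n$ (for $n=0$: $v_{0,0}=v_{0,1,1}=v_0$). It is simple if for every $n>0$ there is $m>n$ such that $E(\varphi_{m,n}(c_{m,i}))=E(G_n)$ for each $1\le i\le r_m$. Its rank is $\liminf_{n\to\infty}r_n\in\{1,2,\dots,\infty\}$. A zero-dimensional system is minimal if and only if it is topologically conjugate to the inverse limit of a simple GM-covering (Gambaudo–Martens). **Topological rank of a minimal zero-dimensional system.** It is the minimum $K\in\{1,2,\dots,\infty\}$ of the ranks of the simple GM-coverings whose inverse limit is topologically conjugate to the system. **Bratteli–Vershik systems.** A Bratteli diagram $(V,E)$ is an infinite directed graph with partitions into non-empty finite sets $V=V_0\cup V_1\cup\cdots$, $E=E_1\cup E_2\cup\cdots$, $V_0=\{v_0\}$, with source and range maps $s:E_n\to V_{n-1}$, $r:E_n\to V_n$ (multiple edges allowed), $s^{-1}(v)\ne\emptyset$ for all $v\in V$ and $r^{-1}(v)\neq\emptyset$ for all $v\in V\setminus V_0$. Its rank is $\liminf_{n\to\infty}\#V_n$. Telescoping means passing to a subsequence of levels (containing level $0$) with edges between consecutive chosen levels being the paths between them. The diagram is simple if after telescoping any $u\in V_n$ and $v\in V_{n+1}$ are joined by an edge, for all $n\ge0$. An ordered Bratteli diagram carries a linear order on each $r^{-1}(v)$, $v\in V\setminus V_0$. A path is maximal (minimal) if all its edges are maximal (minimal). An ordered diagram is properly ordered if it is simple and has a unique infinite maximal path $x_{\max}$ and a unique infinite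 minimal path $x_{\min}$ starting at $v_0$. The Vershik map $\phi$ on the infinite path space $E_{0,\infty}=\{(e_1,e_2,\dots)\mid e_i\in E_i,\ r(e_i)=s(e_{i+1})\}$ (subspace of the product) is: $\phi(x_{\max})=x_{\min}$; for $e\neq x_{\max}$, with $n$ least such that $e_n$ is not maximal, $f_n$ the successor of $e_n$ in $r^{-1}(r(e_n))$, and $(f_1,\dots,f_{n-1})$ the minimal path from $v_0$ to $s(f_n)$, $\phi(e)=(f_1,\dots,f_{n-1},f_n,e_{n+1},e_{n+2},\dots)$. **Topological rank of a minimal homeomorphism.** For a minimal homeomorphic zero-dimensional system, the topological rank is the minimum $K\in\{1,2,\dots,\infty\}$ of the ranks of properly ordered Bratteli diagrams whose Vershik map is topologically conjugate to it. (It is known that for homeomorphic Cantor minimal systems this agrees with the rank defined through simple GM-coverings.) The topological rank of a two-sided subshift is understood in this sense, that of a one-sided subshift in the sense of simple GM-coverings. *)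

theory Defs
  imports "HOL-Analysis.Analysis"
begin

section \<open>Topological dynamical systems and subshifts\<close>

text \<open>A system is a topology \<open>T\<close> together with a map \<open>f\<close>, of which only the values on
  \<open>topspace T\<close> matter.\<close>

definition minimal_system :: "'x topology \<Rightarrow> ('x \<Rightarrow> 'x) \<Rightarrow> bool" where
  "minimal_system T f \<longleftrightarrow>
     topspace T \<noteq> {} \<and> (\<forall>C. closedin T C \<and> f ` C \<subseteq> C \<longrightarrow> C = {} \<or> C = topspace T)"

definition topologically_conjugate ::
    "'x topology \<Rightarrow> ('x \<Rightarrow> 'x) \<Rightarrow> 'y topology \<Rightarrow> ('y \<Rightarrow> 'y) \<Rightarrow> bool" where
  "topologically_conjugate S f T g \<longleftrightarrow>
     (\<exists>h. homeomorphic_map S T h \<and> (\<forall>x\<in>topspace S. h (f x) = g (h x)))"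

text \<open>The index type is \<open>int\<close> for two-sided and \<open>nat\<close> for one-sided sequences.\<close>

definition shift :: "('i::{plus,one} \<Rightarrow> 'a) \<Rightarrow> 'i \<Rightarrow> 'a" where
  "shift x = (\<lambda>i. x (i + 1))"

definition full_shift_topology :: "'a set \<Rightarrow> ('i \<Rightarrow> 'a) topology" where
  "full_shift_topology A = product_topology (\<lambda>_. discrete_topology A) UNIV"

definition subshift_topology :: "'a set \<Rightarrow> ('i \<Rightarrow> 'a) set \<Rightarrow> ('i \<Rightarrow> 'a) topology" where
  "subshift_topology A S = subtopology (full_shift_topology A) S"

definition two_sided_subshift :: "'a set \<Rightarrow> (int \<Rightarrow> 'a) set \<Rightarrow> bool" where
  "two_sided_subshift A S \<longleftrightarrow>
     finite A \<and> closedin (full_shift_topology A) S \<and> shift ` S = S"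

definition minimal_two_sided_subshift :: "'a set \<Rightarrow> (int \<Rightarrow> 'a) set \<Rightarrow> bool" where
  "minimal_two_sided_subshift A S \<longleftrightarrow>
     two_sided_subshift A S \<and> minimal_system (subshift_topology A S) shift"

definition one_sided_factor :: "(int \<Rightarrow> 'a) set \<Rightarrow> (nat \<Rightarrow> 'a) set" where
  "one_sided_factor S = (\<lambda>x n. x (int n)) ` S"


section \<open>Graph coverings and their inverse limits\<close>

definition graph :: "'v set \<Rightarrow> ('v \<times> 'v) set \<Rightarrow> bool" where
  "graph V E \<longleftrightarrow> finite V \<and> E \<subseteq> V \<times> V \<and>
     (\<forall>v\<in>V. (\<exists>u. (u, v) \<in> E) \<and> (\<exists>w. (v, w) \<in> E))"

definition graph_homomorphism ::
    "'v set \<Rightarrow> ('v \<times> 'v) set \<Rightarrow> 'w set \<Rightarrow> ('w \<times> 'w) set \<Rightarrow> ('v \<Rightarrow> 'w) \<Rightarrow> bool" where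
  "graph_homomorphism V1 E1 V2 E2 f \<longleftrightarrow>
     f ` V1 \<subseteq> V2 \<and> (\<forall>(u, v)\<in>E1. (f u, f v) \<in> E2)"

definition cover ::
    "'v set \<Rightarrow> ('v \<times> 'v) set \<Rightarrow> 'w set \<Rightarrow> ('w \<times> 'w) set \<Rightarrow> ('v \<Rightarrow> 'w) \<Rightarrow> bool" where
  "cover V1 E1 V2 E2 f \<longleftrightarrow>
     graph_homomorphism V1 E1 V2 E2 f \<and>
     map_prod f f ` E1 = E2 \<and>
     (\<forall>u v v'. (u, v) \<in> E1 \<and> (u, v') \<in> E1 \<longrightarrow> f v = f v')"

text \<open>\<open>cov_map G (Suc n)\<close> is the cover from level \<open>Suc n\<close> to level \<open>n\<close>;
  \<open>cov_map G 0\<close> is not used.\<close>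

record 'v graph_seq =
  cov_verts :: "nat \<Rightarrow> 'v set"
  cov_edges :: "nat \<Rightarrow> ('v \<times> 'v) set"
  cov_map :: "nat \<Rightarrow> 'v \<Rightarrow> 'v"

definition graph_covering :: "'v graph_seq \<Rightarrow> bool" where
  "graph_covering G \<longleftrightarrow>
     (\<forall>n. graph (cov_verts G n) (cov_edges G n)) \<and>
     (\<exists>v0. cov_verts G 0 = {v0} \<and> cov_edges G 0 = {(v0, v0)}) \<and>
     (\<forall>n. cover (cov_verts G (Suc n)) (cov_edges G (Suc n)) (cov_verts G n) (cov_edges G n)
            (cov_map G (Suc n)))"

text \<open>\<open>cov_comp G n m\<close> maps level \<open>m\<close> to level \<open>n\<close>, for \<open>m > n\<close>.\<close>

primrec cov_comp :: "'v graph_seq \<Rightarrow> nat \<Rightarrow> nat \<Rightarrow> 'v \<Rightarrow> 'v" where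
  "cov_comp G n 0 = id"
| "cov_comp G n (Suc m) = (if n \<le> m then cov_comp G n m \<circ> cov_map G (Suc m) else id)"

definition inverse_limit :: "'v graph_seq \<Rightarrow> (nat \<Rightarrow> 'v) set" where
  "inverse_limit G =
     {x. \<forall>i. x i \<in> cov_verts G i \<and> x i = cov_map G (Suc i) (x (Suc i))}"

definition inverse_limit_topology :: "'v graph_seq \<Rightarrow> (nat \<Rightarrow> 'v) topology" where
  "inverse_limit_topology G =
     subtopology (product_topology (\<lambda>n. discrete_topology (cov_verts G n)) UNIV)
       (inverse_limit G)"

definition inverse_limit_map :: "'v graph_seq \<Rightarrow> (nat \<Rightarrow> 'v) \<Rightarrow> (nat \<Rightarrow> 'v)" where
  "inverse_limit_map G x =
     (THE y. y \<in> inverse_limit G \<and> (\<forall>i. (x i, y i) \<in> cov_edges G i))"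


section \<open>Gambaudo--Martens coverings\<close>

text \<open>A walk of length \<open>l\<close> is the list of its \<open>l + 1\<close> vertices.\<close>

definition walk :: "'v set \<Rightarrow> ('v \<times> 'v) set \<Rightarrow> 'v list \<Rightarrow> bool" where
  "walk V E w \<longleftrightarrow> w \<noteq> [] \<and> set w \<subseteq> V \<and>
     (\<forall>i. Suc i < length w \<longrightarrow> (w ! i, w ! Suc i) \<in> E)"

definition walk_length :: "'v list \<Rightarrow> nat" where
  "walk_length w = length w - 1"

definition walk_edges :: "'v list \<Rightarrow> ('v \<times> 'v) set" where
  "walk_edges w = {(w ! i, w ! Suc i) | i. Suc i < length w}"

definition circuit :: "'v set \<Rightarrow> ('v \<times> 'v) set \<Rightarrow> 'v list \<Rightarrow> bool" where
  "circuit V E w \<longleftrightarrow>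
     walk V E w \<and> walk_length w \<ge> 1 \<and> hd w = last w \<and> distinct (butlast w)"

text \<open>
  \<open>b n\<close> is the base vertex \<open>v\<^sub>n\<^sub>,\<^sub>0\<close>, \<open>r n\<close> the number of circuits, and \<open>c n i ! j\<close> is
  \<open>v\<^sub>n\<^sub>,\<^sub>i\<^sub>,\<^sub>j\<close> for \<open>1 \<le> i \<le> r n\<close> and \<open>j \<le> walk_length (c n i)\<close>.
  The circuits listed all start at \<open>b n\<close>, so ``all circuits of the graph'' is understood
  up to the choice of the starting vertex: the fourth conjunct of \<open>gm_level\<close> says that
  every circuit is a rotation of a listed one.
\<close>

definition gm_level ::
    "'v set \<Rightarrow> ('v \<times> 'v) set \<Rightarrow> 'v \<Rightarrow> nat \<Rightarrow> (nat \<Rightarrow> 'v list) \<Rightarrow> bool" where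
  "gm_level V E b r c \<longleftrightarrow>
     b \<in> V \<and>
     (\<forall>i\<in>{1..r}. circuit V E (c i) \<and> hd (c i) = b) \<and>
     inj_on c {1..r} \<and>
     (\<forall>d. circuit V E d \<longrightarrow> (\<exists>i\<in>{1..r}. \<exists>k. butlast d = rotate k (butlast (c i)))) \<and>
     (\<Union>i\<in>{1..r}. walk_edges (c i)) = E \<and>
     (\<forall>i\<in>{1..r}. \<forall>i'\<in>{1..r}. \<forall>j\<in>{1..walk_length (c i)}. \<forall>j'\<in>{1..walk_length (c i')}.
        c i ! j = c i' ! j' \<longrightarrow>
          walk_length (c i) - j = walk_length (c i') - j' \<and>
          (\<forall>k\<le>walk_length (c i) - j. c i ! (j + k) = c i' ! (j' + k)))"

text \<open>At level \<open>0\<close> only \<open>b 0\<close> and \<open>c 0 1\<close> are used, to encode the convention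
  \<open>v\<^sub>0\<^sub>,\<^sub>0 = v\<^sub>0\<^sub>,\<^sub>1\<^sub>,\<^sub>1 = v\<^sub>0\<close>.\<close>

definition gm_covering ::
    "'v graph_seq \<Rightarrow> (nat \<Rightarrow> 'v) \<Rightarrow> (nat \<Rightarrow> nat) \<Rightarrow> (nat \<Rightarrow> nat \<Rightarrow> 'v list) \<Rightarrow> bool" where
  "gm_covering G b r c \<longleftrightarrow>
     graph_covering G \<and>
     cov_verts G 0 = {b 0} \<and> c 0 1 = [b 0, b 0] \<and>
     (\<forall>n>0. gm_level (cov_verts G n) (cov_edges G n) (b n) (r n) (c n)) \<and>
     (\<forall>n. cov_map G (Suc n) (b (Suc n)) = b n) \<and>
     (\<forall>n. \<forall>i\<in>{1..r (Suc n)}. cov_map G (Suc n) (c (Suc n) i ! 1) = c n 1 ! 1)"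

definition gm_simple ::
    "'v graph_seq \<Rightarrow> (nat \<Rightarrow> nat) \<Rightarrow> (nat \<Rightarrow> nat \<Rightarrow> 'v list) \<Rightarrow> bool" where
  "gm_simple G r c \<longleftrightarrow>
     (\<forall>n>0. \<exists>m>n. \<forall>i\<in>{1..r m}.
        walk_edges (map (cov_comp G n m) (c m i)) = cov_edges G n)"

definition gm_rank :: "(nat \<Rightarrow> nat) \<Rightarrow> enat" where
  "gm_rank r = liminf (\<lambda>n. enat (r n))"

text \<open>
  Vertices may be taken in \<open>nat\<close> because all graphs are finite. For a minimal
  zero-dimensional system the set of ranks is nonempty (Gambaudo--Martens), and since \<open>enat\<close>
  is well-ordered its infimum is then its minimum.
\<close>

definition topological_rank :: "'x topology \<Rightarrow> ('x \<Rightarrow> 'x) \<Rightarrow> enat" where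
  "topological_rank T f = Inf {gm_rank r | (G :: nat graph_seq) b r c.
     gm_covering G b r c \<and> gm_simple G r c \<and>
     topologically_conjugate (inverse_limit_topology G) (inverse_limit_map G) T f}"


section \<open>Ordered Bratteli diagrams and the Vershik map\<close>

text \<open>
  The edge levels are shifted by one: \<open>br_edges B n\<close> is the set \<open>E\<^sub>n\<^sub>+\<^sub>1\<close> of edges from
  level \<open>n\<close> to level \<open>Suc n\<close>, and \<open>x n\<close> is the entry \<open>e\<^sub>n\<^sub>+\<^sub>1\<close> of an infinite path \<open>x\<close>.
  \<open>br_ord B n v\<close> is the (reflexive) linear order on the edges from level \<open>n\<close> with range \<open>v\<close>.
\<close>

record ('v, 'e) bratteli =
  br_verts :: "nat \<Rightarrow> 'v set"
  br_edges :: "nat \<Rightarrow> 'e set"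
  br_src :: "nat \<Rightarrow> 'e \<Rightarrow> 'v"
  br_rng :: "nat \<Rightarrow> 'e \<Rightarrow> 'v"
  br_ord :: "nat \<Rightarrow> 'v \<Rightarrow> ('e \<times> 'e) set"

definition br_fiber :: "('v, 'e) bratteli \<Rightarrow> nat \<Rightarrow> 'v \<Rightarrow> 'e set" where
  "br_fiber B n v = {e \<in> br_edges B n. br_rng B n e = v}"

definition bratteli_diagram :: "('v, 'e) bratteli \<Rightarrow> bool" where
  "bratteli_diagram B \<longleftrightarrow>
     (\<exists>v0. br_verts B 0 = {v0}) \<and>
     (\<forall>n. finite (br_verts B n) \<and> br_verts B n \<noteq> {}) \<and>
     (\<forall>n. finite (br_edges B n) \<and> br_edges B n \<noteq> {}) \<and>
     (\<forall>n. br_src B n ` br_edges B n \<subseteq> br_verts B n) \<and>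
     (\<forall>n. br_rng B n ` br_edges B n \<subseteq> br_verts B (Suc n)) \<and>
     (\<forall>n. \<forall>v\<in>br_verts B n. \<exists>e\<in>br_edges B n. br_src B n e = v) \<and>
     (\<forall>n. \<forall>v\<in>br_verts B (Suc n). \<exists>e\<in>br_edges B n. br_rng B n e = v)"

definition ordered_bratteli :: "('v, 'e) bratteli \<Rightarrow> bool" where
  "ordered_bratteli B \<longleftrightarrow>
     bratteli_diagram B \<and>
     (\<forall>n. \<forall>v\<in>br_verts B (Suc n). linear_order_on (br_fiber B n v) (br_ord B n v))"

definition br_rank :: "('v, 'e) bratteli \<Rightarrow> enat" where
  "br_rank B = liminf (\<lambda>n. enat (card (br_verts B n)))"

text \<open>\<open>p\<close> is a path from a vertex of level \<open>m\<close> to a vertex of level \<open>n\<close>, for \<open>m < n\<close>. Such paths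
  are the edges between consecutive levels \<open>m\<close> and \<open>n\<close> of a telescoped diagram.\<close>

definition br_path ::
    "('v, 'e) bratteli \<Rightarrow> nat \<Rightarrow> 'v \<Rightarrow> nat \<Rightarrow> 'v \<Rightarrow> 'e list \<Rightarrow> bool" where
  "br_path B m u n v p \<longleftrightarrow>
     m < n \<and> length p = n - m \<and>
     (\<forall>i<n - m. p ! i \<in> br_edges B (m + i)) \<and>
     (\<forall>i. Suc i < n - m \<longrightarrow> br_rng B (m + i) (p ! i) = br_src B (m + Suc i) (p ! Suc i)) \<and>
     br_src B m (hd p) = u \<and> br_rng B (n - 1) (last p) = v"

definition br_simple :: "('v, 'e) bratteli \<Rightarrow> bool" where
  "br_simple B \<longleftrightarrow>
     (\<exists>k. strict_mono k \<and> k 0 = 0 \<and>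
        (\<forall>n. \<forall>u\<in>br_verts B (k n). \<forall>v\<in>br_verts B (k (Suc n)).
           \<exists>p. br_path B (k n) u (k (Suc n)) v p))"

definition path_space :: "('v, 'e) bratteli \<Rightarrow> (nat \<Rightarrow> 'e) set" where
  "path_space B =
     {x. \<forall>n. x n \<in> br_edges B n \<and> br_rng B n (x n) = br_src B (Suc n) (x (Suc n))}"

definition path_space_topology :: "('v, 'e) bratteli \<Rightarrow> (nat \<Rightarrow> 'e) topology" where
  "path_space_topology B =
     subtopology (product_topology (\<lambda>n. discrete_topology (br_edges B n)) UNIV) (path_space B)"

definition max_edge :: "('v, 'e) bratteli \<Rightarrow> nat \<Rightarrow> 'e \<Rightarrow> bool" where
  "max_edge B n e \<longleftrightarrow> e \<in> br_edges B n \<and>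
     (\<forall>e'\<in>br_fiber B n (br_rng B n e). (e', e) \<in> br_ord B n (br_rng B n e))"

definition min_edge :: "('v, 'e) bratteli \<Rightarrow> nat \<Rightarrow> 'e \<Rightarrow> bool" where
  "min_edge B n e \<longleftrightarrow> e \<in> br_edges B n \<and>
     (\<forall>e'\<in>br_fiber B n (br_rng B n e). (e, e') \<in> br_ord B n (br_rng B n e))"

definition succ_edge :: "('v, 'e) bratteli \<Rightarrow> nat \<Rightarrow> 'e \<Rightarrow> 'e \<Rightarrow> bool" where
  "succ_edge B n e f \<longleftrightarrow>
     (let v = br_rng B n e in
        f \<in> br_fiber B n v \<and> f \<noteq> e \<and> (e, f) \<in> br_ord B n v \<and>
        (\<forall>g\<in>br_fiber B n v. g \<noteq> e \<and> (e, g) \<in> br_ord B n v \<longrightarrow> (f, g) \<in> br_ord B n v))"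

definition max_path :: "('v, 'e) bratteli \<Rightarrow> (nat \<Rightarrow> 'e) \<Rightarrow> bool" where
  "max_path B x \<longleftrightarrow> x \<in> path_space B \<and> (\<forall>n. max_edge B n (x n))"

definition min_path :: "('v, 'e) bratteli \<Rightarrow> (nat \<Rightarrow> 'e) \<Rightarrow> bool" where
  "min_path B x \<longleftrightarrow> x \<in> path_space B \<and> (\<forall>n. min_edge B n (x n))"

definition properly_ordered :: "('v, 'e) bratteli \<Rightarrow> bool" where
  "properly_ordered B \<longleftrightarrow>
     ordered_bratteli B \<and> br_simple B \<and> (\<exists>!x. max_path B x) \<and> (\<exists>!x. min_path B x)"

text \<open>In the second case \<open>y \<in> path_space B\<close> and minimality of \<open>y 0, \<dots>, y (n - 1)\<close> say that these
  edges form the minimal path from the top vertex to the source of the edge \<open>y n\<close>.\<close>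

definition vershik_map :: "('v, 'e) bratteli \<Rightarrow> (nat \<Rightarrow> 'e) \<Rightarrow> (nat \<Rightarrow> 'e)" where
  "vershik_map B x =
     (if max_path B x then (THE y. min_path B y)
      else let n = (LEAST n. \<not> max_edge B n (x n)) in
        (THE y. y \<in> path_space B \<and> (\<forall>i<n. min_edge B i (y i)) \<and>
                succ_edge B n (x n) (y n) \<and> (\<forall>i>n. y i = x i)))"

text \<open>For a minimal homeomorphic zero-dimensional system the set of ranks is nonempty
  (Herman--Putnam--Skau), so again the infimum is a minimum.\<close>

definition bratteli_topological_rank :: "'x topology \<Rightarrow> ('x \<Rightarrow> 'x) \<Rightarrow> enat" where
  "bratteli_topological_rank T f = Inf {br_rank B | (B :: (nat, nat) bratteli).
     properly_ordered B \<and>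
     topologically_conjugate (path_space_topology B) (vershik_map B) T f}"

end

theory Submission
  imports Defs
begin

text \<open>
  Both ranks measure the same thing. Call a minimal subshift, one-sided or two-sided,
  \<open>K\<close>-good if it has a decreasing sequence of clopen sets that shrinks to one point and
  contains infinitely many sets with at most \<open>K\<close> return words
  (\<open>few_return_words\<close>).

  For a one-sided subshift this says that the rank defined by coverings is at most \<open>K\<close>.
  In a covering, the points over the base vertex of level \<open>n\<close> return along one of the
  \<open>r n\<close> circuits, which for large \<open>n\<close> determines the return word
  (\<open>few_return_words_of_covering\<close>). Conversely, the words that are read until such a
  clopen set is entered are the vertices of a graph whose circuits are the return words, and these
  graphs form a covering if each set is small compared with its predecessor
  (\<open>topological_rank_le\<close>).

  For a two-sided subshift it says that the rank defined by Bratteli diagrams is at most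
  \<open>K\<close>. In a diagram, the paths with \<open>n\<close> minimal edges at the beginning
  return in at most as many ways as there are vertices at level \<open>n\<close>
  (\<open>few_return_words_of_bratteli\<close>). Conversely, the towers over the clopen sets are the
  vertices of a diagram whose edges describe how towers of one level are stacked in those of the
  next one (\<open>bratteli_topological_rank_le\<close>).

  It remains to compare a two-sided subshift with its one-sided factor. A clopen set of the factor
  whose points begin with a long common word is moved along this word, which turns a known beginning
  into a known past; the return words are conjugated (\<open>few_return_words_two_sided\<close>).
  This gives the first claim. The other direction (\<open>few_return_words_one_sided\<close>) has to
  replace a clopen set whose visits depend on the past by one that the future can see. Two points
  with the same future visit the set at the same times in the far future, so they can only differ in
  how the word before is divided into return words, and this happens only if one return word is a
  suffix of another. The defect argument of combinatorics on words removes this: cutting off such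
  suffixes until none is left does not increase the number of words
  (\<open>card_irreducibles_suffix_hull\<close>), and the points at which the new words start
  still have a long beginning in common (\<open>suffix_hull_common_prefix\<close>).

  Over a countable type of letters the two ranks therefore coincide, and for the second claim it
  suffices to rename the letters by natural numbers.
\<close>


section \<open>Topology of sequence spaces\<close>

definition agree_on :: "'i set \<Rightarrow> ('i \<Rightarrow> 'a) \<Rightarrow> ('i \<Rightarrow> 'a) \<Rightarrow> bool" where
  "agree_on F x y \<longleftrightarrow> (\<forall>i\<in>F. x i = y i)"

abbreviation seq_topology :: "('i \<Rightarrow> 'a set) \<Rightarrow> ('i \<Rightarrow> 'a) set \<Rightarrow> ('i \<Rightarrow> 'a) topology" where
  "seq_topology D X \<equiv> subtopology (product_topology (\<lambda>i. discrete_topology (D i)) UNIV) X"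

lemma topspace_seq_topology:
  assumes "X \<subseteq> Pi UNIV D"
  shows "topspace (seq_topology D X) = X"
  using assms by (auto simp: topspace_product_topology PiE_def)

lemma Hausdorff_seq_topology: "Hausdorff_space (seq_topology D X)"
  by (intro Hausdorff_space_subtopology) (simp add: Hausdorff_space_product_topology)

text \<open>
  The cylinders over finite sets of coordinates form a basis. In this form openness turns into a
  combinatorial condition on sequences.
\<close>

lemma openin_seq_topology_iff:
  assumes X: "X \<subseteq> Pi UNIV D"
  shows "openin (seq_topology D X) U \<longleftrightarrow>
    U \<subseteq> X \<and> (\<forall>x\<in>U. \<exists>F. finite F \<and> (\<forall>y\<in>X. agree_on F x y \<longrightarrow> y \<in> U))" (is "?L \<longleftrightarrow> ?R")
proof
  assume ?L
  then obtain W where W: "openin (product_topology (\<lambda>i. discrete_topology (D i)) UNIV) W" "U = W \<inter> X"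
    by (auto simp: openin_subtopology)
  show ?R
  proof (intro conjI ballI)
    show "U \<subseteq> X" using W by auto
    fix x assume "x \<in> U"
    then have "x \<in> W" "x \<in> X" using W by auto
    then obtain V where V: "finite {i \<in> UNIV. V i \<noteq> topspace (discrete_topology (D i))}"
      "x \<in> PiE UNIV V" "PiE UNIV V \<subseteq> W"
      using W(1) unfolding openin_product_topology_alt by meson
    let ?F = "{i. V i \<noteq> D i}"
    have "finite ?F" using V(1) by simp
    moreover have "y \<in> U" if y: "y \<in> X" "agree_on ?F x y" for y
    proof -
      have "y i \<in> V i" for i
      proof (cases "V i = D i")
        case True
        then show ?thesis using X y(1) by auto
      next
        case False
        then have "x i = y i" using y(2) by (simp add: agree_on_def)
        moreover have "x i \<in> V i" using V(2) by auto
        ultimately show ?thesis by simp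
      qed
      then have "y \<in> PiE UNIV V" by auto
      then show ?thesis using V(3) W(2) y(1) by auto
    qed
    ultimately show "\<exists>F. finite F \<and> (\<forall>y\<in>X. agree_on F x y \<longrightarrow> y \<in> U)" by blast
  qed
next
  assume R: ?R
  have "\<exists>W. openin (seq_topology D X) W \<and> x \<in> W \<and> W \<subseteq> U" if x: "x \<in> U" for x
  proof -
    obtain F where F: "finite F" "\<forall>y\<in>X. agree_on F x y \<longrightarrow> y \<in> U" using R x by blast
    have xX: "x \<in> X" using R x by blast
    define V where "V i = (if i \<in> F then {x i} else D i)" for i
    have "openin (product_topology (\<lambda>i. discrete_topology (D i)) UNIV) (PiE UNIV V)"
      unfolding openin_product_topology_alt
    proof (intro ballI exI[of _ V] conjI allI impI)
      fix z assume "z \<in> PiE UNIV V"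
      have "{i \<in> UNIV. V i \<noteq> topspace (discrete_topology (D i))} \<subseteq> F" by (auto simp: V_def)
      then show "finite {i \<in> UNIV. V i \<noteq> topspace (discrete_topology (D i))}"
        using F(1) finite_subset by blast
    qed (use subsetD[OF X xX] in \<open>auto simp: V_def Pi_iff\<close>)
    then have "openin (seq_topology D X) (PiE UNIV V \<inter> X)"
      by (rule openin_subtopology_Int)
    moreover have "x \<in> PiE UNIV V \<inter> X" using xX subsetD[OF X xX] by (auto simp: V_def Pi_iff)
    moreover have "PiE UNIV V \<inter> X \<subseteq> U"
    proof
      fix y assume y: "y \<in> PiE UNIV V \<inter> X"
      have "agree_on F x y" unfolding agree_on_def
      proof
        fix i assume "i \<in> F"
        have "y i \<in> V i" using y by auto
        then show "x i = y i" using \<open>i \<in> F\<close> by (simp add: V_def)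
      qed
      then show "y \<in> U" using F y by blast
    qed
    ultimately show ?thesis by blast
  qed
  then show ?L by (subst openin_subopen) blast
qed

lemma continuous_map_discrete_iff:
  "continuous_map T (discrete_topology D) f \<longleftrightarrow>
     f ` topspace T \<subseteq> D \<and> (\<forall>v. openin T {x \<in> topspace T. f x = v})" (is "?L \<longleftrightarrow> ?R")
proof
  assume L: ?L
  have "openin T {x \<in> topspace T. f x = v}" for v
  proof (cases "v \<in> D")
    case True
    then have "openin T {x \<in> topspace T. f x \<in> {v}}"
      using L by (intro openin_continuous_map_preimage[OF L]) auto
    then show ?thesis by simp
  next
    case False
    then have e: "{x \<in> topspace T. f x = v} = {}" using L by (auto simp: continuous_map_def)
    show ?thesis unfolding e by simp
  qed
  then show ?R using L by (auto simp: continuous_map_def)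
next
  assume R: ?R
  have "openin T {x \<in> topspace T. f x \<in> V}" for V
  proof -
    have "{x \<in> topspace T. f x \<in> V} = (\<Union>v\<in>V. {x \<in> topspace T. f x = v})" by auto
    then show ?thesis using R by (auto intro!: openin_Union)
  qed
  then show ?L using R by (auto simp: continuous_map_def)
qed

lemma continuous_map_seq_topology_iff:
  assumes X: "X \<subseteq> Pi UNIV D"
  shows "continuous_map T (seq_topology D X) f \<longleftrightarrow>
    f ` topspace T \<subseteq> X \<and> (\<forall>i v. openin T {x \<in> topspace T. f x i = v})"
  using X by (auto simp: continuous_map_in_subtopology continuous_map_componentwise_UNIV
    continuous_map_discrete_iff image_subset_iff subset_iff)

lemma compact_space_finite_subcover:
  assumes comp: "compact_space T" and C: "\<And>x. x \<in> topspace T \<Longrightarrow> openin T (C x) \<and> x \<in> C x"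
  shows "\<exists>Y. finite Y \<and> Y \<subseteq> topspace T \<and> topspace T \<subseteq> (\<Union>x\<in>Y. C x)"
proof -
  have "(\<forall>U\<in>C ` topspace T. openin T U) \<and> topspace T \<subseteq> \<Union>(C ` topspace T)" using C by blast
  then obtain \<F> where "finite \<F>" "\<F> \<subseteq> C ` topspace T" "topspace T \<subseteq> \<Union>\<F>"
    using comp unfolding compact_space_alt by meson
  then show ?thesis using finite_subset_image[of \<F> C "topspace T"] by metis
qed

text \<open>Compactness turns local constancy into dependence on one finite set of coordinates.\<close>

lemma uniform_window:
  assumes X: "X \<subseteq> Pi UNIV D"
    and comp: "compact_space (seq_topology D X)"
    and loc: "\<And>v. openin (seq_topology D X) {x \<in> X. g x = v}"
  obtains F where "finite F" "\<And>x y. x \<in> X \<Longrightarrow> y \<in> X \<Longrightarrow> agree_on F x y \<Longrightarrow> g x = g y"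
proof -
  let ?T = "seq_topology D X"
  have ts: "topspace ?T = X" by (rule topspace_seq_topology[OF X])
  have "\<exists>F. finite F \<and> (\<forall>y\<in>X. agree_on F x y \<longrightarrow> g y = g x)" if "x \<in> X" for x
    using loc[of "g x", unfolded openin_seq_topology_iff[OF X]] that by simp
  then obtain F where F: "\<And>x. x \<in> X \<Longrightarrow> finite (F x)"
    "\<And>x y. x \<in> X \<Longrightarrow> y \<in> X \<Longrightarrow> agree_on (F x) x y \<Longrightarrow> g y = g x"
    by metis
  define C where "C x = {y \<in> X. agree_on (F x) x y}" for x
  have op: "openin ?T (C x)" if "x \<in> X" for x
    unfolding openin_seq_topology_iff[OF X] C_def
    using F(1)[OF that] by (auto simp: agree_on_def intro!: exI[of _ "F x"])
  have "x \<in> C x" if "x \<in> X" for x using that by (simp add: C_def agree_on_def)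
  then obtain Y where Y: "finite Y" "Y \<subseteq> X" "X \<subseteq> (\<Union>x\<in>Y. C x)"
    using compact_space_finite_subcover[OF comp, of C, unfolded ts] op by auto
  let ?F = "\<Union>x\<in>Y. F x"
  have "finite ?F" using Y F(1) by auto
  moreover have "g x = g y" if "x \<in> X" "y \<in> X" "agree_on ?F x y" for x y
  proof -
    obtain z where z: "z \<in> Y" "x \<in> C z" using Y(3) \<open>x \<in> X\<close> by blast
    have "agree_on (F z) z x" using z by (simp add: C_def)
    moreover from this have "agree_on (F z) z y" using that z by (auto simp: agree_on_def)
    ultimately show ?thesis using F(2) z Y(2) that by (metis subsetD)
  qed
  ultimately show thesis using that by blast
qed

lemma finite_range_locally_constant:
  assumes comp: "compact_space T" and loc: "\<And>v. openin T {x \<in> topspace T. g x = v}"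
  shows "finite (g ` topspace T)"
proof -
  have "continuous_map T (discrete_topology (g ` topspace T)) g"
    using loc by (simp add: continuous_map_discrete_iff)
  then have "compactin (discrete_topology (g ` topspace T)) (g ` topspace T)"
    using comp image_compactin compact_space_def by blast
  then show ?thesis unfolding compactin_discrete_topology by blast
qed


lemma bounded_value_recurs:
  fixes l :: "nat \<Rightarrow> nat"
  assumes "\<And>n. l n \<le> K" shows "\<exists>i. \<forall>n. \<exists>m\<ge>n. l m = i"
proof -
  have "finite (range l)" using assms by (intro finite_subset[OF _ finite_atMost[of K]]) blast
  then obtain m where "infinite {n. l n = l m}" using pigeonhole_infinite[OF infinite_UNIV_nat] by auto
  then show ?thesis by (intro exI[of _ "l m"]) (simp add: infinite_nat_iff_unbounded_le)
qed


section \<open>Minimal systems\<close>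

lemma funpow_in_space:
  assumes "f ` X \<subseteq> X" "x \<in> X" shows "(f ^^ n) x \<in> X"
  using assms by (induction n) auto

lemma continuous_map_funpow:
  "continuous_map T T f \<Longrightarrow> continuous_map T T (f ^^ n)"
  by (induction n) (auto intro: continuous_map_compose simp: id_def)

lemma openin_funpow_preimage:
  "continuous_map T T f \<Longrightarrow> openin T U \<Longrightarrow> openin T {x \<in> topspace T. (f ^^ n) x \<in> U}"
  by (rule openin_continuous_map_preimage[OF continuous_map_funpow])

lemma minimal_system_image:
  assumes min: "minimal_system T f" and f: "f ` topspace T \<subseteq> topspace T"
    and cont: "continuous_map T T' h" and surj: "h ` topspace T = topspace T'"
    and comm: "\<And>x. x \<in> topspace T \<Longrightarrow> h (f x) = g (h x)"
  shows "minimal_system T' g"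
  unfolding minimal_system_def
proof (intro conjI allI impI)
  have "topspace T \<noteq> {}" using min unfolding minimal_system_def by blast
  then show "topspace T' \<noteq> {}" unfolding surj[symmetric] by blast
  fix C assume C: "closedin T' C \<and> g ` C \<subseteq> C"
  define P where "P = {x \<in> topspace T. h x \<in> C}"
  have "closedin T P" unfolding P_def using C cont closedin_continuous_map_preimage by blast
  moreover have "f ` P \<subseteq> P"
  proof
    fix y assume "y \<in> f ` P"
    then obtain x where x: "x \<in> topspace T" "h x \<in> C" "y = f x" by (auto simp: P_def)
    then have "y \<in> topspace T" "h y \<in> C" using f C comm[of x] by auto
    then show "y \<in> P" by (simp add: P_def)
  qed
  ultimately have "P = {} \<or> P = topspace T" using min unfolding minimal_system_def by blast
  moreover have "C \<subseteq> h ` topspace T" using closedin_subset[of T' C] C surj by simp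
  then have C_eq: "C = h ` P" unfolding P_def by blast
  ultimately show "C = {} \<or> C = topspace T'" using surj by auto
qed

text \<open>The points whose forward orbit avoids \<open>W\<close> form a closed invariant set.\<close>

lemma minimal_visits:
  assumes min: "minimal_system T f" and cont: "continuous_map T T f"
    and W: "openin T W" "W \<noteq> {}" and x: "x \<in> topspace T"
  obtains k where "(f ^^ k) x \<in> W"
proof -
  define C where "C = {x \<in> topspace T. \<forall>k. (f ^^ k) x \<notin> W}"
  have C: "C = topspace T - (\<Union>k. {x \<in> topspace T. (f ^^ k) x \<in> W})" by (auto simp: C_def)
  have "closedin T C"
    unfolding C by (intro closedin_diff closedin_topspace openin_Union)
      (auto intro: openin_funpow_preimage[OF cont W(1)])
  moreover have "f ` C \<subseteq> C"
  proof
    fix y assume "y \<in> f ` C"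
    then obtain z where z: "z \<in> C" "y = f z" by blast
    have "(f ^^ k) (f z) \<notin> W" for k
      using z(1) unfolding C_def by (metis (mono_tags, lifting) funpow_Suc_right comp_apply mem_Collect_eq)
    moreover have "f z \<in> topspace T" using z(1) cont by (auto simp: C_def continuous_map_def)
    ultimately show "y \<in> C" using z by (simp add: C_def)
  qed
  ultimately have "C = {} \<or> C = topspace T" using min by (simp add: minimal_system_def)
  moreover have "C \<noteq> topspace T"
  proof -
    obtain w where "w \<in> W" using W by auto
    then have "w \<in> topspace T" "w \<notin> C" using openin_subset[OF W(1)] by (auto simp: C_def intro: exI[of _ 0])
    then show ?thesis by auto
  qed
  ultimately have "x \<notin> C" by auto
  then show thesis using x that by (auto simp: C_def)
qed

lemma minimal_visits_bounded:
  assumes min: "minimal_system T f" and cont: "continuous_map T T f" and comp: "compact_space T"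
    and W: "openin T W" "W \<noteq> {}"
  obtains M where "\<And>x. x \<in> topspace T \<Longrightarrow> \<exists>k\<le>M. (f ^^ k) x \<in> W"
proof -
  let ?P = "\<lambda>k. {x \<in> topspace T. (f ^^ k) x \<in> W}"
  have "\<exists>k. (f ^^ k) x \<in> W" if "x \<in> topspace T" for x
    using minimal_visits[OF min cont W that] by blast
  then obtain k where k: "\<And>x. x \<in> topspace T \<Longrightarrow> (f ^^ k x) x \<in> W" by metis
  have "openin T (?P (k x)) \<and> x \<in> ?P (k x)" if "x \<in> topspace T" for x
    using k[OF that] that openin_funpow_preimage[OF cont W(1), of "k x"] by simp
  then obtain Y where Y: "finite Y" "Y \<subseteq> topspace T" "topspace T \<subseteq> (\<Union>x\<in>Y. ?P (k x))"
    using compact_space_finite_subcover[OF comp, of "\<lambda>x. ?P (k x)"] by auto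
  have "\<exists>j\<le>Max (k ` Y). (f ^^ j) x \<in> W" if x: "x \<in> topspace T" for x
  proof -
    obtain y where "y \<in> Y" "(f ^^ k y) x \<in> W" using Y(3) x by auto
    then show ?thesis using Y(1) by (intro exI[of _ "k y"]) simp
  qed
  then show thesis by (rule that)
qed

text \<open>
  If the orbit of \<open>p\<close> first meets \<open>W\<close> at time \<open>k\<close>, then
  \<open>p\<close> is different from \<open>(f ^^ i) p\<close> for \<open>1 \<le> i \<le> k\<close>,
  because otherwise \<open>W\<close> would be met at time \<open>k - i\<close>. So a small
  neighbourhood of \<open>p\<close> returns to itself only after time \<open>k\<close>. This
  argument also covers periodic points.
\<close>

lemma visit_before_return:
  assumes min: "minimal_system T f" and cont: "continuous_map T T f" and haus: "Hausdorff_space T"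
    and p: "p \<in> topspace T" and W: "openin T W" "W \<noteq> {}"
  obtains U where "openin T U" "p \<in> U"
    "\<And>y t. y \<in> U \<Longrightarrow> t > 0 \<Longrightarrow> (f ^^ t) y \<in> U \<Longrightarrow> \<exists>i<t. (f ^^ i) y \<in> W"
proof -
  define k where "k = (LEAST k. (f ^^ k) p \<in> W)"
  have k: "(f ^^ k) p \<in> W" unfolding k_def by (rule minimal_visits[OF min cont W p]) (rule LeastI)
  have fs: "f ` topspace T \<subseteq> topspace T" using cont by (auto simp: continuous_map_def)
  have ne: "(f ^^ i) p \<noteq> p" if "i \<in> {1..k}" for i
  proof
    assume "(f ^^ i) p = p"
    then have "(f ^^ (k - i)) p = (f ^^ (k - i)) ((f ^^ i) p)" by simp
    also have "\<dots> = (f ^^ k) p" using that by (metis atLeastAtMost_iff comp_apply funpow_add le_add_diff_inverse2)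
    finally have "k \<le> k - i" unfolding k_def using k[unfolded k_def] by (simp add: Least_le)
    then show False using that by auto
  qed
  have "\<exists>P Q. openin T P \<and> openin T Q \<and> p \<in> P \<and> (f ^^ i) p \<in> Q \<and> disjnt P Q" if "i \<in> {1..k}" for i
    using haus p ne[OF that] funpow_in_space[OF fs p, of i] unfolding Hausdorff_space_def by metis
  then obtain P Q where PQ: "\<And>i. i \<in> {1..k} \<Longrightarrow>
    openin T (P i) \<and> openin T (Q i) \<and> p \<in> P i \<and> (f ^^ i) p \<in> Q i \<and> disjnt (P i) (Q i)" by metis
  define U where "U = {x \<in> topspace T. (f ^^ k) x \<in> W} \<inter>
     ((\<Inter>i\<in>{1..k}. P i \<inter> {x \<in> topspace T. (f ^^ i) x \<in> Q i}) \<inter> topspace T)"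
  have "openin T U"
  proof (cases "k = 0")
    case True
    then show ?thesis unfolding U_def using openin_funpow_preimage[OF cont W(1), of k]
      by (simp add: openin_Int)
  next
    case False
    show ?thesis unfolding U_def
      using PQ openin_funpow_preimage[OF cont] W(1) False
      by (intro openin_Int openin_INT openin_topspace) auto
  qed
  moreover have "p \<in> U" using p k PQ by (auto simp: U_def)
  moreover have "\<exists>i<t. (f ^^ i) y \<in> W" if "y \<in> U" "t > 0" "(f ^^ t) y \<in> U" for y t
  proof (cases "t \<le> k")
    case True
    then have t: "t \<in> {1..k}" using that by auto
    have "(f ^^ t) y \<in> P t" "(f ^^ t) y \<in> Q t" using that t by (auto simp: U_def)
    then have False using PQ[OF t] by (auto simp: disjnt_def)
    then show ?thesis ..
  next
    case False
    then show ?thesis using that by (auto simp: U_def intro!: exI[of _ k])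
  qed
  ultimately show thesis using that by blast
qed

text \<open>
  This is where simple coverings and simple diagrams come from: every word that occurs at all occurs
  in each return word of a small set.
\<close>

lemma visit_all_before_return:
  assumes min: "minimal_system T f" and cont: "continuous_map T T f" and haus: "Hausdorff_space T"
    and p: "p \<in> topspace T" and fin: "finite \<W>" and W: "\<And>W. W \<in> \<W> \<Longrightarrow> openin T W \<and> W \<noteq> {}"
  shows "\<exists>U. openin T U \<and> p \<in> U \<and>
    (\<forall>y t W. y \<in> U \<longrightarrow> t > 0 \<longrightarrow> (f ^^ t) y \<in> U \<longrightarrow> W \<in> \<W> \<longrightarrow> (\<exists>i<t. (f ^^ i) y \<in> W))"
proof -
  have "\<exists>U. openin T U \<and> p \<in> U \<and>
    (\<forall>y t. y \<in> U \<longrightarrow> t > 0 \<longrightarrow> (f ^^ t) y \<in> U \<longrightarrow> (\<exists>i<t. (f ^^ i) y \<in> W))" if "W \<in> \<W>" for W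
    by (rule visit_before_return[OF min cont haus p W[OF that, THEN conjunct1] W[OF that, THEN conjunct2]]) blast
  then obtain U where U: "\<And>W. W \<in> \<W> \<Longrightarrow> openin T (U W) \<and> p \<in> U W \<and>
    (\<forall>y t. y \<in> U W \<longrightarrow> t > 0 \<longrightarrow> (f ^^ t) y \<in> U W \<longrightarrow> (\<exists>i<t. (f ^^ i) y \<in> W))" by metis
  let ?U = "topspace T \<inter> \<Inter>(U ` \<W>)"
  have "openin T ?U" using fin U by (auto intro!: openin_Int_Inter)
  moreover have "p \<in> ?U" using p U by auto
  moreover have "\<exists>i<t. (f ^^ i) y \<in> W" if "y \<in> ?U" "t > 0" "(f ^^ t) y \<in> ?U" "W \<in> \<W>" for y t W
  proof -
    have "y \<in> U W" "(f ^^ t) y \<in> U W" using that by auto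
    then show ?thesis using U[OF that(4)] that(2) by blast
  qed
  ultimately show ?thesis by (intro exI[of _ ?U] conjI allI impI)
qed


section \<open>Sets with few return words\<close>

text \<open>
  The coercion \<open>of_nat\<close> lets the definitions of this section serve sequences indexed by
  \<open>int\<close> and by \<open>nat\<close> alike.
\<close>

definition word :: "('i::semiring_1 \<Rightarrow> 'a) \<Rightarrow> nat \<Rightarrow> 'a list" where
  "word x t = map (\<lambda>i. x (of_nat i)) [0..<t]"

definition first_return :: "('x \<Rightarrow> 'x) \<Rightarrow> 'x set \<Rightarrow> 'x \<Rightarrow> nat \<Rightarrow> bool" where
  "first_return f B x t \<longleftrightarrow>
     x \<in> B \<and> t > 0 \<and> (f ^^ t) x \<in> B \<and> (\<forall>j. 0 < j \<and> j < t \<longrightarrow> (f ^^ j) x \<notin> B)"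

definition return_words :: "('i::semiring_1 \<Rightarrow> 'a) set \<Rightarrow> 'a list set" where
  "return_words B = {word x t | x t. first_return shift B x t}"

definition shrinking_sets :: "'x topology \<Rightarrow> (nat \<Rightarrow> 'x set) \<Rightarrow> 'x \<Rightarrow> bool" where
  "shrinking_sets T B p \<longleftrightarrow>
     (\<forall>n. openin T (B n) \<and> closedin T (B n) \<and> B (Suc n) \<subseteq> B n) \<and> (\<Inter>n. B n) = {p}"

text \<open>
  For a minimal subshift this is the common meaning of ``rank at most \<open>K\<close>'' for both
  kinds of rank. Only infinitely many sets of the sequence have few return words, because ranks are
  lower limits.
\<close>

definition few_return_words :: "('i::semiring_1 \<Rightarrow> 'a) topology \<Rightarrow> nat \<Rightarrow> bool" where
  "few_return_words T K \<longleftrightarrow> (\<exists>B p. shrinking_sets T B p \<and>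
     (\<exists>\<^sub>\<infinity>n. finite (return_words (B n)) \<and> card (return_words (B n)) \<le> K))"

lemma funpow_shift: "(shift ^^ n) x = (\<lambda>i. x (i + of_nat n))"
  for x :: "'i::semiring_1 \<Rightarrow> 'a"
  by (induction n arbitrary: x) (auto simp: shift_def add_ac)

lemma length_word [simp]: "length (word x t) = t"
  by (simp add: word_def)

lemma nth_word: "i < t \<Longrightarrow> word x t ! i = x (of_nat i)"
  by (simp add: word_def)

lemma word_0 [simp]: "word x 0 = []"
  by (simp add: word_def)

lemma word_eq_iff: "word x t = word y s \<longleftrightarrow> t = s \<and> (\<forall>i<t. x (of_nat i) = y (of_nat i))"
  by (auto simp: list_eq_iff_nth_eq nth_word) 

lemma word_add: "word x (s + t) = word x s @ word ((shift ^^ s) x) t"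
  by (rule nth_equalityI) (auto simp: nth_append nth_word funpow_shift simp flip: of_nat_add)

lemma drop_word: "j \<le> t \<Longrightarrow> drop j (word x t) = word ((shift ^^ j) x) (t - j)"
  using word_add[of x j "t - j"] by simp

lemma first_return_exists:
  assumes x: "x \<in> B" and t: "t > 0" "(f ^^ t) x \<in> B"
  obtains s where "first_return f B x s" "s \<le> t"
proof -
  define s where "s = (LEAST s. 0 < s \<and> (f ^^ s) x \<in> B)"
  have "0 < s \<and> (f ^^ s) x \<in> B" unfolding s_def by (rule LeastI[of _ t]) (use t in simp)
  moreover have "\<forall>j. 0 < j \<and> j < s \<longrightarrow> (f ^^ j) x \<notin> B" using not_less_Least unfolding s_def by blast
  moreover have "s \<le> t" unfolding s_def by (rule Least_le) (use t in simp)
  ultimately show thesis using x by (intro that[of s]) (simp_all add: first_return_def)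
qed

lemma first_return_unique: "first_return f B x s \<Longrightarrow> first_return f B x t \<Longrightarrow> s = t"
  unfolding first_return_def by (metis linorder_neqE_nat)

lemma first_return_minimal:
  assumes min: "minimal_system T f" and cont: "continuous_map T T f"
    and B: "openin T B" "x \<in> B"
  obtains t where "first_return f B x t"
proof -
  have x: "f x \<in> topspace T" using B openin_subset cont by (fastforce simp: continuous_map_def)
  obtain k where "(f ^^ k) (f x) \<in> B" by (rule minimal_visits[OF min cont B(1) _ x]) (use B in auto)
  then have "(f ^^ Suc k) x \<in> B" by (simp add: funpow_swap1)
  then show thesis using first_return_exists[OF B(2), of "Suc k" f] that by blast
qed

lemma shrinking_setsD:
  assumes "shrinking_sets T B p"
  shows "openin T (B n)" "closedin T (B n)" "m \<le> n \<Longrightarrow> B n \<subseteq> B m" "p \<in> B n" "p \<in> topspace T"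
    "(\<And>n. x \<in> B n) \<Longrightarrow> x = p"
proof -
  show o: "openin T (B n)" "closedin T (B n)"
    using assms by (auto simp: shrinking_sets_def)
  have eq: "(\<Inter>n. B n) = {p}" using assms by (simp add: shrinking_sets_def)
  then have "p \<in> (\<Inter>n. B n)" by simp
  then show pB: "p \<in> B n" by blast
  show "m \<le> n \<Longrightarrow> B n \<subseteq> B m" using lift_Suc_antimono_le[of B] assms
    by (simp add: shrinking_sets_def)
  show "p \<in> topspace T" using openin_subset[OF o(1)] pB by auto
  show "x = p" if "\<And>n. x \<in> B n"
  proof -
    have "x \<in> (\<Inter>n. B n)" using that by blast
    then show ?thesis using eq by simp
  qed
qed

lemma shrinking_sets_in_open:
  assumes comp: "compact_space T" and B: "shrinking_sets T B p" and U: "openin T U" "p \<in> U"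
  shows "\<exists>N. \<forall>n\<ge>N. B n \<subseteq> U"
proof -
  have "\<exists>N. B N \<subseteq> U"
  proof (rule ccontr)
    assume "\<not> ?thesis"
    then have ne: "B n - U \<noteq> {}" for n by blast
    have "(\<Inter>n. B n - U) \<noteq> {}"
      by (rule compact_space_imp_nest[OF comp])
        (use ne shrinking_setsD[OF B] U in \<open>auto intro!: closedin_diff antimonoI dest: subsetD[OF shrinking_setsD(3)[OF B]]\<close>)
    then show False using shrinking_setsD(6)[OF B] U by blast
  qed
  then show ?thesis using shrinking_setsD(3)[OF B] by blast
qed

text \<open>
  Shrinking sets end up in every neighbourhood of \<open>p\<close>. So passing to a subsequence
  makes every set as small as desired compared with its predecessor, and it keeps the return words.
  The whole space is put in front because the level \<open>0\<close> of a covering or of a diagram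
  carries no information.
\<close>

lemma rapidly_shrinking:
  assumes comp: "compact_space T" and C: "shrinking_sets T C p"
    and inf: "\<exists>\<^sub>\<infinity>n. finite (return_words (C n)) \<and> card (return_words (C n)) \<le> K"
    and R: "\<And>D. openin T D \<Longrightarrow> closedin T D \<Longrightarrow> p \<in> D \<Longrightarrow> \<exists>U. openin T U \<and> p \<in> U \<and> (\<forall>E\<subseteq>U. R D E)"
  shows "\<exists>B. shrinking_sets T B p \<and> B 0 = topspace T \<and> (\<forall>n. R (B n) (B (Suc n))) \<and>
    (\<forall>n>0. finite (return_words (B n)) \<and> card (return_words (B n)) \<le> K)"
proof -
  let ?few = "\<lambda>D. finite (return_words D) \<and> card (return_words D) \<le> K"
  note CD = shrinking_setsD[OF C]
  have next_set: "\<exists>m>n. R D (C m) \<and> ?few (C m)" if D: "openin T D" "closedin T D" "p \<in> D" for n D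
  proof -
    obtain U where U: "openin T U" "p \<in> U" "\<forall>E\<subseteq>U. R D E" using R[OF D] by blast
    obtain N where N: "\<forall>n\<ge>N. C n \<subseteq> U" using shrinking_sets_in_open[OF comp C U(1,2)] by blast
    obtain m where "m > max n N" "?few (C m)" using inf unfolding INFM_nat by blast
    then show ?thesis using N U(3) by (intro exI[of _ m]) auto
  qed
  obtain s0 where s0: "?few (C s0)" "R (topspace T) (C s0)"
    using next_set[OF openin_topspace closedin_topspace CD(5)] by blast
  define g where "g n = (SOME m. m > n \<and> R (C n) (C m) \<and> ?few (C m))" for n
  have g: "g n > n \<and> R (C n) (C (g n)) \<and> ?few (C (g n))" for n
    unfolding g_def by (rule someI_ex) (rule next_set[OF CD(1,2,4)])
  define s where "s k = (g ^^ k) s0" for k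
  have s: "?few (C (s 0))" "R (topspace T) (C (s 0))" "\<And>k. ?few (C (s (Suc k)))"
    "\<And>k. s k < s (Suc k)" "\<And>k. R (C (s k)) (C (s (Suc k)))"
    using s0 g by (simp_all add: s_def)
  have sm: "strict_mono s" using s(4) by (simp add: strict_mono_Suc_iff)
  define B where "B n = (case n of 0 \<Rightarrow> topspace T | Suc k \<Rightarrow> C (s k))" for n
  have "shrinking_sets T B p"
    unfolding shrinking_sets_def
  proof (intro conjI allI)
    fix n show "openin T (B n)" "closedin T (B n)" using CD by (auto simp: B_def split: nat.split)
    show "B (Suc n) \<subseteq> B n"
      using CD(3)[OF less_imp_le[OF s(4)]] openin_subset[OF CD(1)] by (auto simp: B_def split: nat.split)
  next
    show "(\<Inter>n. B n) = {p}"
    proof (intro equalityI subsetI)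
      fix x assume x: "x \<in> (\<Inter>n. B n)"
      have "x \<in> C n" for n
      proof -
        have "x \<in> B (Suc n)" using x by blast
        then have "x \<in> C (s n)" by (simp add: B_def)
        then show ?thesis using CD(3)[of n "s n"] strict_mono_imp_increasing[OF sm] by blast
      qed
      then show "x \<in> {p}" using CD(6) by blast
    qed (use CD in \<open>auto simp: B_def split: nat.split\<close>)
  qed
  moreover have "R (B n) (B (Suc n))" for n using s(2,5) by (simp add: B_def split: nat.split)
  moreover have "n > 0 \<Longrightarrow> ?few (B n)" for n
  proof -
    assume "n > 0"
    then obtain k where k: "n = Suc k" using gr0_implies_Suc by blast
    have "?few (C (s k))" by (cases k) (use s in auto)
    then show "?few (B n)" by (simp add: B_def k)
  qed
  moreover have "B 0 = topspace T" by (simp add: B_def)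
  ultimately show ?thesis by blast
qed


section \<open>Minimal subshifts and their one-sided factors\<close>

text \<open>
  The one-sided factor of a two-sided subshift is given as an image, so compactness is its natural
  form of closedness.
\<close>

definition minimal_subshift :: "'a set \<Rightarrow> ('i::semiring_1 \<Rightarrow> 'a) set \<Rightarrow> bool" where
  "minimal_subshift A X \<longleftrightarrow> X \<subseteq> Pi UNIV (\<lambda>_. A) \<and> compact_space (subshift_topology A X) \<and>
     shift ` X = X \<and> minimal_system (subshift_topology A X) shift"

lemma subshift_topology_eq: "subshift_topology A X = seq_topology (\<lambda>_. A) X"
  by (simp add: subshift_topology_def full_shift_topology_def)

lemma openin_coordinate:
  assumes "X \<subseteq> Pi UNIV D" shows "openin (seq_topology D X) {x \<in> X. x i = v}"
  unfolding openin_seq_topology_iff[OF assms]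
  by (auto simp: agree_on_def intro!: exI[of _ "{i}"])

lemma openin_cylinder:
  assumes "X \<subseteq> Pi UNIV D" "finite F" shows "openin (seq_topology D X) {x \<in> X. agree_on F p x}"
  unfolding openin_seq_topology_iff[OF assms(1)]
  using assms(2) by (auto simp: agree_on_def intro!: exI[of _ F])

lemma minimal_subshiftD:
  assumes "minimal_subshift A X"
  shows "X \<subseteq> Pi UNIV (\<lambda>_. A)" "topspace (subshift_topology A X) = X"
    "compact_space (subshift_topology A X)" "Hausdorff_space (subshift_topology A X)"
    "shift ` X = X" "minimal_system (subshift_topology A X) shift"
    "continuous_map (subshift_topology A X) (subshift_topology A X) shift"
    "x \<in> X \<Longrightarrow> (shift ^^ n) x \<in> X"
proof -
  show X: "X \<subseteq> Pi UNIV (\<lambda>_. A)" "compact_space (subshift_topology A X)" "shift ` X = X"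
    "minimal_system (subshift_topology A X) shift"
    using assms by (auto simp: minimal_subshift_def)
  show ts: "topspace (subshift_topology A X) = X"
    unfolding subshift_topology_eq by (rule topspace_seq_topology[OF X(1)])
  show "Hausdorff_space (subshift_topology A X)"
    unfolding subshift_topology_eq by (rule Hausdorff_seq_topology)
  show "continuous_map (subshift_topology A X) (subshift_topology A X) shift"
    unfolding subshift_topology_eq continuous_map_seq_topology_iff[OF X(1)]
    unfolding ts[unfolded subshift_topology_eq]
    using X(3) openin_coordinate[OF X(1)] by (auto simp: shift_def)
  show "x \<in> X \<Longrightarrow> (shift ^^ n) x \<in> X" by (rule funpow_in_space) (use X(3) in auto)
qed

definition future :: "(int \<Rightarrow> 'a) \<Rightarrow> (nat \<Rightarrow> 'a)" where
  "future x = (\<lambda>n. x (int n))"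

definition translate :: "int \<Rightarrow> (int \<Rightarrow> 'a) \<Rightarrow> (int \<Rightarrow> 'a)" where
  "translate k x = (\<lambda>i. x (i + k))"

lemma one_sided_factor_eq: "one_sided_factor S = future ` S"
  by (simp add: one_sided_factor_def future_def)

lemma funpow_shift_translate: "(shift ^^ n) x = translate (int n) x" for x :: "int \<Rightarrow> 'a"
  by (simp add: funpow_shift translate_def)

lemma translate_translate: "translate j (translate k x) = translate (j + k) x"
  by (simp add: translate_def add.assoc)

lemma translate_0 [simp]: "translate 0 x = x"
  by (simp add: translate_def)

lemma future_shift: "future ((shift ^^ n) x) = (shift ^^ n) (future x)"
  by (simp add: future_def funpow_shift)

lemma word_future: "word (future x) t = word x t"
  by (simp add: word_def future_def)

lemma translate_in_subshift:
  assumes "shift ` S = S" "x \<in> S" shows "translate k x \<in> S"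
proof -
  have *: "translate (- int n) x \<in> S" if "x \<in> S" for n x
    using that
  proof (induction n arbitrary: x)
    case (Suc n)
    obtain y where y: "y \<in> S" "x = shift y" using Suc.prems assms(1) by blast
    have "translate (- int (Suc n)) x = translate (- int n) y"
      by (simp add: y(2) translate_def shift_def)
    then show ?case using Suc.IH[OF y(1)] by simp
  qed simp
  show ?thesis
  proof (cases "k \<ge> 0")
    case True
    have "(shift ^^ nat k) x \<in> S" by (rule funpow_in_space) (use assms in auto)
    then show ?thesis using True by (simp add: funpow_shift_translate)
  next
    case False
    then show ?thesis using *[OF assms(2), of "nat (- k)"] by simp
  qed
qed

lemma continuous_future_translate:
  assumes S: "S \<subseteq> Pi UNIV (\<lambda>_. A)" "shift ` S = S"
  shows "continuous_map (subshift_topology A S) (subshift_topology A (future ` S))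
     (\<lambda>x. future (translate k x))"
proof -
  have S': "future ` S \<subseteq> Pi UNIV (\<lambda>_. A)" using S(1) by (auto simp: future_def)
  have "openin (seq_topology (\<lambda>_. A) S) {x \<in> S. future (translate k x) i = v}" for i v
    using openin_coordinate[OF S(1), of "int i + k" v] by (simp add: future_def translate_def)
  then show ?thesis
    unfolding subshift_topology_eq continuous_map_seq_topology_iff[OF S'] topspace_seq_topology[OF S(1)]
    using translate_in_subshift[OF S(2)] by auto
qed

lemma minimal_two_sided_subshift_imp:
  assumes "minimal_two_sided_subshift A S"
  shows "minimal_subshift A S" "minimal_subshift A (future ` S)"
proof -
  have cl: "closedin (full_shift_topology A) S" and A: "finite A" and sh: "shift ` S = S"
    and min: "minimal_system (subshift_topology A S) shift"
    using assms by (auto simp: minimal_two_sided_subshift_def two_sided_subshift_def)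
  have S: "S \<subseteq> Pi UNIV (\<lambda>_. A)"
    using closedin_subset[OF cl] by (auto simp: full_shift_topology_def)
  have "compact_space (full_shift_topology A)"
    unfolding full_shift_topology_def using A
    by (auto simp: compact_space_product_topology compact_space_discrete_topology)
  then have comp: "compact_space (subshift_topology A S)"
    unfolding subshift_topology_def
    using cl closedin_compact_space compact_space_subtopology by blast
  then show *: "minimal_subshift A S"
    using S sh min by (simp add: minimal_subshift_def)
  let ?T = "subshift_topology A S" and ?T' = "subshift_topology A (future ` S)"
  have cont: "continuous_map ?T ?T' future"
    using continuous_future_translate[OF S sh, of 0] by simp
  have S': "future ` S \<subseteq> Pi UNIV (\<lambda>_. A)" using S by (auto simp: future_def)
  have ts: "topspace ?T = S" "topspace ?T' = future ` S"
    unfolding subshift_topology_eq using topspace_seq_topology S S' by blast+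
  have "compact_space ?T'"
    using image_compactin[OF _ cont] comp unfolding compact_space_def ts by blast
  moreover have comm: "shift (future x) = future (shift x)" for x :: "int \<Rightarrow> 'a"
    using future_shift[of 1 x] by simp
  then have "shift ` future ` S = future ` shift ` S" by (simp add: image_image)
  then have "shift ` future ` S = future ` S" using sh by simp
  moreover have "minimal_system ?T' shift"
    by (rule minimal_system_image[OF min _ cont]) (use sh ts comm in auto)
  ultimately show "minimal_subshift A (future ` S)"
    using S' by (simp add: minimal_subshift_def)
qed


lemma late_visit:
  assumes X: "minimal_subshift A X" and C: "openin (subshift_topology A X) C" "C \<noteq> {}" and x: "x \<in> X"
  obtains t where "t \<ge> M" "(shift ^^ t) x \<in> C"
proof -
  note D = minimal_subshiftD[OF X]
  obtain k where "(shift ^^ k) ((shift ^^ M) x) \<in> C"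
    using minimal_visits[OF D(6,7) C, of "(shift ^^ M) x"] D(2,8) x by blast
  then have "(shift ^^ (k + M)) x \<in> C" by (simp add: funpow_add)
  then show thesis using that[of "k + M"] by simp
qed

lemma funpow_funpow_diff: "i \<le> j \<Longrightarrow> (f ^^ (j - i)) ((f ^^ i) x) = (f ^^ j) x"
  by (metis comp_apply funpow_add le_add_diff_inverse2)

text \<open>
  Every point is preceded by a visit to \<open>D\<close>: the hitting times are bounded by some
  \<open>M\<close>, and the point has a preimage under the \<open>M\<close>-th iterate.
\<close>

lemma last_visit:
  assumes X: "minimal_subshift A X" and D: "openin (subshift_topology A X) D" "D \<noteq> {}" and x: "x \<in> X"
  obtains y t j where "first_return shift D y t" "j < t" "x = (shift ^^ j) y"
proof -
  note XD = minimal_subshiftD[OF X]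
  obtain M where M: "\<And>x. x \<in> X \<Longrightarrow> \<exists>k\<le>M. (shift ^^ k) x \<in> D"
    using minimal_visits_bounded[OF XD(6,7,3) D] XD(2) by metis
  have surj: "\<exists>y\<in>X. (shift ^^ m) y = x" for m
  proof (induction m)
    case (Suc m)
    then obtain y where y: "y \<in> X" "(shift ^^ m) y = x" by blast
    then obtain z where "z \<in> X" "y = shift z" using XD(5) by blast
    then show ?case using y by (intro bexI[of _ z]) (auto simp: funpow_swap1)
  qed (use x in auto)
  obtain y where y: "y \<in> X" "(shift ^^ M) y = x" using surj by blast
  obtain k where k: "k \<le> M" "(shift ^^ k) y \<in> D" using M y by blast
  have "\<exists>m. \<exists>y\<in>D. (shift ^^ m) y = x"
    using k y funpow_funpow_diff[OF k(1), of shift y] by blast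
  then have ex: "\<exists>y\<in>D. (shift ^^ (LEAST m. \<exists>y\<in>D. (shift ^^ m) y = x)) y = x" by (rule LeastI_ex)
  define j where "j = (LEAST m. \<exists>y\<in>D. (shift ^^ m) y = x)"
  obtain z where z: "z \<in> D" "(shift ^^ j) z = x" using ex by (auto simp: j_def)
  obtain t where t: "first_return shift D z t"
    by (rule first_return_minimal[OF XD(6,7) D(1) z(1)])
  have "j < t"
  proof (rule ccontr)
    assume "\<not> j < t"
    then have "(shift ^^ (j - t)) ((shift ^^ t) z) = x" "(shift ^^ t) z \<in> D"
      using z t funpow_funpow_diff[of t j shift z] by (auto simp: first_return_def)
    then have "j \<le> j - t" unfolding j_def by (intro Least_le) (auto simp: j_def)
    then show False using t \<open>\<not> j < t\<close> by (auto simp: first_return_def)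
  qed
  then show thesis using that t z by blast
qed

lemma clopen_window:
  assumes X: "minimal_subshift A X"
    and C: "openin (subshift_topology A X) C" "closedin (subshift_topology A X) C"
  obtains F where "finite F" "\<And>x y. x \<in> X \<Longrightarrow> y \<in> X \<Longrightarrow> agree_on F x y \<Longrightarrow> x \<in> C \<longleftrightarrow> y \<in> C"
proof -
  note D = minimal_subshiftD[OF X]
  have CX: "C \<subseteq> X" using openin_subset[OF C(1)] D(2) by simp
  have "openin (subshift_topology A X) {x \<in> X. (x \<in> C) = v}" for v
  proof (cases v)
    case True
    then have "{x \<in> X. (x \<in> C) = v} = C" using CX by auto
    then show ?thesis using C(1) by simp
  next
    case False
    then have "{x \<in> X. (x \<in> C) = v} = topspace (subshift_topology A X) - C" using D(2) by auto
    then show ?thesis using C(2) by (simp add: closedin_def)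
  qed
  then show thesis
    using uniform_window[OF D(1), of "\<lambda>x. x \<in> C"] D(3) that unfolding subshift_topology_eq by blast
qed

lemma openin_word:
  assumes X: "minimal_subshift A X"
  shows "openin (subshift_topology A X) {y \<in> X. word y t = w}"
proof (cases "length w = t")
  case True
  have eq: "{y \<in> X. word y t = w} = topspace (subshift_topology A X) \<inter> \<Inter>((\<lambda>i. {y \<in> X. y (of_nat i) = w ! i}) ` {..<t})"
    using True minimal_subshiftD(2)[OF X] by (auto simp: list_eq_iff_nth_eq nth_word)
  show ?thesis unfolding eq
    using openin_coordinate[OF minimal_subshiftD(1)[OF X]]
    by (intro openin_Int_Inter openin_topspace) (auto simp: subshift_topology_eq)
next
  case False
  then have e: "{y \<in> X. word y t = w} = {}" by auto
  show ?thesis unfolding e by simp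
qed

lemma Nil_notin_return_words: "[] \<notin> return_words B"
proof
  assume "[] \<in> return_words B"
  then obtain x t where "[] = word x t" "first_return shift B x t" unfolding return_words_def by blast
  then have "length (word x t) = 0" "t > 0" by (simp_all add: first_return_def)
  then show False by simp
qed


section \<open>Suffix hulls of finite sets of words\<close>

text \<open>
  The hull is the smallest monoid containing \<open>R\<close> in which a word can be read backwards
  without ambiguity: if a word and a suffix of it lie in the monoid, then so does the rest.
\<close>

inductive_set suffix_hull :: "'a list set \<Rightarrow> 'a list set" for R where
  nil: "[] \<in> suffix_hull R"
| base: "w \<in> R \<Longrightarrow> w \<in> suffix_hull R"
| append: "u \<in> suffix_hull R \<Longrightarrow> v \<in> suffix_hull R \<Longrightarrow> u @ v \<in> suffix_hull R"
| strip: "v \<in> suffix_hull R \<Longrightarrow> u @ v \<in> suffix_hull R \<Longrightarrow> u \<in> suffix_hull R"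

definition irreducibles :: "'a list set \<Rightarrow> 'a list set" where
  "irreducibles H = {w \<in> H. w \<noteq> [] \<and> (\<forall>u v. w = u @ v \<and> u \<in> H \<and> v \<in> H \<longrightarrow> u = [] \<or> v = [])}"

lemma suffix_hull_least: "R \<subseteq> suffix_hull R' \<Longrightarrow> suffix_hull R \<subseteq> suffix_hull R'"
proof
  fix w assume R: "R \<subseteq> suffix_hull R'" and "w \<in> suffix_hull R"
  from this(2) show "w \<in> suffix_hull R'"
    by induction (use R in \<open>auto intro: suffix_hull.intros\<close>)
qed

text \<open>
  Reading backwards, the last generator is forced if no generator is a suffix of another one.
\<close>

lemma suffix_code_strip:
  assumes code: "\<And>u v. v \<in> R \<Longrightarrow> u @ v \<in> R \<Longrightarrow> u = []" and ne: "[] \<notin> R"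
    and "vs \<in> lists R" "ws \<in> lists R" "u @ concat vs = concat ws"
  shows "u \<in> concat ` lists R"
  using assms(3-)
proof (induction vs arbitrary: ws rule: rev_induct)
  case Nil
  then show ?case by auto
next
  case (snoc y vs)
  have y: "y \<in> R" "y \<noteq> []" using snoc.prems ne by auto
  have "ws \<noteq> []" using snoc.prems(3) y by auto
  then obtain ws' z where ws: "ws = ws' @ [z]" using rev_exhaust by blast
  have z: "z \<in> R" "ws' \<in> lists R" using snoc.prems ws by auto
  have "(u @ concat vs) @ y = concat ws' @ z" using snoc.prems(3) ws by simp
  then obtain us where us: "u @ concat vs = concat ws' @ us \<and> us @ y = z \<or>
     (u @ concat vs) @ us = concat ws' \<and> y = us @ z"
    unfolding append_eq_append_conv2 by metis
  then have "us @ y \<in> R \<or> us @ z \<in> R" using y(1) z(1) by metis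
  then have "us = []" using code us y(1) z(1) by metis
  then have "u @ concat vs = concat ws'" using us by simp
  then show ?case using snoc.IH snoc.prems z by simp
qed

text \<open>
  If one generator is a proper suffix of another one, it is cut off from the longer one. This keeps
  the hull, does not increase the number of generators and makes them shorter in total. Once no
  generator is a suffix of another, the hull consists of the products of generators.
\<close>

lemma card_irreducibles_suffix_hull:
  assumes "finite R" "[] \<notin> R"
  shows "finite (irreducibles (suffix_hull R)) \<and> card (irreducibles (suffix_hull R)) \<le> card R"
  using assms
proof (induction "sum length R" arbitrary: R rule: less_induct)
  case less
  show ?case
  proof (cases "\<exists>u v. v \<in> R \<and> u @ v \<in> R \<and> u \<noteq> []")
    case True
    then obtain u v where uv: "v \<in> R" "u @ v \<in> R" "u \<noteq> []" by blast
    define R' where "R' = insert u (R - {u @ v})"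
    have v: "v \<noteq> []" "v \<in> R'" using uv less.prems by (auto simp: R'_def)
    have "sum length R' \<le> length u + sum length (R - {u @ v})"
      using less.prems by (auto simp: R'_def sum.insert_if)
    also have "\<dots> < length (u @ v) + sum length (R - {u @ v})" using v by simp
    also have "\<dots> = sum length R" using less.prems(1) uv(2) by (metis sum.remove)
    finally have lt: "sum length R' < sum length R" .
    have "card R' \<le> Suc (card (R - {u @ v}))" unfolding R'_def by (rule card_insert_le_m1) auto
    also have "\<dots> = card R" using card_Suc_Diff1[OF less.prems(1) uv(2)] .
    finally have card: "card R' \<le> card R" .
    have "R' \<subseteq> suffix_hull R"
      using uv suffix_hull.strip[of v R u] by (auto simp: R'_def intro: suffix_hull.base)
    moreover have "u @ v \<in> suffix_hull R'"
      using v by (intro suffix_hull.append suffix_hull.base) (auto simp: R'_def)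
    then have "R \<subseteq> suffix_hull R'" by (auto simp: R'_def intro: suffix_hull.base)
    ultimately have "suffix_hull R' = suffix_hull R" by (intro equalityI suffix_hull_least)
    moreover have "finite R'" "[] \<notin> R'" using less.prems uv by (auto simp: R'_def)
    ultimately show ?thesis using less.hyps[OF lt] card by auto
  next
    case False
    then have code: "\<And>u v. v \<in> R \<Longrightarrow> u @ v \<in> R \<Longrightarrow> u = []" by blast
    have hull: "w \<in> concat ` lists R" if "w \<in> suffix_hull R" for w
      using that
    proof induction
      case nil
      show ?case by (rule image_eqI[of _ _ "[]"]) auto
    next
      case (base w)
      then show ?case by (intro image_eqI[of _ _ "[w]"]) auto
    next
      case (append u v)
      then obtain us vs where "us \<in> lists R" "vs \<in> lists R" "u = concat us" "v = concat vs" by blast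
      then show ?case by (intro image_eqI[of _ _ "us @ vs"]) auto
    next
      case (strip v u)
      then obtain vs ws where "vs \<in> lists R" "ws \<in> lists R" "v = concat vs" "u @ v = concat ws" by blast
      then show ?case using suffix_code_strip[of R vs ws u, OF code less.prems(2)] by simp
    qed
    have lists: "concat ws \<in> suffix_hull R" if "ws \<in> lists R" for ws
      using that by (induction ws) (auto intro: suffix_hull.intros)
    have "irreducibles (suffix_hull R) \<subseteq> R"
    proof
      fix w assume w: "w \<in> irreducibles (suffix_hull R)"
      then obtain ws where ws: "ws \<in> lists R" "w = concat ws"
        using hull unfolding irreducibles_def by blast
      have "ws \<noteq> []" using w ws by (auto simp: irreducibles_def)
      then obtain z ws' where z: "ws = z # ws'" by (cases ws) auto
      have zR: "z \<in> R" "ws' \<in> lists R" using ws z by auto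
      have wz: "w = z @ concat ws'" using ws z by simp
      then have "z = [] \<or> concat ws' = []"
        using w lists[OF zR(2)] suffix_hull.base[OF zR(1)] unfolding irreducibles_def by blast
      then show "w \<in> R" using zR(1) less.prems(2) wz by (metis append_Nil2)
    qed
    then show ?thesis using less.prems(1) by (auto intro: finite_subset card_mono)
  qed
qed

text \<open>
  The words \<open>w\<close> such that \<open>T\<close> is a prefix of \<open>w @ T\<close> form a
  monoid that is closed under cutting off suffixes: if \<open>T\<close> is a prefix of
  \<open>u @ v @ T\<close>, and this begins with \<open>u @ T\<close>, then comparing lengths makes
  \<open>T\<close> a prefix of \<open>u @ T\<close>. So the condition passes from the generators to
  the hull.
\<close>

lemma suffix_hull_common_prefix:
  assumes "w \<in> suffix_hull R" and R: "\<And>w. w \<in> R \<Longrightarrow> take (length T) (w @ T) = T"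
  shows "take (length T) (w @ T) = T"
  using assms(1)
proof induction
  case (append u v)
  have "T = take (length T) (u @ T)" using append by simp
  also have "\<dots> = take (length T) (u @ take (length T) (v @ T))" using append by simp
  also have "\<dots> = take (length T) ((u @ v) @ T)" by (simp add: min_def)
  finally show ?case by simp
next
  case (strip v u)
  have "T = take (length T) (u @ v @ T)" using strip by simp
  also have "\<dots> = take (length T) (u @ take (length T) (v @ T))" by (simp add: min_def)
  also have "\<dots> = take (length T) (u @ T)" using strip by simp
  finally show ?case by simp
qed (use R in auto)


section \<open>From two-sided to one-sided return words\<close>

text \<open>
  Whether a point lies in a clopen set of a two-sided subshift may depend on the past, so
  \<open>C\<close> need not induce a clopen set of the one-sided factor. But points with the same
  future visit \<open>C\<close> at the same times from some time on. The cut points are obtained by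
  reading backwards from such a visit with the hull of the return words.
\<close>

definition cut_points :: "(int \<Rightarrow> 'a) set \<Rightarrow> (int \<Rightarrow> 'a) set \<Rightarrow> (int \<Rightarrow> 'a) set" where
  "cut_points S C =
     {x \<in> S. \<exists>t. (shift ^^ t) x \<in> C \<and> word x t \<in> suffix_hull (return_words C)}"

lemma word_between_visits:
  "x \<in> C \<Longrightarrow> (shift ^^ t) x \<in> C \<Longrightarrow> word x t \<in> suffix_hull (return_words C)"
proof (induction t arbitrary: x rule: less_induct)
  case (less t)
  show ?case
  proof (cases "t = 0")
    case True
    then show ?thesis by (simp add: suffix_hull.nil)
  next
    case False
    then obtain s where s: "first_return shift C x s" "s \<le> t"
      using first_return_exists[of x C t shift] less.prems by blast
    have s': "s > 0" "(shift ^^ s) x \<in> C" using s by (auto simp: first_return_def)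
    have "(shift ^^ (t - s)) ((shift ^^ s) x) = (shift ^^ t) x"
      using s(2) by (metis comp_apply funpow_add le_add_diff_inverse2)
    then have "word ((shift ^^ s) x) (t - s) \<in> suffix_hull (return_words C)"
      using less.IH[of "t - s" "(shift ^^ s) x"] s s' False less.prems by simp
    moreover have "word x s \<in> suffix_hull (return_words C)"
      using s(1) by (auto simp: return_words_def intro: suffix_hull.base)
    ultimately show ?thesis
      using word_add[of x s "t - s"] s(2) suffix_hull.append by force
  qed
qed

text \<open>
  The choice of the visit does not matter: between two visits one reads words of the hull, which can
  be appended or cut off.
\<close>

lemma cut_points_iff:
  assumes x: "x \<in> S" and t: "(shift ^^ t) x \<in> C"
  shows "x \<in> cut_points S C \<longleftrightarrow> word x t \<in> suffix_hull (return_words C)" (is "_ \<longleftrightarrow> _ \<in> ?H")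
proof
  assume "x \<in> cut_points S C"
  then obtain t' where t': "(shift ^^ t') x \<in> C" "word x t' \<in> ?H" by (auto simp: cut_points_def)
  have between: "word ((shift ^^ i) x) (j - i) \<in> ?H" if "i \<le> j" "(shift ^^ i) x \<in> C" "(shift ^^ j) x \<in> C" for i j
    using that word_between_visits[of "(shift ^^ i) x" C "j - i"]
    by (metis comp_apply funpow_add le_add_diff_inverse2)
  show "word x t \<in> ?H"
  proof (cases "t' \<le> t")
    case True
    then show ?thesis
      using word_add[of x t' "t - t'"] suffix_hull.append[OF t'(2) between[OF True t'(1) t]] by simp
  next
    case False
    then show ?thesis
      using word_add[of x t "t' - t"] suffix_hull.strip[OF between[OF _ t t'(1)], of "word x t"] t'(2) by simp
  qed
qed (use assms in \<open>auto simp: cut_points_def\<close>)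

text \<open>
  Two points with the same future are eventually cut by \<open>C\<close> at the same times, so
  reading backwards the hull decides about both in the same way.
\<close>

lemma cut_points_future:
  assumes S: "minimal_subshift A S"
    and C: "openin (subshift_topology A S) C" "closedin (subshift_topology A S) C" "C \<noteq> {}"
    and x: "x \<in> cut_points S C" and y: "y \<in> S" and eq: "future x = future y"
  shows "y \<in> cut_points S C"
proof -
  have xS: "x \<in> S" using x by (simp add: cut_points_def)
  obtain F where F: "finite F" "\<And>x y. x \<in> S \<Longrightarrow> y \<in> S \<Longrightarrow> agree_on F x y \<Longrightarrow> x \<in> C \<longleftrightarrow> y \<in> C"
    using clopen_window[OF S C(1,2)] by metis
  \<comment> \<open>From time \<open>M\<close> on, the window \<open>F\<close> lies in the common future.\<close>
  define M where "M = nat (Max (insert 0 (uminus ` F)))"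
  have M: "- i \<le> int M" if "i \<in> F" for i
    using that F(1) Max_ge[of "insert 0 (uminus ` F)" "- i"] by (auto simp: M_def)
  obtain t where t: "t \<ge> M" "(shift ^^ t) x \<in> C" by (rule late_visit[OF S C(1,3) xS])
  have eq': "x i = y i" if "i \<ge> 0" for i
    using fun_cong[OF eq, of "nat i"] that by (simp add: future_def)
  have "agree_on F ((shift ^^ t) x) ((shift ^^ t) y)"
    using M t(1) by (force simp: agree_on_def funpow_shift intro!: eq')
  then have "(shift ^^ t) y \<in> C" using F(2) t(2) minimal_subshiftD(8)[OF S] xS y by metis
  moreover have "word x t = word y t" using eq by (metis word_future)
  ultimately show ?thesis using x t(2) cut_points_iff[OF xS t(2)] cut_points_iff[OF y, of t C] by simp
qed

lemma cut_points_clopen: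
  assumes S: "minimal_subshift A S"
    and C: "openin (subshift_topology A S) C" "C \<noteq> {}"
  shows "openin (subshift_topology A S) (cut_points S C)"
    "closedin (subshift_topology A S) (cut_points S C)"
proof -
  let ?T = "subshift_topology A S"
  note D = minimal_subshiftD[OF S]
  have *: "openin ?T {x \<in> S. (x \<in> cut_points S C) = v}" for v
  proof (subst openin_subopen, intro ballI)
    fix x assume "x \<in> {x \<in> S. (x \<in> cut_points S C) = v}"
    then have x: "x \<in> S" "(x \<in> cut_points S C) = v" by auto
    obtain t where t: "(shift ^^ t) x \<in> C" by (rule late_visit[OF S C x(1), of 0])
    let ?N = "{y \<in> topspace ?T. (shift ^^ t) y \<in> C} \<inter> {y \<in> S. word y t = word x t}"
    have "openin ?T ?N"
      by (intro openin_Int openin_funpow_preimage openin_word) (use D C S in auto)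
    moreover have "?N \<subseteq> {x \<in> S. (x \<in> cut_points S C) = v}"
      using x cut_points_iff[OF x(1) t] cut_points_iff[of _ S t C] by auto
    ultimately show "\<exists>N. openin ?T N \<and> x \<in> N \<and> N \<subseteq> {x \<in> S. (x \<in> cut_points S C) = v}"
      using x(1) t D(2) by blast
  qed
  have "{x \<in> S. (x \<in> cut_points S C) = True} = cut_points S C" by (auto simp: cut_points_def)
  then show "openin ?T (cut_points S C)" using *[of True] by simp
  have "{x \<in> S. (x \<in> cut_points S C) = False} = S - cut_points S C" by auto
  then show "closedin ?T (cut_points S C)"
    using *[of False] D(2) by (auto simp: closedin_def cut_points_def)
qed

text \<open>A factorization of a return word within the hull would produce an earlier cut point.\<close>

lemma return_words_cut_points:
  assumes S: "minimal_subshift A S"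
    and C: "openin (subshift_topology A S) C" "closedin (subshift_topology A S) C" "C \<noteq> {}"
  shows "return_words (future ` cut_points S C) \<subseteq> irreducibles (suffix_hull (return_words C))"
proof
  let ?B = "future ` cut_points S C" and ?H = "suffix_hull (return_words C)"
  note D = minimal_subshiftD[OF S]
  fix w assume "w \<in> return_words ?B"
  then obtain z t where w: "w = word z t" "first_return shift ?B z t" by (auto simp: return_words_def)
  then obtain x where x: "x \<in> cut_points S C" "z = future x" by (auto simp: first_return_def)
  have xS: "x \<in> S" using x by (simp add: cut_points_def)
  have sat: "(shift ^^ s) z \<in> ?B \<longleftrightarrow> (shift ^^ s) x \<in> cut_points S C" for s
    using cut_points_future[OF S C _ D(8)[OF xS]] by (auto simp: x(2) simp flip: future_shift)
  obtain t' where t': "t' \<ge> t" "(shift ^^ t') x \<in> C" by (rule late_visit[OF S C(1,3) xS])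
  have iff: "(shift ^^ s) x \<in> cut_points S C \<longleftrightarrow> word ((shift ^^ s) x) (t' - s) \<in> ?H" if "s \<le> t'" for s
  proof (rule cut_points_iff[OF D(8)[OF xS]])
    show "(shift ^^ (t' - s)) ((shift ^^ s) x) \<in> C"
      using t'(2) that by (metis comp_apply funpow_add le_add_diff_inverse2)
  qed
  have wx: "w = word x t" using w(1) x(2) word_future by metis
  have t: "t > 0" "(shift ^^ t) x \<in> cut_points S C" "\<And>j. 0 < j \<Longrightarrow> j < t \<Longrightarrow> (shift ^^ j) x \<notin> cut_points S C"
    using w(2) sat by (auto simp: first_return_def)
  have tail: "word ((shift ^^ t) x) (t' - t) \<in> ?H" using iff[OF t'(1)] t(2) by simp
  have "word x t' \<in> ?H" using iff[of 0] x(1) by simp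
  then have "w @ word ((shift ^^ t) x) (t' - t) \<in> ?H" using word_add[of x t "t' - t"] t'(1) wx by simp
  then have "w \<in> ?H" using suffix_hull.strip[OF tail] by simp
  moreover have "w \<noteq> []" using wx t(1) by (metis length_word list.size(3) less_irrefl)
  moreover have "u = [] \<or> v = []" if uv: "w = u @ v" "u \<in> ?H" "v \<in> ?H" for u v
  proof (rule ccontr)
    assume ne: "\<not> ?thesis"
    define s where "s = length u"
    have "length w = t" using wx by simp
    then have s: "0 < s" "s < t" using ne uv(1) by (auto simp: s_def)
    have "v = drop s w" using uv(1) by (simp add: s_def)
    then have v: "v = word ((shift ^^ s) x) (t - s)" using wx drop_word[of s t x] s by simp
    have "(shift ^^ (t - s)) ((shift ^^ s) x) = (shift ^^ t) x"
      using s by (metis comp_apply funpow_add le_add_diff_inverse2 less_imp_le)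
    then have "word ((shift ^^ s) x) (t' - s) = v @ word ((shift ^^ t) x) (t' - t)"
      using word_add[of "(shift ^^ s) x" "t - s" "t' - t"] s t'(1) v by simp
    then have "(shift ^^ s) x \<in> cut_points S C"
      using iff[of s] s t'(1) suffix_hull.append[OF uv(3) tail] by simp
    then show False using t(3) s by blast
  qed
  ultimately show "w \<in> irreducibles ?H" by (auto simp: irreducibles_def)
qed

text \<open>
  The cut points have at most as many return words as \<open>C n\<close>, since these are irreducible in
  the hull. They shrink to the future of \<open>p\<close> because all points of \<open>C n\<close> have
  a long word \<open>P\<close> of \<open>p\<close> in common, so that every word of the hull that is as
  long as \<open>P\<close> begins with \<open>P\<close>.
\<close>

lemma few_return_words_one_sided:
  assumes S: "minimal_subshift A S" and S': "minimal_subshift A (future ` S)"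
    and few: "few_return_words (subshift_topology A S) K"
  shows "few_return_words (subshift_topology A (future ` S)) K"
proof -
  let ?T = "subshift_topology A S" and ?T' = "subshift_topology A (future ` S)"
  note D = minimal_subshiftD[OF S] and D' = minimal_subshiftD[OF S']
  obtain C p where C: "shrinking_sets ?T C p"
    and inf: "\<exists>\<^sub>\<infinity>n. finite (return_words (C n)) \<and> card (return_words (C n)) \<le> K"
    using few by (auto simp: few_return_words_def)
  note CD = shrinking_setsD[OF C]
  have ne: "C n \<noteq> {}" for n using CD(4) by blast
  define B where "B n = future ` cut_points S (C n)" for n
  have cont: "continuous_map ?T ?T' future"
    using continuous_future_translate[OF D(1,5), of 0] by simp
  have closed_image: "closedin ?T' (future ` E)" if "closedin ?T E" for E
    using that D(3) D'(4) cont
    by (metis closedin_compact_space compactin_imp_closedin image_compactin)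
  have clopen: "openin ?T (cut_points S (C n))" "closedin ?T (cut_points S (C n))" for n
    using cut_points_clopen[OF S CD(1) ne] by blast+
  have "openin ?T' (B n)" "closedin ?T' (B n)" for n
  proof -
    show "closedin ?T' (B n)" unfolding B_def using closed_image clopen by blast
    have "closedin ?T' (future ` (S - cut_points S (C n)))"
      using closed_image clopen D(2) closedin_diff closedin_topspace by metis
    moreover have "future x \<in> B n \<longleftrightarrow> x \<in> cut_points S (C n)" if "x \<in> S" for x
      unfolding B_def using cut_points_future[OF S CD(1,2) ne _ that] by auto
    then have "future ` (S - cut_points S (C n)) = topspace ?T' - B n"
      unfolding D'(2) set_eq_iff image_iff Diff_iff Bex_def by metis
    moreover have "B n \<subseteq> topspace ?T'" unfolding B_def D'(2) by (auto simp: cut_points_def)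
    ultimately show "openin ?T' (B n)" by (simp add: openin_closedin)
  qed
  moreover have "B (Suc n) \<subseteq> B n" for n
  proof -
    have sub: "C (Suc n) \<subseteq> C n" using CD(3) by simp
    have "return_words (C (Suc n)) \<subseteq> suffix_hull (return_words (C n))"
    proof
      fix w assume "w \<in> return_words (C (Suc n))"
      then obtain x t where "w = word x t" "x \<in> C (Suc n)" "(shift ^^ t) x \<in> C (Suc n)"
        by (auto simp: return_words_def first_return_def)
      then show "w \<in> suffix_hull (return_words (C n))" using word_between_visits[of x "C n" t] sub by auto
    qed
    then have "suffix_hull (return_words (C (Suc n))) \<subseteq> suffix_hull (return_words (C n))"
      by (rule suffix_hull_least)
    then have "cut_points S (C (Suc n)) \<subseteq> cut_points S (C n)"
      using sub unfolding cut_points_def by blast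
    then show ?thesis by (auto simp: B_def)
  qed
  moreover have "(\<Inter>n. B n) = {future p}"
  proof (intro equalityI subsetI)
    fix z assume "z \<in> {future p}"
    have "p \<in> cut_points S (C n)" for n
      using CD(4,5) D(2) by (auto simp: cut_points_def intro!: exI[of _ 0] suffix_hull.nil)
    then show "z \<in> (\<Inter>n. B n)" using \<open>z \<in> {future p}\<close> by (auto simp: B_def)
  next
    fix z assume z: "z \<in> (\<Inter>n. B n)"
    have "z j = future p j" for j
    proof -
      define L where "L = Suc j"
      define P where "P = word p L"
      have "openin ?T {y \<in> S. word y L = P}" by (rule openin_word[OF S])
      moreover have "p \<in> {y \<in> S. word y L = P}" using CD(5) D(2) by (simp add: P_def)
      ultimately obtain n where "\<forall>k\<ge>n. C k \<subseteq> {y \<in> S. word y L = P}"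
        using shrinking_sets_in_open[OF D(3) C] by meson
      then have n: "C n \<subseteq> {y \<in> S. word y L = P}" by simp
      obtain x where x: "z = future x" "x \<in> cut_points S (C n)" using z by (auto simp: B_def)
      have xS: "x \<in> S" using x by (simp add: cut_points_def)
      obtain t where t: "t \<ge> L" "(shift ^^ t) x \<in> C n" by (rule late_visit[OF S CD(1) ne xS])
      have lP: "length P = L" by (simp add: P_def)
      have "take L (w @ P) = P" if w: "w \<in> return_words (C n)" for w
      proof -
        obtain y s where y: "w = word y s" "y \<in> C n" "(shift ^^ s) y \<in> C n"
          using w by (auto simp: return_words_def first_return_def)
        have "w @ P = word y (s + L)" using y n by (auto simp: word_add)
        then have "take L (w @ P) = word y L" using word_add[of y L s] by (simp add: add.commute)
        then show ?thesis using y(2) n by auto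
      qed
      then have "take L (word x t @ P) = P"
        using suffix_hull_common_prefix[of "word x t" "return_words (C n)" P] x(2)
          cut_points_iff[OF xS t(2)] lP by simp
      then have "take L (word x t) = P" using t(1) by simp
      then have "word x t ! j = P ! j" by (metis L_def lessI nth_take)
      then show ?thesis using t(1) x(1) by (simp add: P_def L_def nth_word future_def)
    qed
    then show "z \<in> {future p}" by auto
  qed
  ultimately have "shrinking_sets ?T' B (future p)" by (simp add: shrinking_sets_def)
  moreover have "\<exists>\<^sub>\<infinity>n. finite (return_words (B n)) \<and> card (return_words (B n)) \<le> K"
    using inf
  proof (rule INFM_mono)
    fix n assume n: "finite (return_words (C n)) \<and> card (return_words (C n)) \<le> K"
    have I: "finite (irreducibles (suffix_hull (return_words (C n))))"
      "card (irreducibles (suffix_hull (return_words (C n)))) \<le> card (return_words (C n))"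
      using card_irreducibles_suffix_hull[OF _ Nil_notin_return_words] n by blast+
    have sub: "return_words (B n) \<subseteq> irreducibles (suffix_hull (return_words (C n)))"
      unfolding B_def by (rule return_words_cut_points[OF S CD(1,2) ne])
    show "finite (return_words (B n)) \<and> card (return_words (B n)) \<le> K"
      using finite_subset[OF sub I(1)] card_mono[OF I(1) sub] I(2) n by linarith
  qed
  ultimately show ?thesis by (auto simp: few_return_words_def)
qed


section \<open>From one-sided to two-sided return words\<close>

text \<open>
  The points whose future lies in \<open>B n\<close> do not shrink to one point, since their pasts
  are free. But all futures in \<open>B n\<close> begin with a long common word, so moving these
  points along that word by \<open>m n\<close> steps fixes a long part of the past as well. The
  times \<open>m (n + 1) - m n\<close> are visits of \<open>p\<close> to \<open>B n\<close>, which
  keeps the moved sets decreasing, and the new return words are conjugates of the old ones.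
\<close>

lemma few_return_words_two_sided:
  assumes S: "minimal_subshift A S" and S': "minimal_subshift A (future ` S)"
    and few: "few_return_words (subshift_topology A (future ` S)) K"
  shows "few_return_words (subshift_topology A S) K"
proof -
  let ?T = "subshift_topology A S" and ?T' = "subshift_topology A (future ` S)"
  note D = minimal_subshiftD[OF S] and D' = minimal_subshiftD[OF S']
  obtain B p where B: "shrinking_sets ?T' B p"
    and inf: "\<exists>\<^sub>\<infinity>n. finite (return_words (B n)) \<and> card (return_words (B n)) \<le> K"
    using few by (auto simp: few_return_words_def)
  note BD = shrinking_setsD[OF B]
  define few_at where "few_at n \<longleftrightarrow> finite (return_words (B n)) \<and> card (return_words (B n)) \<le> K" for n
  \<comment> \<open>A common word of length \<open>2 * m\<close> fixes the coordinates from \<open>- m\<close> to \<open>m - 1\<close> after moving by \<open>m\<close>.\<close>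
  define good where "good n m \<longleftrightarrow> few_at n \<and> (\<forall>z\<in>B n. word z (2 * m) = word p (2 * m))" for n m
  have step: "\<exists>n' m'. good n' m' \<and> n < n' \<and> m < m' \<and> (\<forall>z\<in>B n'. (shift ^^ (m' - m)) z \<in> B n)" for n m
  proof -
    obtain t where t: "first_return shift (B n) p t"
      by (rule first_return_minimal[OF D'(6,7) BD(1,4)])
    define m' where "m' = m + t"
    let ?V = "{z \<in> topspace ?T'. (shift ^^ t) z \<in> B n} \<inter> {z \<in> future ` S. word z (2 * m') = word p (2 * m')}"
    have "openin ?T' ?V"
      by (intro openin_Int openin_funpow_preimage openin_word) (use D' BD S' in auto)
    moreover have "p \<in> ?V" using t BD(5) D'(2) by (auto simp: first_return_def)
    ultimately obtain N where N: "\<forall>n\<ge>N. B n \<subseteq> ?V"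
      using shrinking_sets_in_open[OF D'(3) B] by meson
    obtain n' where n': "n' > max n N" "few_at n'" using inf unfolding INFM_nat few_at_def by blast
    have "B n' \<subseteq> ?V" using N n' by simp
    then have "good n' m'" "\<forall>z\<in>B n'. (shift ^^ t) z \<in> B n" using n' by (auto simp: good_def)
    moreover have "m < m'" using t by (simp add: m'_def first_return_def)
    ultimately show ?thesis using n' by (intro exI[of _ n'] exI[of _ m']) (simp add: m'_def)
  qed
  have "\<exists>f. \<forall>k. (k = 0 \<or> good (fst (f k)) (snd (f k))) \<and>
     (fst (f k) < fst (f (Suc k)) \<and> snd (f k) < snd (f (Suc k)) \<and>
      (\<forall>z\<in>B (fst (f (Suc k))). (shift ^^ (snd (f (Suc k)) - snd (f k))) z \<in> B (fst (f k))))"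
  proof (rule dependent_nat_choice)
    fix x :: "nat \<times> nat" and k :: nat
    obtain n' m' where "good n' m'" "fst x < n'" "snd x < m'"
      "\<forall>z\<in>B n'. (shift ^^ (m' - snd x)) z \<in> B (fst x)" using step[of "fst x" "snd x"] by blast
    then show "\<exists>y. (Suc k = 0 \<or> good (fst y) (snd y)) \<and>
       fst x < fst y \<and> snd x < snd y \<and> (\<forall>z\<in>B (fst y). (shift ^^ (snd y - snd x)) z \<in> B (fst x))"
      by (intro exI[of _ "(n', m')"]) simp
  qed auto
  then obtain f where f: "\<And>k. k = 0 \<or> good (fst (f k)) (snd (f k))"
    "\<And>k. snd (f k) < snd (f (Suc k))"
    "\<And>k z. z \<in> B (fst (f (Suc k))) \<Longrightarrow> (shift ^^ (snd (f (Suc k)) - snd (f k))) z \<in> B (fst (f k))"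
    by blast
  define n m where "n k = fst (f k)" and "m k = snd (f k)" for k
  have good: "good (n k) (m k)" if "k > 0" for k using f(1)[of k] that by (simp add: n_def m_def)
  have m_mono: "m k < m (Suc k)" for k using f(2) by (simp add: m_def)
  then have m_ge: "k \<le> m k" for k by (simp add: strict_mono_Suc_iff strict_mono_imp_increasing)
  have visit: "(shift ^^ (m (Suc k) - m k)) z \<in> B (n k)" if "z \<in> B (n (Suc k))" for k z
    using f(3) that by (simp add: n_def m_def)
  define E where "E k = {x \<in> S. future (translate (- int (m k)) x) \<in> B (n k)}" for k
  have cont: "continuous_map ?T ?T' (\<lambda>x. future (translate k x))" for k
    by (rule continuous_future_translate[OF D(1,5)])
  have E_pre: "E k = {x \<in> topspace ?T. future (translate (- int (m k)) x) \<in> B (n k)}" for k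
    by (simp add: E_def D(2))
  have clopen: "openin ?T (E k)" "closedin ?T (E k)" for k
    unfolding E_pre
    using openin_continuous_map_preimage[OF cont BD(1)] closedin_continuous_map_preimage[OF cont BD(2)]
    by blast+
  have dec: "E (Suc k) \<subseteq> E k" for k
  proof
    fix x assume "x \<in> E (Suc k)"
    then have x: "x \<in> S" "future (translate (- int (m (Suc k))) x) \<in> B (n (Suc k))" by (auto simp: E_def)
    have "(shift ^^ (m (Suc k) - m k)) (future (translate (- int (m (Suc k))) x))
        = future (translate (- int (m k)) x)"
      using m_mono[of k] by (simp add: funpow_shift_translate translate_translate of_nat_diff flip: future_shift)
    then show "x \<in> E k" using visit[OF x(2)] x(1) by (simp add: E_def)
  qed
  have "\<exists>q. (\<Inter>k. E k) = {q}"
  proof -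
    have "(\<Inter>k. E k) \<noteq> {}"
    proof (rule compact_space_imp_nest[OF D(3) clopen(2)])
      fix k
      obtain x where x: "x \<in> S" "p = future x" using BD(5) D'(2) by blast
      have "translate (int (m k)) x \<in> E k"
        using x BD(4) translate_in_subshift[OF D(5)] by (auto simp: E_def translate_translate)
      then show "E k \<noteq> {}" by blast
      show "decseq E" by (rule decseq_SucI) (rule dec)
    qed
    moreover have "x = y" if "x \<in> (\<Inter>k. E k)" "y \<in> (\<Inter>k. E k)" for x y
    proof
      fix i :: int
      define k where "k = Suc (nat \<bar>i\<bar>)"
      define j where "j = nat (i + int (m k))"
      have mk: "m k > nat \<bar>i\<bar>" using m_ge[of k] by (simp add: k_def)
      then have j: "j < 2 * m k" "int j = i + int (m k)" by (auto simp: j_def)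
      have val: "u i = p j" if "u \<in> E k" for u
      proof -
        have "word (future (translate (- int (m k)) u)) (2 * m k) = word p (2 * m k)"
          using that good[of k] by (auto simp: E_def good_def k_def)
        then have "future (translate (- int (m k)) u) j = p j" using j(1) by (auto simp: word_eq_iff)
        then show ?thesis by (simp add: future_def translate_def j(2))
      qed
      show "x i = y i" using val[of x] val[of y] that by auto
    qed
    ultimately show ?thesis by blast
  qed
  then obtain q where "(\<Inter>k. E k) = {q}" by blast
  then have "shrinking_sets ?T E q" using clopen dec by (simp add: shrinking_sets_def)
  moreover have "finite (return_words (E k)) \<and> card (return_words (E k)) \<le> K" if "k > 0" for k
  proof -
    have "return_words (E k) \<subseteq> (\<lambda>w. drop (m k) (w @ word p (m k))) ` return_words (B (n k))"
    proof
      fix w assume "w \<in> return_words (E k)"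
      then obtain x t where w: "w = word x t" "first_return shift (E k) x t" by (auto simp: return_words_def)
      define z where "z = future (translate (- int (m k)) x)"
      have xS: "x \<in> S" using w(2) by (auto simp: first_return_def E_def)
      have E_iff: "(shift ^^ j) x \<in> E k \<longleftrightarrow> (shift ^^ j) z \<in> B (n k)" for j
        using D(8)[OF xS, of j]
        by (simp add: E_def z_def funpow_shift_translate translate_translate add.commute flip: future_shift)
      have ret: "first_return shift (B (n k)) z t"
        using w(2) E_iff[of 0] E_iff by (auto simp: first_return_def)
      have pre: "word ((shift ^^ t) z) (m k) = word p (m k)"
      proof -
        have "(shift ^^ t) z \<in> B (n k)" using ret by (simp add: first_return_def)
        then have "word ((shift ^^ t) z) (2 * m k) = word p (2 * m k)"
          using good[OF that] by (simp add: good_def)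
        then show ?thesis by (simp add: word_eq_iff)
      qed
      have "word z t @ word p (m k) = word z (m k + t)" using word_add[of z t "m k"] pre by (simp add: add.commute)
      then have "drop (m k) (word z t @ word p (m k)) = word ((shift ^^ m k) z) t"
        using drop_word[of "m k" "m k + t" z] by simp
      also have "(shift ^^ m k) z = future x"
        by (simp add: z_def funpow_shift_translate translate_translate flip: future_shift)
      finally have "w = drop (m k) (word z t @ word p (m k))" by (simp add: w(1) word_future)
      then show "w \<in> (\<lambda>w. drop (m k) (w @ word p (m k))) ` return_words (B (n k))"
        by (rule image_eqI) (use ret in \<open>auto simp: return_words_def\<close>)
    qed
    moreover have "finite (return_words (B (n k)))" "card (return_words (B (n k))) \<le> K"
      using good[OF that] by (auto simp: good_def few_at_def)
    ultimately show ?thesis by (meson card_image_le card_mono finite_imageI finite_subset le_trans)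
  qed
  then have "\<exists>\<^sub>\<infinity>k. finite (return_words (E k)) \<and> card (return_words (E k)) \<le> K"
    unfolding INFM_nat by (metis lessI zero_less_Suc)
  ultimately show ?thesis by (auto simp: few_return_words_def)
qed


section \<open>Conjugacy and ranks\<close>

lemma topologically_conjugate_sym:
  assumes "topologically_conjugate S f T g" "f ` topspace S \<subseteq> topspace S"
  shows "topologically_conjugate T g S f"
proof -
  obtain h where h: "homeomorphic_map S T h" "\<And>x. x \<in> topspace S \<Longrightarrow> h (f x) = g (h x)"
    using assms(1) unfolding topologically_conjugate_def by blast
  obtain k where k: "homeomorphic_maps S T h k" using h(1) homeomorphic_map_maps by blast
  have "homeomorphic_map T S k" using k homeomorphic_map_maps homeomorphic_maps_sym by blast
  moreover have "k (g y) = f (k y)" if "y \<in> topspace T" for y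
  proof -
    have ky: "k y \<in> topspace S" "h (k y) = y"
      using k that by (auto simp: homeomorphic_maps_def continuous_map_def)
    then have "k (g y) = k (h (f (k y)))" using h(2) by simp
    also have "\<dots> = f (k y)" using k ky(1) assms(2) by (auto simp: homeomorphic_maps_def)
    finally show ?thesis .
  qed
  ultimately show ?thesis unfolding topologically_conjugate_def by blast
qed

lemma topologically_conjugate_trans:
  assumes "topologically_conjugate S f T g" "topologically_conjugate T g U k"
  shows "topologically_conjugate S f U k"
proof -
  obtain h where h: "homeomorphic_map S T h" "\<forall>x\<in>topspace S. h (f x) = g (h x)"
    using assms(1) unfolding topologically_conjugate_def by blast
  obtain h' where h': "homeomorphic_map T U h'" "\<forall>x\<in>topspace T. h' (g x) = k (h' x)"
    using assms(2) unfolding topologically_conjugate_def by blast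
  have "h x \<in> topspace T" if "x \<in> topspace S" for x
    using h(1) that homeomorphic_imp_surjective_map by blast
  then show ?thesis
    unfolding topologically_conjugate_def
    using homeomorphic_map_compose[OF h(1) h'(1)] h(2) h'(2) by (intro exI[of _ "h' \<circ> h"]) auto
qed

lemma liminf_enat_le_iff_frequently:
  "liminf (\<lambda>n. enat (r n)) \<le> enat K \<longleftrightarrow> (\<exists>\<^sub>\<infinity>n. r n \<le> K)"
proof
  assume L: "liminf (\<lambda>n. enat (r n)) \<le> enat K"
  show "\<exists>\<^sub>\<infinity>n. r n \<le> K"
  proof (rule ccontr)
    assume "\<not> ?thesis"
    then have "\<forall>\<^sub>F n in sequentially. enat (Suc K) \<le> enat (r n)"
      by (simp add: frequently_def cofinite_eq_sequentially not_le Suc_le_eq)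
    then have "enat (Suc K) \<le> liminf (\<lambda>n. enat (r n))" by (rule Liminf_bounded)
    then have "enat (Suc K) \<le> enat K" using L by (rule order_trans)
    then show False by simp
  qed
next
  assume R: "\<exists>\<^sub>\<infinity>n. r n \<le> K"
  show "liminf (\<lambda>n. enat (r n)) \<le> enat K"
    unfolding Liminf_def
  proof (rule SUP_least)
    fix P assume "P \<in> {P. eventually P sequentially}"
    then have P: "\<forall>\<^sub>\<infinity>n. P n" by (simp add: cofinite_eq_sequentially)
    obtain n where "P n" "r n \<le> K"
      using frequently_eventually_frequently[OF R P] frequently_ex by blast
    then show "(INF x\<in>{x. P x}. enat (r x)) \<le> enat K"
      by (intro INF_lower2[of n]) auto
  qed
qed


section \<open>Return words from a covering\<close>

lemma graph_coveringD:
  assumes "graph_covering G"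
  shows "finite (cov_verts G n)" "cov_edges G n \<subseteq> cov_verts G n \<times> cov_verts G n"
    "v \<in> cov_verts G n \<Longrightarrow> \<exists>w. (v, w) \<in> cov_edges G n"
    "v \<in> cov_verts G (Suc n) \<Longrightarrow> cov_map G (Suc n) v \<in> cov_verts G n"
    "(u, v) \<in> cov_edges G (Suc n) \<Longrightarrow> (cov_map G (Suc n) u, cov_map G (Suc n) v) \<in> cov_edges G n"
    "(u, v) \<in> cov_edges G (Suc n) \<Longrightarrow> (u, v') \<in> cov_edges G (Suc n) \<Longrightarrow>
       cov_map G (Suc n) v = cov_map G (Suc n) v'"
proof -
  have g: "graph (cov_verts G n) (cov_edges G n)"
    and c: "cover (cov_verts G (Suc n)) (cov_edges G (Suc n)) (cov_verts G n) (cov_edges G n)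
      (cov_map G (Suc n))"
    using assms by (auto simp: graph_covering_def)
  show "finite (cov_verts G n)" "cov_edges G n \<subseteq> cov_verts G n \<times> cov_verts G n"
    "v \<in> cov_verts G n \<Longrightarrow> \<exists>w. (v, w) \<in> cov_edges G n"
    using g by (auto simp: graph_def)
  show "v \<in> cov_verts G (Suc n) \<Longrightarrow> cov_map G (Suc n) v \<in> cov_verts G n"
    "(u, v) \<in> cov_edges G (Suc n) \<Longrightarrow> (cov_map G (Suc n) u, cov_map G (Suc n) v) \<in> cov_edges G n"
    using c[unfolded cover_def, THEN conjunct1] by (auto simp: graph_homomorphism_def)
  show "cov_map G (Suc n) v = cov_map G (Suc n) v'"
    if "(u, v) \<in> cov_edges G (Suc n)" "(u, v') \<in> cov_edges G (Suc n)"
  proof -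
    have "\<forall>u v v'. (u, v) \<in> cov_edges G (Suc n) \<and> (u, v') \<in> cov_edges G (Suc n) \<longrightarrow>
        cov_map G (Suc n) v = cov_map G (Suc n) v'"
      by (rule c[unfolded cover_def, THEN conjunct2, THEN conjunct2])
    then show ?thesis using that by (elim allE impE) (rule conjI)
  qed
qed

text \<open>
  The image of a point is unique since covers send all successors of a vertex to one vertex.
\<close>

lemma inverse_limit_map_eqI:
  assumes G: "graph_covering G" and y: "y \<in> inverse_limit G" "\<And>i. (x i, y i) \<in> cov_edges G i"
  shows "inverse_limit_map G x = y"
  unfolding inverse_limit_map_def
proof (rule the_equality)
  fix z assume z: "z \<in> inverse_limit G \<and> (\<forall>i. (x i, z i) \<in> cov_edges G i)"
  show "z = y"
  proof
    fix i
    have "z i = cov_map G (Suc i) (z (Suc i))" "y i = cov_map G (Suc i) (y (Suc i))"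
      using z y(1) unfolding inverse_limit_def by blast+
    moreover have "cov_map G (Suc i) (z (Suc i)) = cov_map G (Suc i) (y (Suc i))"
      by (rule graph_coveringD(6)[OF G _ y(2)]) (use z in blast)
    ultimately show "z i = y i" by simp
  qed
qed (use y in auto)

lemma inverse_limit_map_props:
  assumes G: "graph_covering G" and x: "x \<in> inverse_limit G"
  shows "inverse_limit_map G x \<in> inverse_limit G" "(x i, inverse_limit_map G x i) \<in> cov_edges G i"
proof -
  have xV: "x i \<in> cov_verts G i" "x i = cov_map G (Suc i) (x (Suc i))" for i
    using x unfolding inverse_limit_def by blast+
  obtain w where w: "\<And>i. (x i, w i) \<in> cov_edges G i"
    using choice[of "\<lambda>i w. (x i, w) \<in> cov_edges G i"] graph_coveringD(3)[OF G xV(1)] by auto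
  define y where "y i = cov_map G (Suc i) (w (Suc i))" for i
  have e: "(x i, y i) \<in> cov_edges G i" for i
    using graph_coveringD(5)[OF G w[of "Suc i"]] xV(2)[of i] by (simp add: y_def)
  have "y i \<in> cov_verts G i" for i using e[of i] graph_coveringD(2)[OF G, of i] by blast
  moreover have "y i = cov_map G (Suc i) (y (Suc i))" for i
    using graph_coveringD(6)[OF G w e, of i] by (simp add: y_def)
  ultimately have y: "y \<in> inverse_limit G" unfolding inverse_limit_def by blast
  have "inverse_limit_map G x = y" by (rule inverse_limit_map_eqI[OF G y e])
  then show "inverse_limit_map G x \<in> inverse_limit G" "(x i, inverse_limit_map G x i) \<in> cov_edges G i"
    using y e by auto
qed

lemma walk_edges_iff:
  "(v, w) \<in> walk_edges c \<longleftrightarrow> (\<exists>j<walk_length c. v = c ! j \<and> w = c ! Suc j)"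
  by (auto simp: walk_edges_def walk_length_def less_diff_conv)

lemma walk_edges_map: "walk_edges (map f c) = map_prod f f ` walk_edges c"
proof (intro equalityI subsetI)
  fix e assume "e \<in> walk_edges (map f c)"
  then obtain i where "Suc i < length c" "e = (f (c ! i), f (c ! Suc i))" by (auto simp: walk_edges_def)
  then show "e \<in> map_prod f f ` walk_edges c"
    by (intro image_eqI[of _ _ "(c ! i, c ! Suc i)"]) (auto simp: walk_edges_def)
next
  fix e assume "e \<in> map_prod f f ` walk_edges c"
  then obtain i where "Suc i < length c" "e = (f (c ! i), f (c ! Suc i))" by (auto simp: walk_edges_def)
  then show "e \<in> walk_edges (map f c)" by (auto simp: walk_edges_def intro!: exI[of _ i])
qed

lemma cov_comp_Suc: "cov_comp G n (Suc n) = cov_map G (Suc n)"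
  by (cases n) auto

text \<open>
  Outside the base vertex every vertex has only one outgoing edge, so a walk that leaves the base
  vertex follows one of the listed circuits until it is back.
\<close>

lemma gm_level_return_walk:
  assumes gm: "gm_level V E b r c"
    and u: "\<And>j. j < t \<Longrightarrow> (u j, u (Suc j)) \<in> E" "u 0 = b" "u t = b" "t > 0"
      "\<And>j. 0 < j \<Longrightarrow> j < t \<Longrightarrow> u j \<noteq> b"
  obtains i where "i \<in> {1..r}" "t = walk_length (c i)" "\<And>j. j \<le> t \<Longrightarrow> u j = c i ! j"
proof -
  have circ: "circuit V E (c i)" "hd (c i) = b" if "i \<in> {1..r}" for i
    using gm that by (auto simp: gm_level_def)
  have E: "E = (\<Union>i\<in>{1..r}. walk_edges (c i))" using gm by (simp add: gm_level_def)
  have merge: "c i ! Suc j = c i' ! Suc j'"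
    if "i \<in> {1..r}" "i' \<in> {1..r}" "j \<in> {1..<walk_length (c i)}" "j' \<in> {1..<walk_length (c i')}"
      "c i ! j = c i' ! j'" for i i' j j'
  proof -
    have "\<forall>k\<le>walk_length (c i) - j. c i ! (j + k) = c i' ! (j' + k)"
      using gm that unfolding gm_level_def by (meson atLeastAtMost_iff atLeastLessThan_iff less_imp_le)
    then show ?thesis using that(3) by (auto dest: spec[of _ 1])
  qed
  have base: "c i ! 0 = b" "c i ! walk_length (c i) = b" "walk_length (c i) > 0"
    "\<And>j. j < walk_length (c i) \<Longrightarrow> c i ! j = b \<Longrightarrow> j = 0" if i: "i \<in> {1..r}" for i
  proof -
    have ne: "c i \<noteq> []" and l: "walk_length (c i) > 0" and d: "distinct (butlast (c i))"
      using circ[OF i] by (auto simp: circuit_def walk_def)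
    show "walk_length (c i) > 0" by (rule l)
    show 0: "c i ! 0 = b" using ne circ(2)[OF i] by (simp add: hd_conv_nth)
    show "c i ! walk_length (c i) = b"
      using circ[OF i] ne by (simp add: circuit_def walk_length_def last_conv_nth)
    fix j assume j: "j < walk_length (c i)" "c i ! j = b"
    have "butlast (c i) ! j = butlast (c i) ! 0"
      using j 0 l by (simp add: nth_butlast walk_length_def)
    then show "j = 0" using d j l by (simp add: nth_eq_iff_index_eq walk_length_def)
  qed
  have "(b, u 1) \<in> E" using u(1)[OF u(4)] u(2) by simp
  then obtain i j where i: "i \<in> {1..r}" "j < walk_length (c i)" "b = c i ! j" "u 1 = c i ! Suc j"
    unfolding E UN_iff walk_edges_iff by blast
  have "j = 0" using base(4)[OF i(1,2)] i(3) by simp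
  then have u1: "u 1 = c i ! 1" using i(4) by simp
  have eq: "u j = c i ! j" if "1 \<le> j" "j \<le> t" "j \<le> walk_length (c i)" for j
    using that
  proof (induction j rule: dec_induct)
    case base
    show ?case by (rule u1)
  next
    case (step j)
    have uj: "u j = c i ! j" using step by simp
    have "u j \<noteq> b" by (rule u(5)) (use step.hyps step.prems in auto)
    obtain i' j' where i': "i' \<in> {1..r}" "j' < walk_length (c i')" "u j = c i' ! j'" "u (Suc j) = c i' ! Suc j'"
      using u(1)[of j] step.prems unfolding E UN_iff walk_edges_iff by (metis Suc_le_lessD)
    have "j' \<noteq> 0" using \<open>u j \<noteq> b\<close> i'(3) base(1)[OF i'(1)] by metis
    then show ?case using merge[OF i(1) i'(1), of j j'] i' uj step by simp
  qed
  note b = base[OF i(1)]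
  have "\<not> t < walk_length (c i)" using eq[of t] u(3,4) b(4)[of t] by force
  moreover have "\<not> walk_length (c i) < t" using eq[of "walk_length (c i)"] u(5) b(2,3) by force
  ultimately have t: "t = walk_length (c i)" by simp
  have "u j = c i ! j" if "j \<le> t" for j
    using eq[of j] that t u(2) b(1) by (cases "j = 0") auto
  then show thesis using that[OF i(1) t] by blast
qed

lemma inverse_limit_lower_levels:
  assumes "x \<in> inverse_limit G" "y \<in> inverse_limit G" "x n = y n" "i \<le> n"
  shows "x i = y i"
  using assms(4,3)
proof (induction i rule: inc_induct)
  case (step i)
  then show ?case using assms(1,2) unfolding inverse_limit_def by (metis (mono_tags, lifting) mem_Collect_eq)
qed

text \<open>
  The sets are the preimages of the base vertices. A return follows one of the \<open>r n\<close>
  circuits, and for large \<open>n\<close> the circuit determines the return word, because the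
  letter at \<open>0\<close> depends on finitely many levels, hence on the vertex at level
  \<open>n\<close>.
\<close>

lemma few_return_words_of_covering:
  fixes X :: "(nat \<Rightarrow> 'a) set" and G :: "'v graph_seq"
  assumes X: "minimal_subshift A X" and gm: "gm_covering G b r c" and r: "gm_rank r \<le> enat K"
    and conj: "topologically_conjugate (inverse_limit_topology G) (inverse_limit_map G)
       (subshift_topology A X) shift"
  shows "few_return_words (subshift_topology A X) K"
proof -
  let ?T = "subshift_topology A X" and ?I = "inverse_limit_topology G"
  note D = minimal_subshiftD[OF X]
  have G: "graph_covering G" and b0: "cov_verts G 0 = {b 0}"
    and level: "\<And>n. n > 0 \<Longrightarrow> gm_level (cov_verts G n) (cov_edges G n) (b n) (r n) (c n)"
    and bmap: "\<And>n. cov_map G (Suc n) (b (Suc n)) = b n"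
    using gm by (auto simp: gm_covering_def)
  have I: "inverse_limit G \<subseteq> Pi UNIV (cov_verts G)" by (auto simp: inverse_limit_def)
  have tsI: "topspace ?I = inverse_limit G"
    unfolding inverse_limit_topology_def by (rule topspace_seq_topology[OF I])
  obtain h where h: "homeomorphic_map ?I ?T h"
    "\<And>x. x \<in> inverse_limit G \<Longrightarrow> h (inverse_limit_map G x) = shift (h x)"
    using conj unfolding topologically_conjugate_def tsI by blast
  obtain k where k: "homeomorphic_maps ?I ?T h k" using h(1) homeomorphic_map_maps by blast
  have hk: "continuous_map ?I ?T h" "continuous_map ?T ?I k"
    "\<And>x. x \<in> inverse_limit G \<Longrightarrow> k (h x) = x" "\<And>z. z \<in> X \<Longrightarrow> h (k z) = z"
    "\<And>x. x \<in> inverse_limit G \<Longrightarrow> h x \<in> X" "\<And>z. z \<in> X \<Longrightarrow> k z \<in> inverse_limit G"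
    using k unfolding homeomorphic_maps_def continuous_map_def tsI D(2) by auto
  have k_shift: "k (shift z) = inverse_limit_map G (k z)" if "z \<in> X" for z
    using h(2)[OF hk(6)[OF that]] hk(3)[OF inverse_limit_map_props(1)[OF G hk(6)[OF that]]] hk(4)[OF that]
    by simp
  define B where "B n = {z \<in> X. k z n = b n}" for n
  have bI: "b \<in> inverse_limit G"
  proof -
    have "b i \<in> cov_verts G i" for i
      using b0 level[of i] by (cases "i = 0") (auto simp: gm_level_def)
    then show ?thesis using bmap[symmetric] unfolding inverse_limit_def by blast
  qed
  have open_k: "openin ?T {z \<in> X. k z n = v}" for n v
    using hk(2) unfolding inverse_limit_topology_def continuous_map_seq_topology_iff[OF I] D(2) by blast
  have "shrinking_sets ?T B (h b)"
    unfolding shrinking_sets_def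
  proof (intro conjI allI)
    fix n
    show "openin ?T (B n)" unfolding B_def by (rule open_k)
    have "topspace ?T - B n = (\<Union>v\<in>- {b n}. {z \<in> X. k z n = v})" by (auto simp: B_def D(2))
    then have "openin ?T (topspace ?T - B n)" using open_k by auto
    then show "closedin ?T (B n)" using D(2) by (auto simp: closedin_def B_def)
    show "B (Suc n) \<subseteq> B n"
    proof
      fix z assume "z \<in> B (Suc n)"
      then have z: "z \<in> X" "k z (Suc n) = b (Suc n)" by (auto simp: B_def)
      have "k z n = cov_map G (Suc n) (k z (Suc n))"
        using hk(6)[OF z(1)] unfolding inverse_limit_def by blast
      then show "z \<in> B n" using z bmap by (simp add: B_def)
    qed
    show "(\<Inter>n. B n) = {h b}"
    proof (intro equalityI subsetI)
      fix z assume "z \<in> (\<Inter>n. B n)"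
      then have "z \<in> X" "k z = b" by (auto simp: B_def)
      then show "z \<in> {h b}" using hk(4) by force
    qed (use bI hk in \<open>auto simp: B_def\<close>)
  qed
  moreover have "\<exists>\<^sub>\<infinity>n. finite (return_words (B n)) \<and> card (return_words (B n)) \<le> K"
  proof -
    have "compact_space ?I"
      using D(3) homeomorphic_compact_space homeomorphic_map_imp_homeomorphic_space[OF h(1)] by blast
    moreover have "openin ?I {x \<in> inverse_limit G. h x 0 = v}" for v
      using hk(1) unfolding subshift_topology_eq continuous_map_seq_topology_iff[OF D(1)] tsI by blast
    ultimately obtain F where F: "finite F"
      "\<And>x y. x \<in> inverse_limit G \<Longrightarrow> y \<in> inverse_limit G \<Longrightarrow> agree_on F x y \<Longrightarrow> h x 0 = h y 0"
      using uniform_window[OF I, of "\<lambda>x. h x 0"] unfolding inverse_limit_topology_def by blast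
    obtain N where N: "F \<subseteq> {..<N}" using F(1) finite_nat_iff_bounded by blast
    have letter: "h x 0 = h y 0" if "x \<in> inverse_limit G" "y \<in> inverse_limit G" "x n = y n" "n \<ge> N" for x y n
      using F(2)[OF that(1,2)] inverse_limit_lower_levels[OF that(1-3)] N that(4)
      by (force simp: agree_on_def)
    have few: "finite (return_words (B n)) \<and> card (return_words (B n)) \<le> r n" if n: "n \<ge> N" "n > 0" for n
    proof -
      define l where "l v = h (SOME x. x \<in> inverse_limit G \<and> x n = v) 0" for v
      have l: "l (x n) = h x 0" if "x \<in> inverse_limit G" for x
        using someI_ex[of "\<lambda>y. y \<in> inverse_limit G \<and> y n = x n"] that letter n unfolding l_def by blast
      have "return_words (B n) \<subseteq> (\<lambda>i. map (\<lambda>j. l (c n i ! j)) [0..<walk_length (c n i)]) ` {1..r n}"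
      proof
        fix w assume "w \<in> return_words (B n)"
        then obtain z t where w: "w = word z t" "first_return shift (B n) z t"
          by (auto simp: return_words_def)
        define u where "u j = k ((shift ^^ j) z) n" for j
        have zX: "z \<in> X" using w(2) by (simp add: first_return_def B_def)
        note zj = D(8)[OF zX]
        have u_b: "u j = b n \<longleftrightarrow> (shift ^^ j) z \<in> B n" for j using zj by (simp add: u_def B_def)
        have "(u j, u (Suc j)) \<in> cov_edges G n" for j
          using inverse_limit_map_props(2)[OF G hk(6)[OF zj[of j]], of n] k_shift[OF zj[of j]]
          by (simp add: u_def)
        moreover have "u 0 = b n" "u t = b n" "t > 0" "\<And>j. 0 < j \<Longrightarrow> j < t \<Longrightarrow> u j \<noteq> b n"
          using w(2) u_b[of 0] u_b by (auto simp: first_return_def)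
        ultimately obtain i where i: "i \<in> {1..r n}" "t = walk_length (c n i)" "\<And>j. j \<le> t \<Longrightarrow> u j = c n i ! j"
          using gm_level_return_walk[OF level[OF n(2)], of t u] by metis
        have "z j = l (c n i ! j)" if "j < t" for j
        proof -
          have "z j = ((shift ^^ j) z) 0" by (simp add: funpow_shift)
          also have "\<dots> = h (k ((shift ^^ j) z)) 0" using hk(4)[OF zj] by simp
          also have "\<dots> = l (u j)" using l[OF hk(6)[OF zj[of j]]] by (simp add: u_def)
          finally show ?thesis using i(3) that by simp
        qed
        then have "w = map (\<lambda>j. l (c n i ! j)) [0..<walk_length (c n i)]"
          by (intro nth_equalityI) (auto simp: w(1) nth_word simp flip: i(2))
        then show "w \<in> (\<lambda>i. map (\<lambda>j. l (c n i ! j)) [0..<walk_length (c n i)]) ` {1..r n}"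
          using i(1) by blast
      qed
      then show ?thesis
        using surj_card_le[of "{1..r n}" "return_words (B n)"] finite_surj[of "{1..r n}" "return_words (B n)"]
        by simp
    qed
    have "\<exists>\<^sub>\<infinity>n. r n \<le> K" using r unfolding gm_rank_def liminf_enat_le_iff_frequently .
    moreover have "\<forall>\<^sub>\<infinity>n. n > N" by (simp add: MOST_nat) blast
    ultimately have "\<exists>\<^sub>\<infinity>n. r n \<le> K \<and> n > N" by (rule frequently_eventually_frequently)
    then show ?thesis
    proof (rule INFM_mono)
      fix n assume "r n \<le> K \<and> n > N"
      then show "finite (return_words (B n)) \<and> card (return_words (B n)) \<le> K" using few[of n] by simp
    qed
  qed
  ultimately show ?thesis unfolding few_return_words_def by blast
qed


section \<open>Entrance words\<close>

definition hitting_time :: "('i::semiring_1 \<Rightarrow> 'a) set \<Rightarrow> ('i \<Rightarrow> 'a) \<Rightarrow> nat" where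
  "hitting_time D x = (LEAST e. (shift ^^ e) x \<in> D)"

text \<open>
  The vertex of a point in the covering will be the word read until \<open>D\<close> is entered, so
  the base vertex is the empty word. Reading a letter leads to the tail of the word, and points with
  different pasts but the same future up to the entrance share their vertex.
\<close>

definition entrance_word :: "('i::semiring_1 \<Rightarrow> 'a) set \<Rightarrow> ('i \<Rightarrow> 'a) \<Rightarrow> 'a list" where
  "entrance_word D x = word x (hitting_time D x)"

lemma one_sided_window:
  fixes X :: "(nat \<Rightarrow> 'a) set"
  assumes X: "minimal_subshift A X"
    and C: "openin (subshift_topology A X) C" "closedin (subshift_topology A X) C"
  obtains L where "\<And>x y. x \<in> X \<Longrightarrow> y \<in> X \<Longrightarrow> word x L = word y L \<Longrightarrow> x \<in> C \<longleftrightarrow> y \<in> C"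
proof -
  obtain F where F: "finite F" "\<And>x y. x \<in> X \<Longrightarrow> y \<in> X \<Longrightarrow> agree_on F x y \<Longrightarrow> x \<in> C \<longleftrightarrow> y \<in> C"
    using clopen_window[OF X C] by metis
  obtain L where L: "F \<subseteq> {..<L}" using F(1) finite_nat_iff_bounded by blast
  have "x \<in> C \<longleftrightarrow> y \<in> C" if "x \<in> X" "y \<in> X" "word x L = word y L" for x y
    using F(2)[OF that(1,2)] L that(3) by (auto simp: word_eq_iff agree_on_def)
  then show thesis using that by blast
qed

lemma word_take: "s \<le> t \<Longrightarrow> word x t = word y t \<Longrightarrow> word x s = word y s"
  by (simp add: word_eq_iff)

lemma entrance_word_first_return:
  assumes "first_return shift D x t" "0 < j" "j \<le> t"
  shows "entrance_word D ((shift ^^ j) x) = drop j (word x t)"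
proof -
  have "hitting_time D ((shift ^^ j) x) = t - j"
    unfolding hitting_time_def
  proof (rule Least_equality)
    show "(shift ^^ (t - j)) ((shift ^^ j) x) \<in> D"
      using assms by (simp add: funpow_funpow_diff first_return_def)
    fix e assume e: "(shift ^^ e) ((shift ^^ j) x) \<in> D"
    then have "(shift ^^ (e + j)) x \<in> D" by (simp add: funpow_add)
    then show "t - j \<le> e" using assms unfolding first_return_def by (metis add_gr_0 le_diff_conv not_less)
  qed
  then show ?thesis using assms(3) by (simp add: entrance_word_def drop_word)
qed

lemma entrance_word_Nil: "x \<in> D \<Longrightarrow> entrance_word D x = []"
  unfolding entrance_word_def hitting_time_def by (metis Least_eq_0 funpow_0 word_0)

lemma entrance_word_visit:
  assumes X: "minimal_subshift A X" and D: "openin (subshift_topology A X) D" "D \<noteq> {}" and x: "x \<in> X"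
  shows "(shift ^^ length (entrance_word D x)) x \<in> D" "entrance_word D x = [] \<longleftrightarrow> x \<in> D"
    "entrance_word D x \<noteq> [] \<Longrightarrow> entrance_word D (shift x) = tl (entrance_word D x)"
    "\<And>e. (shift ^^ e) x \<in> D \<Longrightarrow> length (entrance_word D x) \<le> e"
proof -
  have len: "length (entrance_word D x) = hitting_time D x" by (simp add: entrance_word_def)
  obtain t where "(shift ^^ t) x \<in> D" by (rule late_visit[OF X D x, of 0])
  then show v: "(shift ^^ length (entrance_word D x)) x \<in> D"
    unfolding len hitting_time_def by (rule LeastI)
  show le: "length (entrance_word D x) \<le> e" if "(shift ^^ e) x \<in> D" for e
    unfolding len hitting_time_def using that by (rule Least_le)
  show nil: "entrance_word D x = [] \<longleftrightarrow> x \<in> D"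
    using v entrance_word_Nil by (metis funpow_0 list.size(3))
  assume ne: "entrance_word D x \<noteq> []"
  then obtain e where e: "hitting_time D x = Suc e" using len by (metis length_0_conv not0_implies_Suc)
  have "hitting_time D (shift x) = e"
    unfolding hitting_time_def
  proof (rule Least_equality)
    show "(shift ^^ e) (shift x) \<in> D" using v unfolding len e by (simp add: funpow_swap1)
    fix e' assume "(shift ^^ e') (shift x) \<in> D"
    then have "(shift ^^ Suc e') x \<in> D" by (simp add: funpow_swap1)
    then show "e \<le> e'" using le[of "Suc e'"] len e by simp
  qed
  moreover have "tl (word x (Suc e)) = word (shift x) e"
    using drop_word[of 1 "Suc e" x] by (simp add: drop_Suc)
  ultimately show "entrance_word D (shift x) = tl (entrance_word D x)"
    by (simp add: entrance_word_def e)
qed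

text \<open>
  A point of \<open>D'\<close> is followed by a word that decides about membership in
  \<open>D\<close>. So the letters read until \<open>D'\<close> is entered determine all visits to
  \<open>D\<close> up to that time.
\<close>

lemma entrance_word_refines:
  fixes X :: "(nat \<Rightarrow> 'a) set"
  assumes X: "minimal_subshift A X"
    and D: "openin (subshift_topology A X) D" "D \<noteq> {}"
    and D': "openin (subshift_topology A X) D'" "D' \<noteq> {}" "D' \<subseteq> D"
    and L: "\<And>x y. x \<in> X \<Longrightarrow> y \<in> X \<Longrightarrow> word x L = word y L \<Longrightarrow> x \<in> D \<longleftrightarrow> y \<in> D"
    and P: "\<And>x. x \<in> D' \<Longrightarrow> word x L = P"
    and x: "x \<in> X" and y: "y \<in> X" and eq: "entrance_word D' x = entrance_word D' y"
  shows "entrance_word D x = entrance_word D y"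
proof -
  note DX = minimal_subshiftD[OF X]
  note vx = entrance_word_visit[OF X D'(1,2) x] and vy = entrance_word_visit[OF X D'(1,2) y]
  define e where "e = length (entrance_word D' x)"
  have e: "(shift ^^ e) x \<in> D'" "(shift ^^ e) y \<in> D'" using vx(1) vy(1) eq by (auto simp: e_def)
  have "word x e = word y e"
    using eq unfolding entrance_word_def by (metis e_def entrance_word_def length_word)
  then have w: "word x (e + L) = word y (e + L)" using P[OF e(1)] P[OF e(2)] by (simp add: word_add)
  have iff: "(shift ^^ i) x \<in> D \<longleftrightarrow> (shift ^^ i) y \<in> D" if "i \<le> e" for i
  proof (rule L[OF DX(8)[OF x] DX(8)[OF y]])
    have "x (i + j) = y (i + j)" if "j < L" for j
      using w \<open>i \<le> e\<close> that by (simp add: word_eq_iff)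
    then show "word ((shift ^^ i) x) L = word ((shift ^^ i) y) L"
      by (simp add: word_eq_iff funpow_shift add.commute)
  qed
  note dx = entrance_word_visit[OF X D x] and dy = entrance_word_visit[OF X D y]
  have "length (entrance_word D x) \<le> e" "length (entrance_word D y) \<le> e"
    using dx(4)[of e] dy(4)[of e] e D'(3) by blast+
  then have "length (entrance_word D x) = length (entrance_word D y)"
    using iff dx(1,4) dy(1,4) by (meson le_antisym)
  moreover have "entrance_word D z = word z (length (entrance_word D z))" for z
    by (simp add: entrance_word_def)
  ultimately show ?thesis
    using word_take[OF _ w] \<open>length (entrance_word D x) \<le> e\<close> by (metis le_add1 le_trans)
qed

lemma entrance_word_locally_constant:
  fixes X :: "(nat \<Rightarrow> 'a) set"
  assumes X: "minimal_subshift A X"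
    and D: "openin (subshift_topology A X) D" "closedin (subshift_topology A X) D" "D \<noteq> {}"
  shows "openin (subshift_topology A X) {x \<in> X. entrance_word D x = w}"
proof (subst openin_subopen, intro ballI)
  let ?T = "subshift_topology A X"
  note DX = minimal_subshiftD[OF X]
  fix x assume x: "x \<in> {x \<in> X. entrance_word D x = w}"
  let ?out = "\<lambda>i. {y \<in> topspace ?T. (shift ^^ i) y \<in> topspace ?T - D}"
  let ?N = "({y \<in> topspace ?T. (shift ^^ length w) y \<in> D} \<inter> {y \<in> X. word y (length w) = w}) \<inter>
     (topspace ?T \<inter> \<Inter>(?out ` {..<length w}))"
  have out: "openin ?T (topspace ?T - D)" using D(2) by (simp add: closedin_def)
  have outs: "openin ?T (topspace ?T \<inter> \<Inter>(?out ` {..<length w}))"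
    by (rule openin_Int_Inter) (use openin_funpow_preimage[OF DX(7) out] in auto)
  have "openin ?T ?N"
    by (intro openin_Int[OF openin_Int[OF _ _] outs] openin_funpow_preimage[OF DX(7) D(1)] openin_word[OF X])
  moreover have "x \<in> ?N"
    using x entrance_word_visit[OF X D(1,3), of x] DX(2,8) by (force simp: entrance_word_def)
  moreover have "?N \<subseteq> {x \<in> X. entrance_word D x = w}"
  proof
    fix y assume y: "y \<in> ?N"
    have "hitting_time D y = length w"
      unfolding hitting_time_def
    proof (rule Least_equality)
      show "(shift ^^ length w) y \<in> D" using y by auto
      fix e assume "(shift ^^ e) y \<in> D"
      then have "\<not> e < length w" using y by auto
      then show "length w \<le> e" by simp
    qed
    then show "y \<in> {x \<in> X. entrance_word D x = w}" using y by (auto simp: entrance_word_def)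
  qed
  ultimately show "\<exists>N. openin ?T N \<and> x \<in> N \<and> N \<subseteq> {x \<in> X. entrance_word D x = w}" by blast
qed

lemma enumerate_from:
  assumes "finite R" "a \<in> R"
  shows "\<exists>c. bij_betw c {1..card R} R \<and> c (1::nat) = a"
proof -
  obtain h where h: "bij_betw h {1..card R} R" using ex_bij_betw_nat_finite_1[OF assms(1)] by blast
  then obtain j where j: "j \<in> {1..card R}" "h j = a" using assms(2) unfolding bij_betw_def by (metis imageE)
  define \<tau> where "\<tau> i = (if i = 1 then j else if i = j then 1 else i)" for i
  have "bij_betw \<tau> {1..card R} {1..card R}"
    by (rule bij_betw_byWitness[where f' = \<tau>]) (use j in \<open>auto simp: \<tau>_def\<close>)
  then have "bij_betw (h \<circ> \<tau>) {1..card R} R" using h by (rule bij_betw_trans)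
  moreover have "(h \<circ> \<tau>) 1 = a" using j by (simp add: \<tau>_def)
  ultimately show ?thesis by blast
qed

section \<open>A covering from return words\<close>

text \<open>
  The assumptions \<open>window\<close>, \<open>after\<close> and \<open>full\<close> say that every
  set of the sequence is small compared with its predecessor. They give, in this order, that the
  vertices of a level determine the vertices of the level below, that the covering maps are
  directional, and that the covering is simple.
\<close>

locale one_sided_cuts =
  fixes A :: "'a::countable set" and X :: "(nat \<Rightarrow> 'a) set" and B :: "nat \<Rightarrow> (nat \<Rightarrow> 'a) set" and p
  assumes X: "minimal_subshift A X"
    and B: "shrinking_sets (subshift_topology A X) B p"
    and B_0: "B 0 = X"
    and window: "\<And>n. \<exists>L P. (\<forall>x\<in>X. \<forall>y\<in>X. word x L = word y L \<longrightarrow> (x \<in> B n \<longleftrightarrow> y \<in> B n)) \<and>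
       (\<forall>x\<in>B (Suc n). word x L = P)"
    and after: "\<And>n x. x \<in> B (Suc n) \<Longrightarrow> entrance_word (B n) (shift x) = entrance_word (B n) (shift p)"
    and full: "\<And>n x y t. x \<in> X \<Longrightarrow> y \<in> B (Suc n) \<Longrightarrow> t > 0 \<Longrightarrow> (shift ^^ t) y \<in> B (Suc n) \<Longrightarrow>
       \<exists>i<t. entrance_word (B n) ((shift ^^ i) y) = entrance_word (B n) x \<and>
             entrance_word (B n) ((shift ^^ Suc i) y) = entrance_word (B n) (shift x)"
    and finite_words: "\<And>n. n > 0 \<Longrightarrow> finite (return_words (B n))"
begin

lemmas X_facts = minimal_subshiftD[OF X]
lemmas B_facts = shrinking_setsD[OF B]

lemma B_nonempty: "B n \<noteq> {}"
  using B_facts(4) by blast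

lemma B_subset: "B n \<subseteq> X"
  using openin_subset[OF B_facts(1)] X_facts(2) by simp

lemma p_in_X: "p \<in> X"
  using B_facts(5) X_facts(2) by simp

lemma shift_in_X: "x \<in> X \<Longrightarrow> shift x \<in> X"
  using X_facts(5) by blast

lemmas visit = entrance_word_visit[OF X B_facts(1) B_nonempty]

definition vert :: "nat \<Rightarrow> (nat \<Rightarrow> 'a) \<Rightarrow> nat" where
  "vert n x = to_nat (entrance_word (B n) x)"

definition vmap :: "nat \<Rightarrow> nat \<Rightarrow> nat" where
  "vmap n v = vert (n - 1) (SOME x. x \<in> X \<and> vert n x = v)"

definition cover_graph :: "nat graph_seq" where
  "cover_graph = \<lparr>cov_verts = \<lambda>n. vert n ` X,
     cov_edges = \<lambda>n. (\<lambda>x. (vert n x, vert n (shift x))) ` X, cov_map = vmap\<rparr>"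

definition base :: nat where
  "base = to_nat ([] :: 'a list)"

text \<open>
  The start needs its own case, since \<open>drop 0 w\<close> is not empty. The end is the base
  vertex because \<open>drop (length w) w\<close> is.
\<close>

definition return_circuit :: "'a list \<Rightarrow> nat list" where
  "return_circuit w = map (\<lambda>j. if j = 0 then base else to_nat (drop j w)) [0..<Suc (length w)]"

lemma cover_graph_simps [simp]:
  "cov_verts cover_graph n = vert n ` X"
  "cov_edges cover_graph n = (\<lambda>x. (vert n x, vert n (shift x))) ` X"
  "cov_map cover_graph = vmap"
  by (simp_all add: cover_graph_def)

lemma vert_eq_base_iff: "x \<in> X \<Longrightarrow> vert n x = base \<longleftrightarrow> x \<in> B n"
  using visit(2) by (simp add: vert_def base_def)

lemma vert_refines:
  assumes "x \<in> X" "y \<in> X" "vert (Suc n) x = vert (Suc n) y" shows "vert n x = vert n y"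
proof -
  obtain L P where "\<forall>x\<in>X. \<forall>y\<in>X. word x L = word y L \<longrightarrow> (x \<in> B n \<longleftrightarrow> y \<in> B n)"
    "\<forall>x\<in>B (Suc n). word x L = P" using window by blast
  note LP = this
  have "entrance_word (B n) x = entrance_word (B n) y"
  proof (rule entrance_word_refines[OF X B_facts(1) B_nonempty B_facts(1) B_nonempty])
    show "B (Suc n) \<subseteq> B n" by (rule B_facts(3)) simp
    show "entrance_word (B (Suc n)) x = entrance_word (B (Suc n)) y" using assms(3) by (simp add: vert_def)
    show "\<And>x y. x \<in> X \<Longrightarrow> y \<in> X \<Longrightarrow> word x L = word y L \<Longrightarrow> x \<in> B n \<longleftrightarrow> y \<in> B n"
      using LP(1) by blast
    show "\<And>x. x \<in> B (Suc n) \<Longrightarrow> word x L = P" using LP(2) by blast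
  qed (use assms in auto)
  then show ?thesis by (simp add: vert_def)
qed

lemma vmap_vert: "x \<in> X \<Longrightarrow> vmap (Suc n) (vert (Suc n) x) = vert n x"
proof -
  assume x: "x \<in> X"
  define y where "y = (SOME y. y \<in> X \<and> vert (Suc n) y = vert (Suc n) x)"
  have "y \<in> X \<and> vert (Suc n) y = vert (Suc n) x" unfolding y_def by (rule someI[of _ x]) (use x in simp)
  then have "vert n y = vert n x" using vert_refines[of y x n] x by simp
  then show ?thesis by (simp add: vmap_def y_def)
qed

text \<open>
  The base vertex does not determine the next vertex of its own level, but \<open>after\<close>
  prescribes the one of the level below.
\<close>

lemma vert_shift_cong:
  assumes x: "x \<in> X" and y: "y \<in> X" and eq: "vert (Suc n) x = vert (Suc n) y"
  shows "vert n (shift x) = vert n (shift y)"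
proof (cases "x \<in> B (Suc n)")
  case True
  then have "y \<in> B (Suc n)" using vert_eq_base_iff x y eq by metis
  then show ?thesis using after True by (simp add: vert_def)
next
  case False
  have e: "entrance_word (B (Suc n)) x = entrance_word (B (Suc n)) y" using eq by (simp add: vert_def)
  have "entrance_word (B (Suc n)) x \<noteq> []" using visit(2)[OF x] False by simp
  then have "vert (Suc n) (shift x) = vert (Suc n) (shift y)"
    using visit(3)[OF x] visit(3)[OF y] e by (simp add: vert_def)
  then show ?thesis using vert_refines shift_in_X x y by blast
qed

lemma finite_vert: "finite (vert n ` X)"
proof -
  have "openin (subshift_topology A X) {x \<in> X. entrance_word (B n) x = w}" for w
    by (rule entrance_word_locally_constant[OF X B_facts(1,2) B_nonempty])
  then have "finite (entrance_word (B n) ` X)"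
    using finite_range_locally_constant[OF X_facts(3)] X_facts(2) by metis
  moreover have "vert n ` X = to_nat ` entrance_word (B n) ` X" by (auto simp: vert_def)
  ultimately show ?thesis by simp
qed

lemma vert_0: "x \<in> X \<Longrightarrow> vert 0 x = base"
  using vert_eq_base_iff B_0 by simp

lemma graph_covering_cover_graph: "graph_covering cover_graph"
  unfolding graph_covering_def
proof (intro conjI allI)
  fix n
  show "graph (cov_verts cover_graph n) (cov_edges cover_graph n)"
    unfolding graph_def
  proof (intro conjI ballI)
    show "finite (cov_verts cover_graph n)" using finite_vert by simp
    show "cov_edges cover_graph n \<subseteq> cov_verts cover_graph n \<times> cov_verts cover_graph n"
      using shift_in_X by auto
    fix v assume "v \<in> cov_verts cover_graph n"
    then obtain x where x: "x \<in> X" "v = vert n x" by auto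
    then show "\<exists>w. (v, w) \<in> cov_edges cover_graph n" by auto
    obtain y where y: "y \<in> X" "x = shift y" using x X_facts(5) by blast
    then have "(vert n y, v) \<in> cov_edges cover_graph n" using x by auto
    then show "\<exists>u. (u, v) \<in> cov_edges cover_graph n" by blast
  qed
  show "cover (cov_verts cover_graph (Suc n)) (cov_edges cover_graph (Suc n))
      (cov_verts cover_graph n) (cov_edges cover_graph n) (cov_map cover_graph (Suc n))"
    unfolding cover_def graph_homomorphism_def
  proof (intro conjI allI impI)
    show "cov_map cover_graph (Suc n) ` cov_verts cover_graph (Suc n) \<subseteq> cov_verts cover_graph n"
      by (auto simp: vmap_vert)
    show "\<forall>(u, v)\<in>cov_edges cover_graph (Suc n).
        (cov_map cover_graph (Suc n) u, cov_map cover_graph (Suc n) v) \<in> cov_edges cover_graph n"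
      using shift_in_X by (auto simp: vmap_vert)
    show "map_prod (cov_map cover_graph (Suc n)) (cov_map cover_graph (Suc n)) `
        cov_edges cover_graph (Suc n) = cov_edges cover_graph n"
      using shift_in_X by (auto simp: vmap_vert image_image cong: image_cong_simp)
    fix u v v' assume "(u, v) \<in> cov_edges cover_graph (Suc n) \<and> (u, v') \<in> cov_edges cover_graph (Suc n)"
    then obtain x y where "x \<in> X" "y \<in> X" "vert (Suc n) x = vert (Suc n) y" "v = vert (Suc n) (shift x)"
      "v' = vert (Suc n) (shift y)" by auto
    then show "cov_map cover_graph (Suc n) v = cov_map cover_graph (Suc n) v'"
      using vert_shift_cong[of x y n] shift_in_X by (simp add: vmap_vert)
  qed
next
  have "vert 0 ` X = (\<lambda>_. base) ` X"
    "(\<lambda>x. (vert 0 x, vert 0 (shift x))) ` X = (\<lambda>_. (base, base)) ` X"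
    by (auto intro!: image_cong simp: vert_0 shift_in_X)
  then have "cov_verts cover_graph 0 = {base}" "cov_edges cover_graph 0 = {(base, base)}"
    using p_in_X by (simp_all add: image_constant[OF p_in_X])
  then show "\<exists>v0. cov_verts cover_graph 0 = {v0} \<and> cov_edges cover_graph 0 = {(v0, v0)}" by blast
qed

section \<open>The circuits of the covering\<close>

lemma length_return_circuit [simp]: "length (return_circuit w) = Suc (length w)"
  by (simp add: return_circuit_def)

lemma walk_length_return_circuit [simp]: "walk_length (return_circuit w) = length w"
  by (simp add: walk_length_def)

lemma return_circuit_0 [simp]: "return_circuit w ! 0 = base"
  by (simp add: return_circuit_def del: upt_Suc)

lemma return_circuit_nth: "0 < j \<Longrightarrow> j \<le> length w \<Longrightarrow> return_circuit w ! j = to_nat (drop j w)"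
  by (simp add: return_circuit_def del: upt_Suc)

lemma return_circuit_vert:
  assumes "first_return shift (B n) x t" "j \<le> t"
  shows "return_circuit (word x t) ! j = vert n ((shift ^^ j) x)"
proof (cases "j = 0")
  case True
  have "x \<in> B n" using assms by (simp add: first_return_def)
  then show ?thesis using True vert_eq_base_iff[of x n] subsetD[OF B_subset] by simp
next
  case False
  then show ?thesis
    using entrance_word_first_return[OF assms(1)] assms(2) by (simp add: vert_def return_circuit_nth)
qed

lemma circuit_return_circuit:
  assumes w: "w \<in> return_words (B n)"
  shows "circuit (vert n ` X) (cov_edges cover_graph n) (return_circuit w)" "hd (return_circuit w) = base"
proof -
  obtain x t where x: "w = word x t" "first_return shift (B n) x t" using w by (auto simp: return_words_def)
  have t: "t > 0" "x \<in> X" using x B_subset by (auto simp: first_return_def)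
  note v = return_circuit_vert[OF x(2), folded x(1)]
  have ne: "return_circuit w \<noteq> []" by (simp add: return_circuit_def)
  show hd: "hd (return_circuit w) = base" using ne by (simp add: hd_conv_nth)
  have last: "last (return_circuit w) = base"
    using ne t(1) return_circuit_nth[of t w] by (simp add: last_conv_nth x(1) base_def)
  have "set (return_circuit w) \<subseteq> vert n ` X"
    using v X_facts(8)[OF t(2)] by (force simp: in_set_conv_nth x(1))
  moreover have "(return_circuit w ! j, return_circuit w ! Suc j) \<in> cov_edges cover_graph n" if "j < t" for j
    using v[of j] v[of "Suc j"] that X_facts(8)[OF t(2), of j] by auto
  ultimately have "walk (vert n ` X) (cov_edges cover_graph n) (return_circuit w)"
    using ne by (auto simp: walk_def x(1))
  moreover have "distinct (butlast (return_circuit w))"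
  proof -
    have "i = j" if "i < t" "j < t" "return_circuit w ! i = return_circuit w ! j" for i j
    proof -
      define s where "s i = (if i = 0 then [] else drop i w)" for i
      have "return_circuit w ! i = to_nat (s i)" if "i < t" for i
        using that by (cases "i = 0") (auto simp: s_def base_def return_circuit_nth x(1))
      then have "s i = s j" using that by simp
      then have "length (s i) = length (s j)" by simp
      then show ?thesis using that by (auto simp: s_def x(1) split: if_splits)
    qed
    then show ?thesis by (auto simp: distinct_conv_nth nth_butlast x(1))
  qed
  ultimately show "circuit (vert n ` X) (cov_edges cover_graph n) (return_circuit w)"
    using hd last t(1) by (simp add: circuit_def x(1))
qed

lemma return_circuit_merge:
  assumes "j \<in> {1..length w}" "j' \<in> {1..length w'}" "return_circuit w ! j = return_circuit w' ! j'"
  shows "length w - j = length w' - j'"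
    "k \<le> length w - j \<Longrightarrow> return_circuit w ! (j + k) = return_circuit w' ! (j' + k)"
proof -
  have d: "drop j w = drop j' w'" using assms by (simp add: return_circuit_nth)
  then have "length (drop j w) = length (drop j' w')" by simp
  then show len: "length w - j = length w' - j'" by simp
  have "drop (k + j) w = drop (k + j') w'" using d by (metis drop_drop)
  moreover assume "k \<le> length w - j"
  then have "return_circuit w ! (k + j) = to_nat (drop (k + j) w)"
    "return_circuit w' ! (k + j') = to_nat (drop (k + j') w')"
    using assms(1,2) len by (auto intro!: return_circuit_nth)
  ultimately show "return_circuit w ! (j + k) = return_circuit w' ! (j' + k)"
    by (simp add: add.commute)
qed

lemma walk_edges_return_circuit:
  assumes "first_return shift (B n) x t"
  shows "walk_edges (return_circuit (word x t)) =
    (\<lambda>j. (vert n ((shift ^^ j) x), vert n ((shift ^^ Suc j) x))) ` {..<t}"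
proof -
  note v = return_circuit_vert[OF assms]
  have "v \<in> walk_edges (return_circuit (word x t)) \<longleftrightarrow>
      v \<in> (\<lambda>j. (vert n ((shift ^^ j) x), vert n ((shift ^^ Suc j) x))) ` {..<t}" for v
  proof (cases v)
    case (Pair a b)
    show ?thesis
      unfolding Pair walk_edges_iff using v by (force simp del: funpow.simps)
  qed
  then show ?thesis by blast
qed

lemma Union_walk_edges:
  "(\<Union>w\<in>return_words (B n). walk_edges (return_circuit w)) = cov_edges cover_graph n" (is "?L = ?R")
proof
  show "?L \<subseteq> ?R"
  proof
    fix e assume "e \<in> ?L"
    then obtain x t where x: "first_return shift (B n) x t" "e \<in> walk_edges (return_circuit (word x t))"
      by (auto simp: return_words_def)
    have "x \<in> X" using x B_subset by (auto simp: first_return_def)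
    then show "e \<in> ?R" using x(2) X_facts(8) unfolding walk_edges_return_circuit[OF x(1)] by auto
  qed
  show "?R \<subseteq> ?L"
  proof
    fix e assume "e \<in> ?R"
    then obtain x where x: "x \<in> X" "e = (vert n x, vert n (shift x))" by auto
    obtain y t j where y: "first_return shift (B n) y t" "j < t" "x = (shift ^^ j) y"
      by (rule last_visit[OF X B_facts(1) B_nonempty x(1)])
    have "e \<in> walk_edges (return_circuit (word y t))"
      unfolding walk_edges_return_circuit[OF y(1)] using x(2) y by auto
    moreover have "word y t \<in> return_words (B n)" using y(1) by (auto simp: return_words_def)
    ultimately show "e \<in> ?L" by blast
  qed
qed

text \<open>
  An edge from a nonempty entrance word cuts off its first letter. So following any circuit leads to
  the base vertex, and from there on the circuit reads off one return word.
\<close>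

lemma edge_from_word:
  fixes s :: "'a list"
  assumes "(to_nat s, v) \<in> cov_edges cover_graph n" "s \<noteq> []" shows "v = to_nat (tl s)"
proof -
  obtain x where x: "x \<in> X" "to_nat s = vert n x" "v = vert n (shift x)" using assms(1) by auto
  have "entrance_word (B n) x = s" using x(2) by (simp add: vert_def)
  then show ?thesis using visit(3)[OF x(1)] assms(2) x(3) by (simp add: vert_def)
qed

lemma walk_follows_word:
  fixes s :: "'a list"
  assumes e: "\<And>j. (u j, u (Suc j)) \<in> cov_edges cover_graph n" and u: "u 0 = to_nat s"
  shows "j \<le> length s \<Longrightarrow> u j = to_nat (drop j s)"
proof (induction j)
  case (Suc j)
  then have "(to_nat (drop j s), u (Suc j)) \<in> cov_edges cover_graph n" using e[of j] by simp
  moreover have "drop j s \<noteq> []" using Suc.prems by simp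
  ultimately have "u (Suc j) = to_nat (tl (drop j s))" by (rule edge_from_word)
  then show ?case by (simp add: drop_Suc tl_drop)
qed (use u in simp)

lemma circuit_is_return_circuit:
  assumes d: "circuit (vert n ` X) (cov_edges cover_graph n) d"
  shows "\<exists>w\<in>return_words (B n). \<exists>k. butlast d = rotate k (butlast (return_circuit w))"
proof -
  define ds where "ds = butlast d"
  define m where "m = length ds"
  have walk: "d \<noteq> []" "set d \<subseteq> vert n ` X" "\<And>i. Suc i < length d \<Longrightarrow> (d ! i, d ! Suc i) \<in> cov_edges cover_graph n"
    and "walk_length d \<ge> 1" and cl: "hd d = last d" and dist: "distinct ds"
    using d by (auto simp: circuit_def walk_def ds_def)
  then have m: "m > 0" "length d = Suc m" by (auto simp: m_def ds_def walk_length_def)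
  have ds: "ds ! i = d ! i" if "i < m" for i using that by (simp add: ds_def m_def nth_butlast)
  have dm: "d ! m = d ! 0" using cl walk(1) m by (simp add: last_conv_nth hd_conv_nth)
  define u where "u j = ds ! (j mod m)" for j
  have edge: "(u j, u (Suc j)) \<in> cov_edges cover_graph n" for j
  proof -
    define i where "i = j mod m"
    have i: "i < m" using m by (simp add: i_def)
    have "u (Suc j) = d ! Suc i"
    proof (cases "Suc i = m")
      case True
      then have "Suc j mod m = 0" by (simp add: i_def mod_Suc)
      then show ?thesis using True dm ds[OF m(1)] by (simp add: u_def)
    next
      case False
      then have "Suc j mod m = Suc i" by (simp add: i_def mod_Suc)
      then show ?thesis using False i ds[of "Suc i"] by (simp add: u_def)
    qed
    moreover have "u j = d ! i" using ds[OF i] by (simp add: u_def i_def)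
    ultimately show ?thesis using walk(3)[of i] m i by simp
  qed
  obtain x0 where "x0 \<in> X" "u 0 = vert n x0" using edge[of 0] by auto
  then have "u (length (entrance_word (B n) x0)) = base"
    using walk_follows_word[of u n "entrance_word (B n) x0", OF edge] by (simp add: vert_def base_def)
  then obtain k where k: "u k = base" by blast
  define u' where "u' j = u (k + j)" for j
  have edge': "(u' j, u' (Suc j)) \<in> cov_edges cover_graph n" for j using edge[of "k + j"] by (simp add: u'_def)
  obtain x where x: "x \<in> X" "u' 0 = vert n x" "u' 1 = vert n (shift x)" using edge'[of 0] by auto
  have "x \<in> B n" using vert_eq_base_iff[OF x(1), of n] x(2) k by (simp add: u'_def)
  then obtain t where t: "first_return shift (B n) x t"
    using first_return_minimal[OF X_facts(6,7) B_facts(1)] by blast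
  define w where "w = word x t"
  have t0: "t > 0" using t by (simp add: first_return_def)
  have "u' 1 = to_nat (drop 1 w)"
    using x(3) entrance_word_first_return[OF t, of 1] t0 by (simp add: vert_def w_def)
  then have "u' (Suc j) = to_nat (drop j (drop 1 w))" if "j \<le> length (drop 1 w)" for j
    using walk_follows_word[of "\<lambda>j. u' (Suc j)" n "drop 1 w" j, OF edge'] that by simp
  then have u'_drop: "u' j = to_nat (drop j w)" if "0 < j" "j \<le> t" for j
    using that by (cases j) (auto simp: w_def)
  have u'_nth: "u' j = return_circuit w ! j" if "j \<le> t" for j
    using that u'_drop[of j] k by (cases "j = 0") (auto simp: return_circuit_nth u'_def w_def)
  have rot: "rotate k ds ! j = u' j" if "j < m" for j
    using that by (simp add: nth_rotate m_def u'_def u_def add.commute)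
  have "m = t"
  proof (rule linorder_cases[of m t])
    assume "m < t"
    moreover have "u' m = base" using k by (simp add: u'_def u_def)
    ultimately have "drop m w = []" using u'_drop[of m] m(1) by (simp add: base_def)
    then show ?thesis using \<open>m < t\<close> by (simp add: w_def)
  next
    assume "t < m"
    have "u' t = u' 0" using u'_drop[of t] t0 k by (simp add: w_def u'_def base_def)
    then have "rotate k ds ! t = rotate k ds ! 0" using rot[OF \<open>t < m\<close>] rot[OF m(1)] by simp
    then have "t = 0"
      using nth_eq_iff_index_eq[of "rotate k ds" t 0] dist \<open>t < m\<close> m(1) by (simp add: m_def)
    then show ?thesis using t0 by simp
  qed
  then have eq: "rotate k ds = butlast (return_circuit w)"
    using rot u'_nth by (intro nth_equalityI) (auto simp: m_def nth_butlast w_def)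
  have "rotate (m - k mod m) (rotate k ds) = rotate ((m - k mod m) + k mod m) ds"
    unfolding rotate_conv_mod[of k ds] m_def[symmetric] by (rule rotate_rotate)
  then have "ds = rotate (m - k mod m) (butlast (return_circuit w))"
    using m(1) eq by (simp add: m_def)
  moreover have "w \<in> return_words (B n)" using t by (auto simp: return_words_def w_def)
  ultimately show ?thesis unfolding ds_def by blast
qed

lemma gm_level_cover_graph:
  assumes c: "bij_betw c {1..r} (return_circuit ` return_words (B n))"
  shows "gm_level (cov_verts cover_graph n) (cov_edges cover_graph n) base r c"
proof -
  have c_word: "\<exists>w\<in>return_words (B n). c i = return_circuit w" if "i \<in> {1..r}" for i
    using bij_betwE[OF c] that by blast
  have word_c: "\<exists>i\<in>{1..r}. c i = return_circuit w" if "w \<in> return_words (B n)" for w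
    using c that unfolding bij_betw_def by (metis imageE imageI)
  have "vert n p = base" using vert_eq_base_iff[OF p_in_X] B_facts(4) by simp
  then have f1: "base \<in> cov_verts cover_graph n" using p_in_X by force
  have f2: "circuit (cov_verts cover_graph n) (cov_edges cover_graph n) (c i) \<and> hd (c i) = base"
    if "i \<in> {1..r}" for i
    using c_word[OF that] circuit_return_circuit[of _ n] by auto
  have f3: "inj_on c {1..r}" using c by (rule bij_betw_imp_inj_on)
  have f4: "\<exists>i\<in>{1..r}. \<exists>k. butlast d = rotate k (butlast (c i))"
    if d: "circuit (cov_verts cover_graph n) (cov_edges cover_graph n) d" for d
  proof -
    obtain w k where w: "w \<in> return_words (B n)" "butlast d = rotate k (butlast (return_circuit w))"
      using circuit_is_return_circuit[of n d] d by auto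
    obtain i where "i \<in> {1..r}" "c i = return_circuit w" using word_c[OF w(1)] by blast
    then show ?thesis using w(2) by metis
  qed
  have f5: "(\<Union>i\<in>{1..r}. walk_edges (c i)) = cov_edges cover_graph n"
  proof -
    have "c ` {1..r} = return_circuit ` return_words (B n)" using c by (simp add: bij_betw_def)
    then have "(\<Union>i\<in>{1..r}. walk_edges (c i)) = (\<Union>w\<in>return_words (B n). walk_edges (return_circuit w))"
      by (metis image_image)
    then show ?thesis using Union_walk_edges by simp
  qed
  have f6: "walk_length (c i) - j = walk_length (c i') - j' \<and>
      (\<forall>k\<le>walk_length (c i) - j. c i ! (j + k) = c i' ! (j' + k))"
    if i: "i \<in> {1..r}" "i' \<in> {1..r}" "j \<in> {1..walk_length (c i)}" "j' \<in> {1..walk_length (c i')}"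
      "c i ! j = c i' ! j'" for i i' j j'
  proof -
    obtain w w' where w: "c i = return_circuit w" "c i' = return_circuit w'"
      using c_word i(1,2) by blast
    have "j \<in> {1..length w}" "j' \<in> {1..length w'}" "return_circuit w ! j = return_circuit w' ! j'"
      using i(3-5) by (auto simp: w)
    from return_circuit_merge[OF this] show ?thesis by (simp add: w)
  qed
  show ?thesis unfolding gm_level_def
    by (intro conjI[OF f1] conjI[OF _ conjI[OF f3]] conjI[OF _ conjI[OF f5]] ballI allI impI f2 f4 f6)
qed

text \<open>
  By \<open>full\<close>, a return at level \<open>Suc n\<close> runs through every edge of level
  \<open>n\<close>.
\<close>

lemma simple_cover_graph:
  assumes "w \<in> return_words (B (Suc n))"
  shows "walk_edges (map (cov_comp cover_graph n (Suc n)) (return_circuit w)) = cov_edges cover_graph n"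
proof -
  obtain y t where y: "w = word y t" "first_return shift (B (Suc n)) y t"
    using assms by (auto simp: return_words_def)
  have t: "y \<in> B (Suc n)" "t > 0" "(shift ^^ t) y \<in> B (Suc n)" using y(2) by (auto simp: first_return_def)
  then have yX: "(shift ^^ j) y \<in> X" for j using B_subset X_facts(8) by blast
  have "walk_edges (map (cov_comp cover_graph n (Suc n)) (return_circuit w)) =
      (\<lambda>j. (vert n ((shift ^^ j) y), vert n ((shift ^^ Suc j) y))) ` {..<t}"
    unfolding walk_edges_map cov_comp_Suc y(1) walk_edges_return_circuit[OF y(2)] image_image
    by (rule image_cong) (simp_all add: vmap_vert yX shift_in_X)
  also have "\<dots> = cov_edges cover_graph n"
  proof (intro equalityI subsetI)
    fix e assume "e \<in> cov_edges cover_graph n"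
    then obtain x where x: "x \<in> X" "e = (vert n x, vert n (shift x))" by auto
    obtain i where i: "i < t" "entrance_word (B n) ((shift ^^ i) y) = entrance_word (B n) x"
      "entrance_word (B n) ((shift ^^ Suc i) y) = entrance_word (B n) (shift x)"
      using full[OF x(1) t] by blast
    then have "e = (vert n ((shift ^^ i) y), vert n ((shift ^^ Suc i) y))" using x(2) by (simp add: vert_def)
    then show "e \<in> (\<lambda>j. (vert n ((shift ^^ j) y), vert n ((shift ^^ Suc j) y))) ` {..<t}"
      using i(1) by blast
  qed (use yX in auto)
  finally show ?thesis .
qed

text \<open>
  The enumeration of the circuits starts with the one that \<open>p\<close> follows, since all first
  edges of the next level are mapped to the first edge of this circuit.
\<close>

lemma gm_covering_cover_graph:
  "\<exists>b r c. gm_covering cover_graph b r c \<and> gm_simple cover_graph r c \<and>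
    (\<forall>n>0. r n \<le> card (return_words (B n)))"
proof -
  let ?R = "\<lambda>n. return_circuit ` return_words (B n)"
  have "\<exists>t. first_return shift (B n) p t" for n
    using first_return_minimal[OF X_facts(6,7) B_facts(1) B_facts(4)] by blast
  then obtain t where t: "\<And>n. first_return shift (B n) p (t n)" by metis
  have "return_circuit (word p (t n)) \<in> ?R n" for n using t by (auto simp: return_words_def)
  then have "\<exists>c. (n > 0 \<longrightarrow> bij_betw c {1..card (?R n)} (?R n)) \<and> c (1::nat) = return_circuit (word p (t n))" for n
    using enumerate_from[of "?R n" "return_circuit (word p (t n))"] finite_words[of n]
    by (cases "n > 0") auto
  then obtain c where c: "\<And>n. n > 0 \<Longrightarrow> bij_betw (c n) {1..card (?R n)} (?R n)"
    "\<And>n. c n (1::nat) = return_circuit (word p (t n))"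
    by metis
  have tp: "t n > 0" for n using t[of n] by (simp add: first_return_def)
  have c_word: "\<exists>x s. c n i = return_circuit (word x s) \<and> first_return shift (B n) x s"
    if "i \<in> {1..card (?R n)}" "n > 0" for n i
    using bij_betwE[OF c(1)[OF that(2)]] that(1) unfolding return_words_def by fast
  have c_1: "c n 1 ! 1 = vert n (shift p)" for n
    using return_circuit_vert[OF t, of 1 n] tp[of n] unfolding c(2) by simp
  have "gm_covering cover_graph (\<lambda>_. base) (\<lambda>n. card (?R n)) c"
    unfolding gm_covering_def
  proof (intro conjI allI impI ballI)
    show "graph_covering cover_graph" by (rule graph_covering_cover_graph)
    have "vert 0 ` X = (\<lambda>_. base) ` X" by (rule image_cong) (simp_all add: vert_0)
    then show "cov_verts cover_graph 0 = {base}" by (simp add: image_constant[OF p_in_X])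
    have "first_return shift (B 0) p 1"
      using p_in_X shift_in_X by (auto simp: first_return_def B_0)
    then have "t 0 = 1" by (rule first_return_unique[OF t])
    then show "c 0 1 = [base, base]" unfolding c(2) by (simp add: return_circuit_def base_def)
    show "gm_level (cov_verts cover_graph n) (cov_edges cover_graph n) base (card (?R n)) (c n)" if "0 < n" for n
      by (rule gm_level_cover_graph[OF c(1)[OF that]])
    fix n
    have "vert m p = base" for m using vert_eq_base_iff[OF p_in_X] B_facts(4) by simp
    then show "cov_map cover_graph (Suc n) base = base" using vmap_vert[OF p_in_X, of n] by simp
    fix i assume "i \<in> {1..card (?R (Suc n))}"
    then obtain x s where x: "c (Suc n) i = return_circuit (word x s)" "first_return shift (B (Suc n)) x s"
      using c_word by blast
    then have s: "s > 0" "x \<in> B (Suc n)" "x \<in> X" using B_subset by (auto simp: first_return_def)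
    have "c (Suc n) i ! 1 = vert (Suc n) (shift x)"
      using return_circuit_vert[OF x(2), of 1] s by (simp add: x(1))
    then have "cov_map cover_graph (Suc n) (c (Suc n) i ! 1) = vert n (shift x)"
      using vmap_vert shift_in_X s(3) by simp
    also have "\<dots> = vert n (shift p)" using after[OF s(2)] by (simp add: vert_def)
    finally show "cov_map cover_graph (Suc n) (c (Suc n) i ! 1) = c n 1 ! 1" using c_1 by simp
  qed
  moreover have "gm_simple cover_graph (\<lambda>n. card (?R n)) c"
    unfolding gm_simple_def
  proof (intro allI impI)
    fix n :: nat
    have "walk_edges (map (cov_comp cover_graph n (Suc n)) (c (Suc n) i)) = cov_edges cover_graph n"
      if i: "i \<in> {1..card (?R (Suc n))}" for i
    proof -
      obtain x s where x: "c (Suc n) i = return_circuit (word x s)" "first_return shift (B (Suc n)) x s"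
        using c_word[OF i] by blast
      then have "word x s \<in> return_words (B (Suc n))" by (auto simp: return_words_def)
      then show ?thesis unfolding x(1) by (rule simple_cover_graph)
    qed
    then show "\<exists>m>n. \<forall>i\<in>{1..card (?R m)}. walk_edges (map (cov_comp cover_graph n m) (c m i)) = cov_edges cover_graph n"
      by blast
  qed
  moreover have "card (?R n) \<le> card (return_words (B n))" if "n > 0" for n
    by (rule card_image_le[OF finite_words[OF that]])
  ultimately show ?thesis by blast
qed

section \<open>The inverse limit of the covering\<close>

text \<open>
  Two points with the same vertices agree until they enter \<open>B n\<close>. If this time stays
  bounded, then both points reach \<open>p\<close> at one and the same time.
\<close>

lemma vert_separates:
  assumes x: "x \<in> X" and y: "y \<in> X" and eq: "\<And>n. vert n x = vert n y"
  shows "x = y"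
proof (rule ccontr)
  assume ne: "x \<noteq> y"
  then obtain j where j: "x j \<noteq> y j" by blast
  have e: "entrance_word (B n) x = entrance_word (B n) y" for n using eq by (simp add: vert_def)
  define l where "l n = length (entrance_word (B n) x)" for n
  have w: "word x (l n) = word y (l n)" for n
    using e[of n] unfolding l_def entrance_word_def by (metis length_word)
  have lj: "l n \<le> j" for n
    using w[of n] j by (metis not_le word_eq_iff of_nat_id)
  have "\<exists>i. \<forall>n. \<exists>m\<ge>n. l m = i" using bounded_value_recurs[of l j] lj by blast
  then obtain i where i: "\<And>n. \<exists>m\<ge>n. l m = i" by blast
  have at_p: "(shift ^^ i) z = p" if "z \<in> X" "\<And>n. length (entrance_word (B n) z) = l n" for z
  proof (rule B_facts(6))
    fix n
    obtain m where m: "m \<ge> n" "l m = i" using i by blast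
    then show "(shift ^^ i) z \<in> B n" using visit(1)[OF that(1), of m] that(2)[of m] B_facts(3)[OF m(1)] by auto
  qed
  have "(shift ^^ i) x = p" "(shift ^^ i) y = p" using at_p x y e by (auto simp: l_def)
  then have "x (k + i) = y (k + i)" for k by (metis funpow_shift of_nat_id)
  moreover have "x k = y k" if "k < i" for k
  proof -
    obtain n where "l n = i" using i by blast
    then show ?thesis using w[of n] that by (simp add: word_eq_iff)
  qed
  ultimately show False using j by (metis le_add_diff_inverse2 not_le)
qed

lemma conjugate_cover_graph:
  "topologically_conjugate (inverse_limit_topology cover_graph) (inverse_limit_map cover_graph)
     (subshift_topology A X) shift"
proof (rule topologically_conjugate_sym)
  let ?T = "subshift_topology A X" and ?I = "inverse_limit_topology cover_graph"
  show "shift ` topspace ?T \<subseteq> topspace ?T" using X_facts(2,5) by simp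
  have I: "inverse_limit cover_graph \<subseteq> Pi UNIV (cov_verts cover_graph)"
    unfolding inverse_limit_def by blast
  have tsI: "topspace ?I = inverse_limit cover_graph"
    unfolding inverse_limit_topology_def by (rule topspace_seq_topology[OF I])
  define h where "h x n = vert n x" for x n
  have open_h: "openin ?T {x \<in> X. vert n x = v}" for n v
  proof -
    have *: "openin ?T {x \<in> X. entrance_word (B n) x = w}" for w
      by (rule entrance_word_locally_constant[OF X B_facts(1,2) B_nonempty])
    have "{x \<in> X. vert n x = v} = (\<Union>w\<in>{w. to_nat w = v}. {x \<in> X. entrance_word (B n) x = w})"
      by (auto simp: vert_def)
    then show ?thesis using * by auto
  qed
  have h_in: "h x \<in> inverse_limit cover_graph" if "x \<in> X" for x
    using that by (auto simp: inverse_limit_def h_def vmap_vert)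
  have "continuous_map ?T ?I h"
    unfolding inverse_limit_topology_def continuous_map_seq_topology_iff[OF I] X_facts(2)
    using h_in open_h by (auto simp: h_def)
  moreover have "h ` X = inverse_limit cover_graph"
  proof (intro equalityI subsetI)
    fix v assume v: "v \<in> inverse_limit cover_graph"
    define F where "F n = {x \<in> X. vert n x = v n}" for n
    have v_vert: "v n \<in> vert n ` X" "v n = vmap (Suc n) (v (Suc n))" for n
      using v unfolding inverse_limit_def cover_graph_simps by blast+
    have "(\<Inter>n. F n) \<noteq> {}"
    proof (rule compact_space_imp_nest[OF X_facts(3)])
      fix n
      have "topspace ?T - F n = (\<Union>u\<in>- {v n}. {x \<in> X. vert n x = u})" by (auto simp: F_def X_facts(2))
      then have "openin ?T (topspace ?T - F n)" using open_h by auto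
      then show "closedin ?T (F n)" by (auto simp: closedin_def F_def X_facts(2))
      show "F n \<noteq> {}" using v_vert(1)[of n] by (auto simp: F_def)
      show "decseq F"
      proof (rule decseq_SucI, rule subsetI)
        fix n x assume "x \<in> F (Suc n)"
        then have "x \<in> X" "vert (Suc n) x = v (Suc n)" by (auto simp: F_def)
        then show "x \<in> F n" using vmap_vert[of x n] v_vert(2)[of n] by (simp add: F_def)
      qed
    qed
    then obtain x where x: "x \<in> (\<Inter>n. F n)" by blast
    then have "x \<in> X" "h x = v" by (auto simp: F_def h_def)
    then show "v \<in> h ` X" by blast
  qed (use h_in in auto)
  moreover have "inj_on h X"
    by (rule inj_onI) (metis h_def vert_separates)
  ultimately have "homeomorphic_map ?T ?I h"
    using X_facts(2,3) tsI Hausdorff_seq_topology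
    by (intro continuous_imp_homeomorphic_map) (auto simp: inverse_limit_topology_def)
  moreover have "h (shift x) = inverse_limit_map cover_graph (h x)" if "x \<in> X" for x
    by (rule inverse_limit_map_eqI[OF graph_covering_cover_graph h_in[OF shift_in_X[OF that]], symmetric])
      (use that in \<open>auto simp: h_def\<close>)
  ultimately show "topologically_conjugate ?T shift ?I (inverse_limit_map cover_graph)"
    unfolding topologically_conjugate_def X_facts(2) by blast
qed

end

text \<open>
  The three smallness conditions of the locale hold near \<open>p\<close>: the first one on a
  cylinder over a window of the given set, the second one because entrance words are locally
  constant, and the third one because every edge of the graph stands for an open set that is visited
  before the next return.
\<close>

lemma topological_rank_le:
  fixes X :: "(nat \<Rightarrow> 'a::countable) set"
  assumes X: "minimal_subshift A X" and few: "few_return_words (subshift_topology A X) K"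
  shows "topological_rank (subshift_topology A X) shift \<le> enat K"
proof -
  let ?T = "subshift_topology A X"
  note D = minimal_subshiftD[OF X]
  obtain C p where C: "shrinking_sets ?T C p"
    and inf: "\<exists>\<^sub>\<infinity>n. finite (return_words (C n)) \<and> card (return_words (C n)) \<le> K"
    using few by (auto simp: few_return_words_def)
  have pX: "p \<in> X" using shrinking_setsD(5)[OF C] D(2) by simp
  define R where "R E E' \<longleftrightarrow>
     (\<exists>L P. (\<forall>x\<in>X. \<forall>y\<in>X. word x L = word y L \<longrightarrow> (x \<in> E \<longleftrightarrow> y \<in> E)) \<and> (\<forall>x\<in>E'. word x L = P)) \<and>
     (\<forall>x\<in>E'. entrance_word E (shift x) = entrance_word E (shift p)) \<and>
     (\<forall>x\<in>X. \<forall>y\<in>E'. \<forall>t>0. (shift ^^ t) y \<in> E' \<longrightarrow>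
       (\<exists>i<t. entrance_word E ((shift ^^ i) y) = entrance_word E x \<and>
              entrance_word E ((shift ^^ Suc i) y) = entrance_word E (shift x)))" for E E'
  have ex_nbhd: "\<exists>U. openin ?T U \<and> p \<in> U \<and> (\<forall>E'\<subseteq>U. R E E')" if E: "openin ?T E" "closedin ?T E" "p \<in> E" for E
  proof -
    have ne: "E \<noteq> {}" using E(3) by blast
    obtain L where L: "\<And>x y. x \<in> X \<Longrightarrow> y \<in> X \<Longrightarrow> word x L = word y L \<Longrightarrow> x \<in> E \<longleftrightarrow> y \<in> E"
      using one_sided_window[OF X E(1,2)] by metis
    have ew: "openin ?T {x \<in> X. entrance_word E x = w}" for w
      by (rule entrance_word_locally_constant[OF X E(1,2) ne])
    have ew': "openin ?T {x \<in> X. entrance_word E (shift x) = w}" for w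
    proof -
      have "{x \<in> X. entrance_word E (shift x) = w} = {x \<in> topspace ?T. shift x \<in> {x \<in> X. entrance_word E x = w}}"
        using D(2,5) by auto
      then show ?thesis using openin_continuous_map_preimage[OF D(7) ew] by simp
    qed
    \<comment> \<open>the points that run through a given edge\<close>
    define W where "W q = {x \<in> X. entrance_word E x = fst q} \<inter> {x \<in> X. entrance_word E (shift x) = snd q}" for q
    let ?Q = "(\<lambda>x. (entrance_word E x, entrance_word E (shift x))) ` X"
    have "finite (entrance_word E ` X)"
      using finite_range_locally_constant[OF D(3)] ew D(2) by metis
    moreover have "?Q \<subseteq> entrance_word E ` X \<times> entrance_word E ` X" using D(5) by blast
    ultimately have "finite (W ` ?Q)" using finite_subset by blast
    moreover have "openin ?T V \<and> V \<noteq> {}" if V: "V \<in> W ` ?Q" for V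
    proof -
      obtain x where "x \<in> X" "V = W (entrance_word E x, entrance_word E (shift x))" using V by blast
      then have "x \<in> V" "openin ?T V" using ew ew' by (auto simp: W_def)
      then show ?thesis by blast
    qed
    moreover have "p \<in> topspace ?T" using pX D(2) by simp
    ultimately have "\<exists>V. openin ?T V \<and> p \<in> V \<and> (\<forall>y t q. y \<in> V \<longrightarrow> t > 0 \<longrightarrow>
        (shift ^^ t) y \<in> V \<longrightarrow> q \<in> W ` ?Q \<longrightarrow> (\<exists>i<t. (shift ^^ i) y \<in> q))"
      by (intro visit_all_before_return[OF D(6,7,4)])
    then obtain V where V: "openin ?T V" "p \<in> V" "\<forall>y t q. y \<in> V \<longrightarrow> t > 0 \<longrightarrow>
        (shift ^^ t) y \<in> V \<longrightarrow> q \<in> W ` ?Q \<longrightarrow> (\<exists>i<t. (shift ^^ i) y \<in> q)"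
      by (elim exE conjE)
    let ?U = "{x \<in> X. word x L = word p L} \<inter> {x \<in> X. entrance_word E (shift x) = entrance_word E (shift p)} \<inter> V"
    have "openin ?T ?U" by (intro openin_Int openin_word[OF X] ew' V(1))
    moreover have "p \<in> ?U" using pX V(2) by simp
    moreover have "R E E'" if E': "E' \<subseteq> ?U" for E'
      unfolding R_def
    proof (intro conjI)
      have "\<forall>x\<in>E'. word x L = word p L" using E' by blast
      then show "\<exists>L P. (\<forall>x\<in>X. \<forall>y\<in>X. word x L = word y L \<longrightarrow> (x \<in> E \<longleftrightarrow> y \<in> E)) \<and> (\<forall>x\<in>E'. word x L = P)"
        using L by meson
      show "\<forall>x\<in>E'. entrance_word E (shift x) = entrance_word E (shift p)" using E' by blast
      show "\<forall>x\<in>X. \<forall>y\<in>E'. \<forall>t>0. (shift ^^ t) y \<in> E' \<longrightarrow>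
       (\<exists>i<t. entrance_word E ((shift ^^ i) y) = entrance_word E x \<and>
              entrance_word E ((shift ^^ Suc i) y) = entrance_word E (shift x))"
      proof (intro ballI allI impI)
        fix x y t assume *: "x \<in> X" "y \<in> E'" "0 < t" "(shift ^^ t) y \<in> E'"
        then have "y \<in> V" "(shift ^^ t) y \<in> V" using E' by blast+
        then obtain i where "i < t" "(shift ^^ i) y \<in> W (entrance_word E x, entrance_word E (shift x))"
          using V(3)[rule_format, of y t "W (entrance_word E x, entrance_word E (shift x))"] *(1,3) by blast
        then show "\<exists>i<t. entrance_word E ((shift ^^ i) y) = entrance_word E x \<and>
            entrance_word E ((shift ^^ Suc i) y) = entrance_word E (shift x)"
          by (auto simp: W_def)
      qed
    qed
    ultimately show ?thesis by blast
  qed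
  obtain B where Bs: "shrinking_sets ?T B p" "B 0 = topspace ?T" "\<forall>n. R (B n) (B (Suc n))"
    "\<forall>n>0. finite (return_words (B n)) \<and> card (return_words (B n)) \<le> K"
  proof -
    have "\<exists>B. shrinking_sets ?T B p \<and> B 0 = topspace ?T \<and> (\<forall>n. R (B n) (B (Suc n))) \<and>
      (\<forall>n>0. finite (return_words (B n)) \<and> card (return_words (B n)) \<le> K)"
      by (rule rapidly_shrinking[OF D(3) C inf]) (rule ex_nbhd)
    then show thesis using that by (elim exE conjE)
  qed
  note RB = Bs(3)[rule_format, unfolded R_def]
  interpret one_sided_cuts A X B p
  proof
    show "minimal_subshift A X" "shrinking_sets ?T B p" by (rule X, rule Bs(1))
    show "B 0 = X" using Bs(2) D(2) by simp
    show "finite (return_words (B n))" if "n > 0" for n using Bs(4) that by blast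
    show "\<exists>L P. (\<forall>x\<in>X. \<forall>y\<in>X. word x L = word y L \<longrightarrow> (x \<in> B n \<longleftrightarrow> y \<in> B n)) \<and>
        (\<forall>x\<in>B (Suc n). word x L = P)" for n
      by (rule RB[THEN conjunct1])
    show "entrance_word (B n) (shift x) = entrance_word (B n) (shift p)" if "x \<in> B (Suc n)" for n x
      by (rule RB[THEN conjunct2, THEN conjunct1, rule_format, OF that])
    show "\<exists>i<t. entrance_word (B n) ((shift ^^ i) y) = entrance_word (B n) x \<and>
             entrance_word (B n) ((shift ^^ Suc i) y) = entrance_word (B n) (shift x)"
      if "x \<in> X" "y \<in> B (Suc n)" "t > 0" "(shift ^^ t) y \<in> B (Suc n)" for n x y t
      by (rule RB[THEN conjunct2, THEN conjunct2, rule_format, OF that])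
  qed
  obtain b r c where gm: "gm_covering cover_graph b r c" "gm_simple cover_graph r c"
    "\<forall>n>0. r n \<le> card (return_words (B n))"
    using gm_covering_cover_graph by (elim exE conjE)
  have "r n \<le> K" if "n > 0" for n using gm(3)[rule_format, OF that] Bs(4)[rule_format, OF that] by linarith
  then have "\<exists>\<^sub>\<infinity>n. r n \<le> K" unfolding INFM_nat by (metis lessI zero_less_Suc)
  then have "gm_rank r \<le> enat K" unfolding gm_rank_def liminf_enat_le_iff_frequently .
  moreover have "topological_rank ?T shift \<le> gm_rank r"
    unfolding topological_rank_def
    by (rule Inf_lower) (use gm(1,2) conjugate_cover_graph in blast)
  ultimately show ?thesis by (rule order_trans[rotated])
qed


section \<open>The Vershik map\<close>

lemma finite_linear_order_least:
  assumes lin: "linear_order_on F R" and M: "finite M" "M \<noteq> {}" "M \<subseteq> F"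
  shows "\<exists>m\<in>M. \<forall>x\<in>M. (m, x) \<in> R"
  using M
proof (induction M rule: finite_ne_induct)
  case (singleton x)
  then show ?case using lin by (auto simp: order_on_defs refl_on_def)
next
  case (insert x M)
  then obtain m where m: "m \<in> M" "\<forall>y\<in>M. (m, y) \<in> R" by blast
  have tr: "trans R" and refl: "(x, x) \<in> R" and tot: "x = m \<or> (x, m) \<in> R \<or> (m, x) \<in> R"
    using lin insert.prems m(1) by (auto simp: order_on_defs refl_on_def total_on_def)
  show ?case
  proof (cases "(m, x) \<in> R")
    case True
    then show ?thesis using m by blast
  next
    case False
    then have "(x, m) \<in> R" using tot refl by blast
    then have "\<forall>y\<in>insert x M. (x, y) \<in> R" using m(2) refl transD[OF tr] by blast
    then show ?thesis by blast
  qed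
qed

lemma ordered_bratteliD:
  assumes "ordered_bratteli B"
  shows "finite (br_verts B n)" "finite (br_edges B n)" "e \<in> br_edges B n \<Longrightarrow> br_src B n e \<in> br_verts B n"
    "e \<in> br_edges B n \<Longrightarrow> br_rng B n e \<in> br_verts B (Suc n)"
    "v \<in> br_verts B (Suc n) \<Longrightarrow> \<exists>e\<in>br_edges B n. br_rng B n e = v"
    "v \<in> br_verts B (Suc n) \<Longrightarrow> linear_order_on (br_fiber B n v) (br_ord B n v)"
    "\<exists>v0. br_verts B 0 = {v0}"
  using assms unfolding ordered_bratteli_def bratteli_diagram_def by blast+

lemma linear_order_antisymD:
  "linear_order_on F R \<Longrightarrow> (a, b) \<in> R \<Longrightarrow> (b, a) \<in> R \<Longrightarrow> a = b"
  by (auto simp: order_on_defs antisym_def)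

lemma min_edge_unique:
  assumes B: "ordered_bratteli B" and e: "min_edge B n e" "min_edge B n e'" "br_rng B n e = br_rng B n e'"
  shows "e = e'"
proof -
  have "br_rng B n e \<in> br_verts B (Suc n)" using ordered_bratteliD(4)[OF B] e(1) by (auto simp: min_edge_def)
  from linear_order_antisymD[OF ordered_bratteliD(6)[OF B this]] show ?thesis
    using e by (auto simp: min_edge_def br_fiber_def)
qed

lemma min_edge_exists:
  assumes B: "ordered_bratteli B" and v: "v \<in> br_verts B (Suc n)"
  shows "\<exists>e. min_edge B n e \<and> br_rng B n e = v"
proof -
  have "\<exists>m\<in>br_fiber B n v. \<forall>x\<in>br_fiber B n v. (m, x) \<in> br_ord B n v"
  proof (rule finite_linear_order_least[OF ordered_bratteliD(6)[OF B v]])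
    show "br_fiber B n v \<noteq> {}" using ordered_bratteliD(5)[OF B v] unfolding br_fiber_def by blast
  qed (use ordered_bratteliD(2)[OF B] in \<open>auto simp: br_fiber_def\<close>)
  then show ?thesis by (auto simp: min_edge_def br_fiber_def)
qed

lemma succ_edge_unique:
  assumes B: "ordered_bratteli B" and e: "e \<in> br_edges B n"
    and f: "succ_edge B n e f" "succ_edge B n e f'"
  shows "f = f'"
  using linear_order_antisymD[OF ordered_bratteliD(6)[OF B ordered_bratteliD(4)[OF B e]], of f f'] f
  by (auto simp: succ_edge_def Let_def)

lemma succ_edge_exists:
  assumes B: "ordered_bratteli B" and e: "e \<in> br_edges B n" "\<not> max_edge B n e"
  shows "\<exists>f. succ_edge B n e f"
proof -
  let ?v = "br_rng B n e" and ?F = "br_fiber B n (br_rng B n e)" and ?R = "br_ord B n (br_rng B n e)"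
  have lin: "linear_order_on ?F ?R" by (rule ordered_bratteliD(6)[OF B ordered_bratteliD(4)[OF B e(1)]])
  have eF: "e \<in> ?F" using e by (simp add: br_fiber_def)
  obtain e' where e': "e' \<in> ?F" "(e', e) \<notin> ?R" using e by (auto simp: max_edge_def)
  have "e' \<noteq> e" using lin e' by (auto simp: order_on_defs refl_on_def)
  moreover from this have "(e, e') \<in> ?R"
    using lin e' eF unfolding order_on_defs total_on_def by blast
  ultimately have "\<exists>m\<in>{f \<in> ?F. f \<noteq> e \<and> (e, f) \<in> ?R}. \<forall>x\<in>{f \<in> ?F. f \<noteq> e \<and> (e, f) \<in> ?R}. (m, x) \<in> ?R"
    using e' ordered_bratteliD(2)[OF B]
    by (intro finite_linear_order_least[OF lin]) (auto simp: br_fiber_def)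
  then show ?thesis by (auto simp: succ_edge_def Let_def)
qed

lemma path_spaceD:
  "x \<in> path_space B \<Longrightarrow> x n \<in> br_edges B n" "x \<in> path_space B \<Longrightarrow> br_rng B n (x n) = br_src B (Suc n) (x (Suc n))"
  by (auto simp: path_space_def)

lemma min_prefix_unique:
  assumes B: "ordered_bratteli B" and x: "x \<in> path_space B" and y: "y \<in> path_space B"
    and min: "\<And>i. i < n \<Longrightarrow> min_edge B i (x i)" "\<And>i. i < n \<Longrightarrow> min_edge B i (y i)"
    and src: "n > 0 \<Longrightarrow> br_src B n (x n) = br_src B n (y n)"
    and i: "i < n"
  shows "x i = y i"
proof -
  have "i < n \<longrightarrow> x i = y i" if "i \<le> n" for i
    using that
  proof (induction i rule: inc_induct)
    case (step i)
    have "br_src B (Suc i) (x (Suc i)) = br_src B (Suc i) (y (Suc i))"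
    proof (cases "Suc i = n")
      case True
      then show ?thesis using src by auto
    next
      case False
      then show ?thesis using step by simp
    qed
    then have "br_rng B i (x i) = br_rng B i (y i)" using path_spaceD(2) x y by metis
    then show ?case using min_edge_unique[OF B] min step by blast
  qed simp
  then show ?thesis using i by simp
qed

lemma min_prefix_exists:
  assumes B: "ordered_bratteli B" and v: "v \<in> br_verts B n"
  shows "\<exists>q. (\<forall>i<n. min_edge B i (q i)) \<and> (\<forall>i. Suc i < n \<longrightarrow> br_rng B i (q i) = br_src B (Suc i) (q (Suc i))) \<and>
    (n > 0 \<longrightarrow> br_rng B (n - 1) (q (n - 1)) = v)"
  using v
proof (induction n arbitrary: v)
  case (Suc n)
  obtain e where e: "min_edge B n e" "br_rng B n e = v" using min_edge_exists[OF B Suc.prems] by blast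
  then have "br_src B n e \<in> br_verts B n" using ordered_bratteliD(3)[OF B] by (auto simp: min_edge_def)
  then obtain q where q: "\<forall>i<n. min_edge B i (q i)"
    "\<forall>i. Suc i < n \<longrightarrow> br_rng B i (q i) = br_src B (Suc i) (q (Suc i))"
    "n > 0 \<longrightarrow> br_rng B (n - 1) (q (n - 1)) = br_src B n e" using Suc.IH by blast
  have "br_rng B i ((q(n := e)) i) = br_src B (Suc i) ((q(n := e)) (Suc i))" if "Suc i < Suc n" for i
  proof (cases "Suc i = n")
    case True
    then show ?thesis using q(3) by auto
  next
    case False
    then show ?thesis using q(2) that by simp
  qed
  then show ?case using e q(1) by (intro exI[of _ "q(n := e)"]) (auto simp: less_Suc_eq)
qed simp

text \<open>
  The condition that describes the value of the Vershik map if \<open>n\<close> is the first level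
  at which the edge of \<open>x\<close> is not maximal.
\<close>

definition vershik_step :: "('v, 'e) bratteli \<Rightarrow> nat \<Rightarrow> (nat \<Rightarrow> 'e) \<Rightarrow> (nat \<Rightarrow> 'e) \<Rightarrow> bool" where
  "vershik_step B n x y \<longleftrightarrow> y \<in> path_space B \<and> (\<forall>i<n. min_edge B i (y i)) \<and>
     succ_edge B n (x n) (y n) \<and> (\<forall>i>n. y i = x i)"

lemma vershik_step_unique:
  assumes B: "ordered_bratteli B" and x: "x \<in> path_space B"
    and y: "vershik_step B n x y" and z: "vershik_step B n x z"
  shows "y = z"
proof
  fix i
  have yn: "y n = z n" using succ_edge_unique[OF B path_spaceD(1)[OF x]] y z by (auto simp: vershik_step_def)
  consider "i < n" | "i = n" | "i > n" by linarith
  then show "y i = z i"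
  proof cases
    case 1
    then show ?thesis
      using min_prefix_unique[OF B, of y z n i] y z yn by (auto simp: vershik_step_def)
  qed (use yn y z in \<open>auto simp: vershik_step_def\<close>)
qed

lemma vershik_map_eqI:
  assumes B: "ordered_bratteli B" and x: "x \<in> path_space B"
    and n: "\<not> max_edge B n (x n)" "\<And>i. i < n \<Longrightarrow> max_edge B i (x i)"
    and y: "vershik_step B n x y"
  shows "vershik_map B x = y"
proof -
  have "(LEAST n. \<not> max_edge B n (x n)) = n"
    by (rule Least_equality) (use n in \<open>auto simp: not_less[symmetric]\<close>)
  moreover have "\<not> max_path B x" using n(1) by (auto simp: max_path_def)
  moreover have "(THE y. vershik_step B n x y) = y"
    using y vershik_step_unique[OF B x _ y] by (rule the_equality)
  ultimately show ?thesis unfolding vershik_map_def by (simp add: vershik_step_def)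
qed

lemma vershik_step_exists:
  assumes B: "ordered_bratteli B" and x: "x \<in> path_space B" and n: "\<not> max_edge B n (x n)"
  shows "\<exists>y. vershik_step B n x y"
proof -
  obtain f where f: "succ_edge B n (x n) f" using succ_edge_exists[OF B path_spaceD(1)[OF x] n] by blast
  then have fE: "f \<in> br_edges B n" "br_rng B n f = br_rng B n (x n)"
    by (auto simp: succ_edge_def Let_def br_fiber_def)
  obtain q where q: "\<forall>i<n. min_edge B i (q i)"
    "\<forall>i. Suc i < n \<longrightarrow> br_rng B i (q i) = br_src B (Suc i) (q (Suc i))"
    "n > 0 \<longrightarrow> br_rng B (n - 1) (q (n - 1)) = br_src B n f"
    using min_prefix_exists[OF B ordered_bratteliD(3)[OF B fE(1)]] by blast
  define y where "y i = (if i < n then q i else if i = n then f else x i)" for i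
  have "y i \<in> br_edges B i" for i
    using q(1) fE(1) path_spaceD(1)[OF x] by (auto simp: y_def min_edge_def)
  moreover have "br_rng B i (y i) = br_src B (Suc i) (y (Suc i))" for i
  proof -
    consider "Suc i < n" | "Suc i = n" | "i = n" | "i > n" by linarith
    then show ?thesis
      by cases (use q fE path_spaceD(2)[OF x] in \<open>auto simp: y_def\<close>)
  qed
  ultimately have "y \<in> path_space B" by (simp add: path_space_def)
  then have "vershik_step B n x y" using q(1) f by (simp add: vershik_step_def y_def)
  then show ?thesis by blast
qed

lemma vershik_map_cases:
  assumes B: "properly_ordered B" and x: "x \<in> path_space B"
  shows "(\<forall>n. max_edge B n (x n)) \<and> min_path B (vershik_map B x) \<or>
    (\<exists>n. (\<forall>i<n. max_edge B i (x i)) \<and> \<not> max_edge B n (x n) \<and> vershik_step B n x (vershik_map B x))"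
proof (cases "\<forall>n. max_edge B n (x n)")
  case True
  then have "max_path B x" using x by (simp add: max_path_def)
  moreover have "min_path B (THE y. min_path B y)"
    using B theI'[of "min_path B"] by (simp add: properly_ordered_def)
  ultimately show ?thesis using True by (simp add: vershik_map_def)
next
  case False
  define n where "n = (LEAST n. \<not> max_edge B n (x n))"
  have n: "\<not> max_edge B n (x n)" unfolding n_def by (rule LeastI_ex) (use False in blast)
  have less: "max_edge B i (x i)" if "i < n" for i using not_less_Least that unfolding n_def by blast
  have B': "ordered_bratteli B" using B by (simp add: properly_ordered_def)
  obtain y where y: "vershik_step B n x y" using vershik_step_exists[OF B' x n] by blast
  then have "vershik_map B x = y" using vershik_map_eqI[OF B' x n less] by blast
  then show ?thesis using n less y by blast
qed

lemma vershik_map_in_path_space: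
  "properly_ordered B \<Longrightarrow> x \<in> path_space B \<Longrightarrow> vershik_map B x \<in> path_space B"
  using vershik_map_cases[of B x] by (auto simp: min_path_def vershik_step_def)

text \<open>
  The first \<open>n\<close> edges of a path evolve on their own until all of them are maximal;
  after that all of them are minimal.
\<close>

lemma vershik_map_prefix:
  assumes B: "properly_ordered B" and x: "x \<in> path_space B" and y: "y \<in> path_space B"
    and eq: "\<And>i. i < n \<Longrightarrow> x i = y i"
  shows "(\<forall>i<n. vershik_map B x i = vershik_map B y i) \<or>
    (\<forall>i<n. min_edge B i (vershik_map B x i)) \<and> (\<forall>i<n. min_edge B i (vershik_map B y i))"
proof (cases "\<forall>i<n. max_edge B i (x i)")
  case True
  have "\<forall>i<n. min_edge B i (vershik_map B z i)"
    if z: "z \<in> path_space B" "\<And>i. i < n \<Longrightarrow> max_edge B i (z i)" for z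
    using vershik_map_cases[OF B z(1)]
  proof
    assume "(\<forall>n. max_edge B n (z n)) \<and> min_path B (vershik_map B z)"
    then show ?thesis by (simp add: min_path_def)
  next
    assume "\<exists>n. (\<forall>i<n. max_edge B i (z i)) \<and> \<not> max_edge B n (z n) \<and> vershik_step B n z (vershik_map B z)"
    then obtain m where m: "\<not> max_edge B m (z m)" "vershik_step B m z (vershik_map B z)" by blast
    then have "n \<le> m" using z(2)[of m] by (meson not_less)
    then show ?thesis using m(2) by (auto simp: vershik_step_def)
  qed
  moreover have "max_edge B i (y i)" if "i < n" for i using True eq that by metis
  ultimately show ?thesis using True x y by blast
next
  case False
  have B': "ordered_bratteli B" using B by (simp add: properly_ordered_def)
  obtain k where k: "k < n" "\<not> max_edge B k (x k)" using False by blast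
  obtain m where m: "\<forall>i<m. max_edge B i (x i)" "\<not> max_edge B m (x m)" "vershik_step B m x (vershik_map B x)"
    using vershik_map_cases[OF B x] k by blast
  have mn: "m < n" using m(1) k by (meson le_less_trans not_le)
  have "\<not> max_edge B m (y m)" "\<And>i. i < m \<Longrightarrow> max_edge B i (y i)"
    using m(1,2) eq mn by (metis, metis less_trans)
  moreover obtain z where z: "vershik_step B m y z" using vershik_step_exists[OF B' y] calculation(1) by blast
  ultimately have vy: "vershik_step B m y (vershik_map B y)" using vershik_map_eqI[OF B' y] by metis
  have eq_m: "vershik_map B x m = vershik_map B y m"
  proof (rule succ_edge_unique[OF B' path_spaceD(1)[OF x]])
    show "succ_edge B m (x m) (vershik_map B x m)" using m(3) unfolding vershik_step_def by blast
    show "succ_edge B m (x m) (vershik_map B y m)"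
      using vy unfolding vershik_step_def eq[OF mn] by blast
  qed
  have "vershik_map B x i = vershik_map B y i" if "i < n" for i
  proof -
    consider "i < m" | "i = m" | "i > m" by linarith
    then show ?thesis
    proof cases
      case 1
      then show ?thesis
        using min_prefix_unique[OF B', of "vershik_map B x" "vershik_map B y" m i] m(3) vy eq_m
        by (auto simp: vershik_step_def)
    qed (use eq_m m(3) vy eq that in \<open>auto simp: vershik_step_def\<close>)
  qed
  then show ?thesis by blast
qed


section \<open>Return words from a Bratteli diagram\<close>

text \<open>
  The sets consist of the paths with \<open>n\<close> minimal edges at the beginning. These edges
  are determined by the vertex at which they end, and they determine the first \<open>n\<close>
  edges until the return. So for large \<open>n\<close> there are at most as many return words as
  vertices at level \<open>n\<close>.
\<close>

lemma few_return_words_of_bratteli: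
  fixes S :: "(int \<Rightarrow> 'a) set" and B :: "('v, 'e) bratteli"
  assumes S: "minimal_subshift A S" and B: "properly_ordered B" and rank: "br_rank B \<le> enat K"
    and conj: "topologically_conjugate (path_space_topology B) (vershik_map B)
       (subshift_topology A S) shift"
  shows "few_return_words (subshift_topology A S) K"
proof -
  let ?T = "subshift_topology A S" and ?I = "path_space_topology B"
  note D = minimal_subshiftD[OF S]
  have B': "ordered_bratteli B" using B by (simp add: properly_ordered_def)
  have I: "path_space B \<subseteq> Pi UNIV (br_edges B)" by (auto simp: path_space_def)
  have tsI: "topspace ?I = path_space B"
    unfolding path_space_topology_def by (rule topspace_seq_topology[OF I])
  obtain h where h: "homeomorphic_map ?I ?T h"
    "\<And>x. x \<in> path_space B \<Longrightarrow> h (vershik_map B x) = shift (h x)"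
    using conj unfolding topologically_conjugate_def tsI by blast
  obtain k where k: "homeomorphic_maps ?I ?T h k" using h(1) homeomorphic_map_maps by blast
  have hk: "continuous_map ?I ?T h" "continuous_map ?T ?I k"
    "\<And>x. x \<in> path_space B \<Longrightarrow> k (h x) = x" "\<And>z. z \<in> S \<Longrightarrow> h (k z) = z"
    "\<And>x. x \<in> path_space B \<Longrightarrow> h x \<in> S" "\<And>z. z \<in> S \<Longrightarrow> k z \<in> path_space B"
    using k unfolding homeomorphic_maps_def continuous_map_def tsI D(2) by auto
  have k_shift: "k (shift z) = vershik_map B (k z)" if "z \<in> S" for z
    using h(2)[OF hk(6)[OF that]] hk(3)[OF vershik_map_in_path_space[OF B hk(6)[OF that]]] hk(4)[OF that]
    by simp
  have open_k: "openin ?T {z \<in> S. k z n = v}" for n v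
    using hk(2) unfolding path_space_topology_def continuous_map_seq_topology_iff[OF I] D(2) by blast
  define C where "C n = {z \<in> S. \<forall>i<n. min_edge B i (k z i)}" for n
  obtain q where q: "min_path B q" "\<And>x. min_path B x \<Longrightarrow> x = q" 
  proof -
    have "\<exists>!x. min_path B x" using B by (simp add: properly_ordered_def)
    then show thesis using that by (elim ex1E) blast
  qed
  have "shrinking_sets ?T C (h q)"
    unfolding shrinking_sets_def
  proof (intro conjI allI)
    fix n
    have one: "openin ?T {z \<in> S. min_edge B i (k z i) = b}" for i b
    proof -
      have "{z \<in> S. min_edge B i (k z i) = b} = (\<Union>e\<in>{e. min_edge B i e = b}. {z \<in> S. k z i = e})" by auto
      then show ?thesis using open_k by auto
    qed
    have "openin ?T (C n) \<and> closedin ?T (C n)"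
    proof (induction n)
      case 0
      then show ?case using D(2) openin_topspace[of ?T] closedin_topspace[of ?T] by (simp add: C_def)
    next
      case (Suc n)
      have eq: "C (Suc n) = C n \<inter> {z \<in> S. min_edge B n (k z n) = True}" by (auto simp: C_def less_Suc_eq)
      have "closedin ?T {z \<in> S. min_edge B n (k z n) = True}"
      proof -
        have "topspace ?T - {z \<in> S. min_edge B n (k z n) = True} = {z \<in> S. min_edge B n (k z n) = False}"
          using D(2) by auto
        then show ?thesis using one[of n False] D(2) by (auto simp: closedin_def)
      qed
      then show ?case unfolding eq using Suc.IH one[of n True] by (intro conjI openin_Int closedin_Int) auto
    qed
    then show "openin ?T (C n)" "closedin ?T (C n)" by auto
    show "C (Suc n) \<subseteq> C n" by (auto simp: C_def)
  next
    show "(\<Inter>n. C n) = {h q}"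
    proof (intro equalityI subsetI)
      fix z assume z: "z \<in> (\<Inter>n. C n)"
      then have zS: "z \<in> S" by (auto simp: C_def)
      have "min_edge B i (k z i)" for i using z by (auto simp: C_def)
      then have "k z = q" using q(2) hk(6)[OF zS] by (simp add: min_path_def)
      then show "z \<in> {h q}" using hk(4)[OF zS] by simp
    next
      fix z assume "z \<in> {h q}"
      then show "z \<in> (\<Inter>n. C n)" using q(1) hk(3,5) by (auto simp: C_def min_path_def)
    qed
  qed
  moreover have "\<exists>\<^sub>\<infinity>n. finite (return_words (C n)) \<and> card (return_words (C n)) \<le> K"
  proof -
    have "compact_space ?I"
      using D(3) homeomorphic_compact_space homeomorphic_map_imp_homeomorphic_space[OF h(1)] by blast
    moreover have "openin ?I {x \<in> path_space B. h x 0 = v}" for v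
      using hk(1) unfolding subshift_topology_eq continuous_map_seq_topology_iff[OF D(1)] tsI by blast
    ultimately obtain F where F: "finite F"
      "\<And>x y. x \<in> path_space B \<Longrightarrow> y \<in> path_space B \<Longrightarrow> agree_on F x y \<Longrightarrow> h x 0 = h y 0"
      using uniform_window[OF I, of "\<lambda>x. h x 0"] unfolding path_space_topology_def by blast
    obtain N where N: "F \<subseteq> {..<N}" using F(1) finite_nat_iff_bounded by blast
    have few: "finite (return_words (C n)) \<and> card (return_words (C n)) \<le> card (br_verts B n)"
      if n: "n \<ge> N" "n > 0" for n
    proof -
      define top_vert where "top_vert z = br_src B n (k z n)" for z
      have same: "t = t' \<and> word z t = word z' t'"
        if z: "first_return shift (C n) z t" and z': "first_return shift (C n) z' t'"
          and v: "top_vert z = top_vert z'" for z z' t t'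
      proof -
        have zS: "z \<in> S" "z' \<in> S" using z z' by (auto simp: first_return_def C_def)
        note zj = D(8)[OF zS(1)] and zj' = D(8)[OF zS(2)]
        have next_k: "k ((shift ^^ Suc j) u) = vershik_map B (k ((shift ^^ j) u))" if "u \<in> S" for u j
          using k_shift[OF D(8)[OF that]] by simp
        have init: "k z i = k z' i" if "i < n" for i
          using min_prefix_unique[OF B' hk(6)[OF zS(1)] hk(6)[OF zS(2)] _ _ _ that] z z' v
          by (auto simp: first_return_def C_def top_vert_def)
        have step: "(\<forall>i<n. k ((shift ^^ Suc j) z) i = k ((shift ^^ Suc j) z') i) \<or>
            (shift ^^ Suc j) z \<in> C n \<and> (shift ^^ Suc j) z' \<in> C n"
          if "\<And>i. i < n \<Longrightarrow> k ((shift ^^ j) z) i = k ((shift ^^ j) z') i" for j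
          using vershik_map_prefix[OF B hk(6)[OF zj] hk(6)[OF zj'] that] zj[of "Suc j"] zj'[of "Suc j"]
          unfolding next_k[OF zS(1)] next_k[OF zS(2)] C_def by (simp add: next_k zS del: funpow.simps)
        have agree: "(\<forall>i<n. k ((shift ^^ j) z) i = k ((shift ^^ j) z') i) \<and> (j > 0 \<longrightarrow> (shift ^^ j) z' \<notin> C n)"
          if "j < t" for j
          using that
        proof (induction j)
          case 0
          then show ?case using init by simp
        next
          case (Suc j)
          then have "(shift ^^ Suc j) z \<notin> C n" using z unfolding first_return_def by blast
          moreover from this have "\<forall>i<n. k ((shift ^^ Suc j) z) i = k ((shift ^^ Suc j) z') i"
            using step[of j] Suc by (auto simp del: funpow.simps)
          ultimately show ?case using zj[of "Suc j"] by (auto simp: C_def simp del: funpow.simps)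
        qed
        obtain s where s: "t = Suc s" using z by (metis first_return_def gr0_implies_Suc)
        have "(shift ^^ t) z \<in> C n" using z by (simp add: first_return_def)
        then have "(shift ^^ t) z' \<in> C n"
          using step[of s] agree[of s] zj'[of t] unfolding s by (auto simp: C_def simp del: funpow.simps)
        then have "first_return shift (C n) z' t"
          using z z' agree unfolding first_return_def by blast
        then have t: "t = t'" by (rule first_return_unique[OF _ z'])
        have "z (int j) = z' (int j)" if "j < t" for j
        proof -
          have "agree_on F (k ((shift ^^ j) z)) (k ((shift ^^ j) z'))"
            using agree[OF that] N n(1) by (auto simp: agree_on_def)
          then have "h (k ((shift ^^ j) z)) 0 = h (k ((shift ^^ j) z')) 0"
            using F(2) hk(6) zj zj' by blast
          then show ?thesis using hk(4)[OF zj] hk(4)[OF zj'] by (simp add: funpow_shift)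
        qed
        then show ?thesis using t by (simp add: word_eq_iff)
      qed
      define g where "g v = (SOME w. \<exists>z t. first_return shift (C n) z t \<and> top_vert z = v \<and> w = word z t)" for v
      have "return_words (C n) \<subseteq> g ` br_verts B n"
      proof
        fix w assume "w \<in> return_words (C n)"
        then obtain z t where w: "w = word z t" "first_return shift (C n) z t" by (auto simp: return_words_def)
        have ex: "\<exists>w z' t. first_return shift (C n) z' t \<and> top_vert z' = top_vert z \<and> w = word z' t"
          using w(2) by blast
        obtain z' t' where "first_return shift (C n) z' t'" "top_vert z' = top_vert z" "g (top_vert z) = word z' t'"
          using someI_ex[OF ex] unfolding g_def by blast
        then have "g (top_vert z) = w" using same[OF w(2)] w(1) by metis
        moreover have "z \<in> S" using w(2) by (simp add: first_return_def C_def)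
        then have "top_vert z \<in> br_verts B n"
          unfolding top_vert_def by (intro ordered_bratteliD(3)[OF B'] path_spaceD(1) hk(6))
        ultimately show "w \<in> g ` br_verts B n" by blast
      qed
      then show ?thesis
        using surj_card_le[OF ordered_bratteliD(1)[OF B']] finite_surj[OF ordered_bratteliD(1)[OF B']] by blast
    qed
    have "\<exists>\<^sub>\<infinity>n. card (br_verts B n) \<le> K" using rank unfolding br_rank_def liminf_enat_le_iff_frequently .
    moreover have "\<forall>\<^sub>\<infinity>n. n > N" by (simp add: MOST_nat) blast
    ultimately have "\<exists>\<^sub>\<infinity>n. card (br_verts B n) \<le> K \<and> n > N" by (rule frequently_eventually_frequently)
    then show ?thesis
    proof (rule INFM_mono)
      fix n assume "card (br_verts B n) \<le> K \<and> n > N"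
      then show "finite (return_words (C n)) \<and> card (return_words (C n)) \<le> K" using few[of n] by simp
    qed
  qed
  ultimately show ?thesis unfolding few_return_words_def by blast
qed


section \<open>A Bratteli diagram from return words\<close>

definition return_time :: "('i::semiring_1 \<Rightarrow> 'a) set \<Rightarrow> ('i \<Rightarrow> 'a) \<Rightarrow> nat" where
  "return_time D x = (LEAST t. t > 0 \<and> (shift ^^ t) x \<in> D)"

definition return_word :: "('i::semiring_1 \<Rightarrow> 'a) set \<Rightarrow> ('i \<Rightarrow> 'a) \<Rightarrow> 'a list" where
  "return_word D x = word x (return_time D x)"

lemma return_time_eq: "first_return shift D x t \<Longrightarrow> return_time D x = t"
  unfolding return_time_def first_return_def by (rule Least_equality) (auto simp: not_less[symmetric])

lemma openin_first_return:
  assumes X: "minimal_subshift A X"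
    and D: "openin (subshift_topology A X) D" "closedin (subshift_topology A X) D"
  shows "openin (subshift_topology A X) {z \<in> X. first_return shift D z t \<and> word z t = w}"
proof (cases "t > 0")
  case True
  let ?T = "subshift_topology A X"
  note DX = minimal_subshiftD[OF X]
  let ?in = "\<lambda>i. {y \<in> topspace ?T. (shift ^^ i) y \<in> D}"
  let ?out = "\<lambda>i. {y \<in> topspace ?T. (shift ^^ i) y \<in> topspace ?T - D}"
  have out: "openin ?T (topspace ?T - D)" using D(2) by (simp add: closedin_def)
  have outs: "openin ?T (topspace ?T \<inter> \<Inter>(?out ` {1..<t}))"
    by (rule openin_Int_Inter) (use openin_funpow_preimage[OF DX(7) out] in auto)
  have "{z \<in> X. first_return shift D z t \<and> word z t = w} =
      (?in 0 \<inter> ?in t) \<inter> (topspace ?T \<inter> \<Inter>(?out ` {1..<t})) \<inter> {y \<in> X. word y t = w}"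
    using True DX(2,8) by (auto simp: first_return_def)
  also have "openin ?T \<dots>"
    by (intro openin_Int[OF openin_Int[OF openin_Int outs]] openin_funpow_preimage[OF DX(7) D(1)] openin_word[OF X])
  finally show ?thesis .
next
  case False
  then have e: "{z \<in> X. first_return shift D z t \<and> word z t = w} = {}" by (auto simp: first_return_def)
  show ?thesis unfolding e by simp
qed

lemma continuous_translate:
  assumes S: "S \<subseteq> Pi UNIV (\<lambda>_. A)" "shift ` S = S"
  shows "continuous_map (subshift_topology A S) (subshift_topology A S) (translate k)"
proof -
  have "openin (seq_topology (\<lambda>_. A) S) {x \<in> S. translate k x i = v}" for i v
    using openin_coordinate[OF S(1), of "i + k" v] by (simp add: translate_def)
  then show ?thesis
    unfolding subshift_topology_eq continuous_map_seq_topology_iff[OF S(1)] topspace_seq_topology[OF S(1)]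
    using translate_in_subshift[OF S(2)] by auto
qed

text \<open>
  The assumptions \<open>refine\<close> and \<open>full\<close> say that every set of the sequence
  is small compared with its predecessor: a return word at one level determines its decomposition
  into return words of the level below, and every return word of the level below occurs in the
  decomposition.
\<close>

locale two_sided_cuts =
  fixes A :: "'a set" and S :: "(int \<Rightarrow> 'a) set" and B :: "nat \<Rightarrow> (int \<Rightarrow> 'a) set" and p
  assumes S: "minimal_subshift A S"
    and B: "shrinking_sets (subshift_topology A S) B p"
    and B_0: "B 0 = S"
    and refine: "\<And>n y z t i. first_return shift (B (Suc n)) y t \<Longrightarrow> first_return shift (B (Suc n)) z t \<Longrightarrow>
       word y t = word z t \<Longrightarrow> i \<le> t \<Longrightarrow> (shift ^^ i) y \<in> B n \<longleftrightarrow> (shift ^^ i) z \<in> B n"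
    and full: "\<And>n x y t. x \<in> B n \<Longrightarrow> y \<in> B (Suc n) \<Longrightarrow> t > 0 \<Longrightarrow> (shift ^^ t) y \<in> B (Suc n) \<Longrightarrow>
       \<exists>i<t. (shift ^^ i) y \<in> B n \<and> return_word (B n) ((shift ^^ i) y) = return_word (B n) x"
    and finite_words: "\<And>n. n > 0 \<Longrightarrow> finite (return_words (B n))"
begin

lemmas S_facts = minimal_subshiftD[OF S]
lemmas B_facts = shrinking_setsD[OF B]

lemma B_nonempty: "B n \<noteq> {}"
  using B_facts(4) by blast

lemma B_subset: "B n \<subseteq> S"
  using openin_subset[OF B_facts(1)] S_facts(2) by simp

lemma B_Suc: "x \<in> B (Suc n) \<Longrightarrow> x \<in> B n"
  using B_facts(3)[of n "Suc n"] by auto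

lemma p_in_S: "p \<in> S"
  using B_facts(5) S_facts(2) by simp

lemma shift_in_S: "x \<in> S \<Longrightarrow> shift x \<in> S"
  using S_facts(5) by blast

text \<open>
  The points between two visits to \<open>B n\<close> form towers over \<open>B n\<close>, one for
  each return word. The number \<open>depth n x\<close> counts the steps down from \<open>x\<close>
  to the base of its tower.
\<close>

definition depth :: "nat \<Rightarrow> (int \<Rightarrow> 'a) \<Rightarrow> nat" where
  "depth n x = (LEAST j. translate (- int j) x \<in> B n)"

definition tower_base :: "nat \<Rightarrow> (int \<Rightarrow> 'a) \<Rightarrow> (int \<Rightarrow> 'a)" where
  "tower_base n x = translate (- int (depth n x)) x"

definition height :: "nat \<Rightarrow> (int \<Rightarrow> 'a) \<Rightarrow> nat" where
  "height n x = return_time (B n) (tower_base n x)"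

text \<open>
  At level \<open>0\<close> there is only one tower although \<open>B 0\<close> has a return word
  for every letter, because a Bratteli diagram has a single top vertex.
\<close>

definition tower :: "nat \<Rightarrow> (int \<Rightarrow> 'a) \<Rightarrow> nat" where
  "tower n x = (if n = 0 then 0 else to_nat_on (return_words (B n)) (return_word (B n) (tower_base n x)))"

definition offset :: "nat \<Rightarrow> (int \<Rightarrow> 'a) \<Rightarrow> nat" where
  "offset n x = depth (Suc n) x - depth n x"

text \<open>
  An edge says where a tower of level \<open>n\<close> sits in a tower of the next level.
\<close>

definition edge :: "nat \<Rightarrow> (int \<Rightarrow> 'a) \<Rightarrow> nat" where
  "edge n x = to_nat (tower (Suc n) x, offset n x)"

lemma tower_position:
  assumes y: "first_return shift (B n) y t" and j: "j < t"
  shows "depth n ((shift ^^ j) y) = j" "tower_base n ((shift ^^ j) y) = y" "height n ((shift ^^ j) y) = t"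
proof -
  have tr: "translate (- int i) ((shift ^^ j) y) = (shift ^^ (j - i)) y" if "i \<le> j" for i
    using that by (simp add: funpow_shift_translate translate_translate of_nat_diff)
  show b: "depth n ((shift ^^ j) y) = j"
    unfolding depth_def
  proof (rule Least_equality)
    show "translate (- int j) ((shift ^^ j) y) \<in> B n" using y tr[of j] by (simp add: first_return_def)
    fix i assume i: "translate (- int i) ((shift ^^ j) y) \<in> B n"
    show "j \<le> i"
    proof (rule ccontr)
      assume "\<not> j \<le> i"
      then have "(shift ^^ (j - i)) y \<in> B n" "0 < j - i" "j - i < t" using i tr[of i] j by auto
      then show False using y by (simp add: first_return_def)
    qed
  qed
  show base: "tower_base n ((shift ^^ j) y) = y" using tr[of j] by (simp add: tower_base_def b)
  show "height n ((shift ^^ j) y) = t" using y by (simp add: height_def base return_time_eq)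
qed

lemma tower_facts:
  assumes x: "x \<in> S"
  shows "first_return shift (B n) (tower_base n x) (height n x)" "depth n x < height n x"
    "(shift ^^ depth n x) (tower_base n x) = x" "tower_base n x \<in> B n" "tower_base n x \<in> S"
proof -
  obtain y t j where y: "first_return shift (B n) y t" "j < t" "x = (shift ^^ j) y"
    by (rule last_visit[OF S B_facts(1) B_nonempty x])
  note pos = tower_position[OF y(1,2), folded y(3)]
  show "first_return shift (B n) (tower_base n x) (height n x)" "depth n x < height n x"
    "(shift ^^ depth n x) (tower_base n x) = x" unfolding pos using y by simp_all
  show "tower_base n x \<in> B n" unfolding pos using y(1) by (simp add: first_return_def)
  then show "tower_base n x \<in> S" using B_subset by blast
qed

lemma tower_move:
  assumes x: "x \<in> S" and j: "j < height n x"
  shows "depth n ((shift ^^ j) (tower_base n x)) = j"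
    "tower_base n ((shift ^^ j) (tower_base n x)) = tower_base n x"
    "height n ((shift ^^ j) (tower_base n x)) = height n x"
    "tower n ((shift ^^ j) (tower_base n x)) = tower n x"
    "(shift ^^ j) (tower_base n x) \<in> S"
  using tower_position[OF tower_facts(1)[OF x] j] S_facts(8)[OF tower_facts(5)[OF x]]
  by (simp_all add: tower_def)

lemma depth_le: "translate (- int j) x \<in> B n \<Longrightarrow> depth n x \<le> j"
  unfolding depth_def by (rule Least_le)

lemma depth_eq_0_iff: "x \<in> S \<Longrightarrow> depth n x = 0 \<longleftrightarrow> x \<in> B n"
  using tower_facts(3,4)[of x n] depth_le[of 0 x n] by auto

lemma tower_base_eq: "x \<in> B n \<Longrightarrow> tower_base n x = x"
  using depth_le[of 0 x n] by (simp add: tower_base_def)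

lemma same_tower:
  assumes x: "x \<in> S" and y: "y \<in> S" and eq: "tower n x = tower n y"
  shows "height n x = height n y"
    "n > 0 \<Longrightarrow> word (tower_base n x) (height n x) = word (tower_base n y) (height n y)"
proof -
  have w: "return_word (B n) (tower_base n z) = word (tower_base n z) (height n z)" for z
    by (simp add: return_word_def height_def)
  have *: "word (tower_base n x) (height n x) = word (tower_base n y) (height n y)" if n: "n > 0"
  proof -
    have "return_word (B n) (tower_base n z) \<in> return_words (B n)" if "z \<in> S" for z
      using tower_facts(1)[OF that, of n] unfolding w return_words_def by blast
    note rw = this
    have "to_nat_on (return_words (B n)) (return_word (B n) (tower_base n x)) =
        to_nat_on (return_words (B n)) (return_word (B n) (tower_base n y))"
      using eq n by (simp add: tower_def)
    then have "return_word (B n) (tower_base n x) = return_word (B n) (tower_base n y)"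
      by (rule inj_onD[OF inj_on_to_nat_on[OF countable_finite[OF finite_words[OF n]]] _ rw[OF x] rw[OF y]])
    then show ?thesis unfolding w .
  qed
  then show "n > 0 \<Longrightarrow> word (tower_base n x) (height n x) = word (tower_base n y) (height n y)" .
  have h0: "height 0 z = 1" if "z \<in> S" for z
  proof -
    have "first_return shift (B 0) (tower_base 0 z) 1"
      using tower_facts(5)[OF that, of 0] shift_in_S by (auto simp: first_return_def B_0)
    then show ?thesis unfolding height_def by (rule return_time_eq)
  qed
  show "height n x = height n y"
  proof (cases "n = 0")
    case True
    then show ?thesis using h0 x y by simp
  next
    case False
    then show ?thesis using * by (simp add: word_eq_iff)
  qed
qed

lemma depth_mono:
  assumes x: "x \<in> S" shows "depth n x \<le> depth (Suc n) x"
proof -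
  have "translate (- int (depth (Suc n) x)) x \<in> B (Suc n)"
    using tower_facts(4)[OF x, of "Suc n"] by (simp add: tower_base_def)
  then show ?thesis by (rule depth_le[OF B_Suc])
qed

lemma tower_base_offset:
  assumes x: "x \<in> S"
  shows "tower_base n x = (shift ^^ offset n x) (tower_base (Suc n) x)" "offset n x < height (Suc n) x"
proof -
  show "tower_base n x = (shift ^^ offset n x) (tower_base (Suc n) x)"
    using depth_mono[OF x, of n]
    by (simp add: tower_base_def offset_def funpow_shift_translate translate_translate of_nat_diff)
  show "offset n x < height (Suc n) x" using tower_facts(2)[OF x, of "Suc n"] by (simp add: offset_def)
qed

text \<open>
  The position of a point at level \<open>n\<close> is the pair of its tower and its depth. By
  \<open>refine\<close>, the return word of the upper tower shows where the lower towers begin and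
  end inside it.
\<close>

lemma refine_position:
  assumes x: "x \<in> S" and y: "y \<in> S"
    and eq: "tower (Suc n) x = tower (Suc n) y" "depth (Suc n) x = depth (Suc n) y"
  shows "tower n x = tower n y" "depth n x = depth n y"
proof -
  define u v t i s where "u = tower_base (Suc n) x" and "v = tower_base (Suc n) y"
    and "t = height (Suc n) x" and "i = offset n x" and "s = height n x"
  have w: "word u t = word v t" and t: "t = height (Suc n) y"
    using same_tower[OF x y eq(1)] by (auto simp: u_def v_def t_def)
  have u: "first_return shift (B (Suc n)) u t" and v: "first_return shift (B (Suc n)) v t"
    using tower_facts(1)[OF x, of "Suc n"] tower_facts(1)[OF y, of "Suc n"] t
    by (auto simp: u_def v_def t_def)
  note iff = refine[OF u v w]
  have base: "tower_base n x = (shift ^^ i) u" "i < t"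
    using tower_base_offset[OF x, of n] by (auto simp: u_def i_def t_def)
  have fx: "first_return shift (B n) ((shift ^^ i) u) s"
    using tower_facts(1)[OF x, of n] by (simp add: base s_def)
  have st: "i + s \<le> t"
  proof (rule ccontr)
    assume "\<not> i + s \<le> t"
    moreover have "(shift ^^ (t - i)) ((shift ^^ i) u) \<in> B n"
      using u B_Suc[of "(shift ^^ t) u" n] base(2) by (simp add: funpow_funpow_diff first_return_def)
    ultimately show False using fx base(2) by (auto simp: first_return_def)
  qed
  have iff': "(shift ^^ k) ((shift ^^ i) u) \<in> B n \<longleftrightarrow> (shift ^^ k) ((shift ^^ i) v) \<in> B n" if "k \<le> s" for k
    using iff[of "k + i"] that st by (simp add: funpow_add)
  have fy: "first_return shift (B n) ((shift ^^ i) v) s"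
    using fx iff'[of 0] iff'[of s] iff' unfolding first_return_def by auto
  have bs: "depth n x < s" using tower_facts(2)[OF x] by (simp add: s_def)
  have "depth n x + i = depth (Suc n) y" using depth_mono[OF x, of n] eq(2) by (simp add: i_def offset_def)
  then have "(shift ^^ depth n x) ((shift ^^ i) v) = y"
    using tower_facts(3)[OF y, of "Suc n"] funpow_add[of "depth n x" i shift] unfolding v_def
    by (metis comp_apply)
  then have pos: "depth n y = depth n x" "tower_base n y = (shift ^^ i) v" "height n y = s"
    using tower_position[OF fy bs] by simp_all
  then show "depth n x = depth n y" by simp
  have "word ((shift ^^ i) u) s = word ((shift ^^ i) v) s"
    using w st by (auto simp: word_eq_iff funpow_shift simp flip: of_nat_add)
  then have "return_word (B n) (tower_base n x) = return_word (B n) (tower_base n y)"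
    unfolding pos(2) base(1) return_word_def return_time_eq[OF fx] return_time_eq[OF fy] .
  then show "tower n x = tower n y" by (simp add: tower_def)
qed

lemma tower_base_next:
  assumes x: "x \<in> S"
  shows "tower (Suc n) (tower_base n x) = tower (Suc n) x" "depth (Suc n) (tower_base n x) = offset n x"
    "offset n (tower_base n x) = offset n x" "tower n (tower_base n x) = tower n x"
proof -
  note mv = tower_move[OF x tower_base_offset(2)[OF x, of n], folded tower_base_offset(1)[OF x]]
  show "tower (Suc n) (tower_base n x) = tower (Suc n) x" "depth (Suc n) (tower_base n x) = offset n x"
    using mv by auto
  moreover have "depth n (tower_base n x) = 0"
    using depth_eq_0_iff[OF tower_facts(5)[OF x]] tower_facts(4)[OF x] by blast
  ultimately show "offset n (tower_base n x) = offset n x" by (simp add: offset_def)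
  show "tower n (tower_base n x) = tower n x"
    using tower_base_eq[OF tower_facts(4)[OF x, of n]] by (simp add: tower_def)
qed

lemma edge_eq_iff: "edge n x = edge n y \<longleftrightarrow> tower (Suc n) x = tower (Suc n) y \<and> offset n x = offset n y"
  by (simp add: edge_def)

lemma edge_tower_base: "x \<in> S \<Longrightarrow> edge n (tower_base n x) = edge n x"
  by (simp add: edge_eq_iff tower_base_next)

lemma edge_source:
  assumes "x \<in> S" "y \<in> S" "edge n x = edge n y" shows "tower n x = tower n y"
proof -
  have "tower n (tower_base n x) = tower n (tower_base n y)"
  proof (rule refine_position(1))
    show "tower_base n x \<in> S" "tower_base n y \<in> S" using tower_facts(5) assms(1,2) by blast+
    show "tower (Suc n) (tower_base n x) = tower (Suc n) (tower_base n y)"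
      "depth (Suc n) (tower_base n x) = depth (Suc n) (tower_base n y)"
      using assms(3) unfolding edge_eq_iff tower_base_next(1,2)[OF assms(1)] tower_base_next(1,2)[OF assms(2)]
      by blast+
  qed
  then show ?thesis unfolding tower_base_next(4)[OF assms(1)] tower_base_next(4)[OF assms(2)] .
qed

lemma refine_positions:
  assumes x: "x \<in> S" and y: "y \<in> S" and eq: "tower n x = tower n y" "depth n x = depth n y" and i: "i \<le> n"
  shows "tower i x = tower i y \<and> depth i x = depth i y"
  using i by (induction i rule: inc_induct) (use eq refine_position[OF x y] in blast)+

lemma position_edges:
  assumes x: "x \<in> S" and y: "y \<in> S" and eq: "tower n x = tower n y" "depth n x = depth n y" and i: "i < n"
  shows "edge i x = edge i y"
  using refine_positions[OF x y eq, of i] refine_positions[OF x y eq, of "Suc i"] i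
  by (simp add: edge_eq_iff offset_def)

text \<open>
  Source and range of an edge are read off from an arbitrary point with this edge, and edges with
  the same range are ordered by their offsets.
\<close>

definition diagram :: "(nat, nat) bratteli" where
  "diagram = \<lparr>br_verts = \<lambda>n. tower n ` S, br_edges = \<lambda>n. edge n ` S,
     br_src = \<lambda>n e. tower n (inv_into S (edge n) e), br_rng = \<lambda>n e. tower (Suc n) (inv_into S (edge n) e),
     br_ord = \<lambda>n v. {(edge n x, edge n y) | x y. x \<in> S \<and> y \<in> S \<and>
       tower (Suc n) x = v \<and> tower (Suc n) y = v \<and> offset n x \<le> offset n y}\<rparr>"

lemma diagram_simps [simp]:
  "br_verts diagram n = tower n ` S" "br_edges diagram n = edge n ` S"
  by (simp_all add: diagram_def)

lemma diagram_src: "x \<in> S \<Longrightarrow> br_src diagram n (edge n x) = tower n x"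
  and diagram_rng: "x \<in> S \<Longrightarrow> br_rng diagram n (edge n x) = tower (Suc n) x"
proof -
  assume x: "x \<in> S"
  define y where "y = inv_into S (edge n) (edge n x)"
  have y: "y \<in> S" "edge n y = edge n x"
    unfolding y_def using inv_into_into[of "edge n x" "edge n" S] f_inv_into_f[of "edge n x" "edge n" S] x by auto
  then show "br_src diagram n (edge n x) = tower n x"
    using edge_source[OF y(1) x y(2)] by (simp add: diagram_def y_def)
  show "br_rng diagram n (edge n x) = tower (Suc n) x"
    using y(2) by (simp add: diagram_def y_def edge_eq_iff)
qed

lemma diagram_fiber: "e \<in> br_fiber diagram n v \<longleftrightarrow> (\<exists>x\<in>S. e = edge n x \<and> tower (Suc n) x = v)"
  by (auto simp: br_fiber_def diagram_rng)

lemma diagram_fiber_ball: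
  "(\<forall>e\<in>br_fiber diagram n v. P e) \<longleftrightarrow> (\<forall>y\<in>S. tower (Suc n) y = v \<longrightarrow> P (edge n y))"
  using diagram_fiber[of _ n v] by auto

lemma diagram_ord:
  assumes "x \<in> S" "y \<in> S" "tower (Suc n) x = v" "tower (Suc n) y = v"
  shows "(edge n x, edge n y) \<in> br_ord diagram n v \<longleftrightarrow> offset n x \<le> offset n y"
proof
  assume "(edge n x, edge n y) \<in> br_ord diagram n v"
  then obtain x' y' where "edge n x = edge n x'" "edge n y = edge n y'" "offset n x' \<le> offset n y'"
    unfolding diagram_def by auto
  then show "offset n x \<le> offset n y" by (simp only: edge_eq_iff)
next
  assume "offset n x \<le> offset n y"
  then show "(edge n x, edge n y) \<in> br_ord diagram n v"
    unfolding diagram_def using assms by simp blast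
qed

lemma diagram_max_edge:
  assumes x: "x \<in> S"
  shows "max_edge diagram n (edge n x) \<longleftrightarrow>
    (\<forall>y\<in>S. tower (Suc n) y = tower (Suc n) x \<longrightarrow> offset n y \<le> offset n x)"
proof -
  have "edge n x \<in> br_edges diagram n" using x by simp
  moreover have "(edge n y, edge n x) \<in> br_ord diagram n (tower (Suc n) x) \<longleftrightarrow> offset n y \<le> offset n x"
    if "y \<in> S" "tower (Suc n) y = tower (Suc n) x" for y
    by (rule diagram_ord[OF that(1) x that(2) refl])
  ultimately show ?thesis unfolding max_edge_def diagram_rng[OF x] diagram_fiber_ball by meson
qed

lemma diagram_min_edge:
  assumes x: "x \<in> S"
  shows "min_edge diagram n (edge n x) \<longleftrightarrow>
    (\<forall>y\<in>S. tower (Suc n) y = tower (Suc n) x \<longrightarrow> offset n x \<le> offset n y)"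
proof -
  have "edge n x \<in> br_edges diagram n" using x by simp
  moreover have "(edge n x, edge n y) \<in> br_ord diagram n (tower (Suc n) x) \<longleftrightarrow> offset n x \<le> offset n y"
    if "y \<in> S" "tower (Suc n) y = tower (Suc n) x" for y
    by (rule diagram_ord[OF x that(1) refl that(2)])
  ultimately show ?thesis unfolding min_edge_def diagram_rng[OF x] diagram_fiber_ball by meson
qed

text \<open>
  The offsets of the edges with the same range as the \<open>n\<close>-th edge of \<open>x\<close>
  are the visits to \<open>B n\<close> in the tower of \<open>x\<close>. Up to the position of
  \<open>x\<close> itself the last of them is the offset of \<open>x\<close>.
\<close>

lemma offset_visit:
  assumes x: "x \<in> S" and y: "y \<in> S" and eq: "tower (Suc n) y = tower (Suc n) x"
  shows "offset n y < height (Suc n) x" "(shift ^^ offset n y) (tower_base (Suc n) x) \<in> B n"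
    "offset n y \<le> depth (Suc n) x \<Longrightarrow> offset n y \<le> offset n x"
proof -
  note same = same_tower[OF y x eq]
  show lt: "offset n y < height (Suc n) x" using tower_base_offset(2)[OF y, of n] same(1) by simp
  have "first_return shift (B (Suc n)) (tower_base (Suc n) x) (height (Suc n) x)"
    "first_return shift (B (Suc n)) (tower_base (Suc n) y) (height (Suc n) x)"
    using tower_facts(1)[OF x, of "Suc n"] tower_facts(1)[OF y, of "Suc n"] same(1) by auto
  from refine[OF this, of "offset n y"] show v: "(shift ^^ offset n y) (tower_base (Suc n) x) \<in> B n"
    using same lt tower_facts(4)[OF y, of n] tower_base_offset(1)[OF y, of n] by simp
  assume le: "offset n y \<le> depth (Suc n) x"
  have "translate (- int (depth (Suc n) x - offset n y)) x = (shift ^^ offset n y) (tower_base (Suc n) x)"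
    using le by (simp add: tower_base_def funpow_shift_translate translate_translate of_nat_diff)
  then have "depth n x \<le> depth (Suc n) x - offset n y" using v by (intro depth_le) simp
  then show "offset n y \<le> offset n x" using le by (simp add: offset_def)
qed

text \<open>
  The edges of \<open>x\<close> are minimal as long as \<open>x\<close> is in the base of its
  towers, and maximal as long as it is in the top.
\<close>

lemma min_prefix_iff:
  assumes x: "x \<in> S"
  shows "(\<forall>i<n. min_edge diagram i (edge i x)) \<longleftrightarrow> x \<in> B n"
proof (induction n)
  case (Suc n)
  have "min_edge diagram n (edge n x) \<longleftrightarrow> x \<in> B (Suc n)" if xn: "x \<in> B n"
  proof
    have b: "depth n x = 0" using depth_eq_0_iff x xn by simp
    show "min_edge diagram n (edge n x)" if "x \<in> B (Suc n)"
      using depth_eq_0_iff[OF x, of "Suc n"] that x by (simp add: diagram_min_edge offset_def)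
    assume m: "min_edge diagram n (edge n x)"
    let ?u = "tower_base (Suc n) x"
    have u: "tower (Suc n) ?u = tower (Suc n) x" "depth (Suc n) ?u = 0" "?u \<in> S"
      using tower_move[OF x, of 0 "Suc n"] tower_facts(2)[OF x, of "Suc n"] by auto
    then have "offset n x \<le> offset n ?u" using m x by (simp add: diagram_min_edge)
    then have "depth (Suc n) x = 0" using u(2) b by (simp add: offset_def)
    then show "x \<in> B (Suc n)" using depth_eq_0_iff x by simp
  qed
  then show ?case using Suc.IH B_Suc[of x n] by (auto simp: less_Suc_eq)
qed (use x B_0 in simp)

lemma shift_position:
  assumes x: "x \<in> S" and out: "shift x \<notin> B n"
  shows "depth n (shift x) = Suc (depth n x)" "tower n (shift x) = tower n x" "Suc (depth n x) < height n x"
proof -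
  have eq: "shift x = (shift ^^ Suc (depth n x)) (tower_base n x)" using tower_facts(3)[OF x, of n] by simp
  have "Suc (depth n x) \<noteq> height n x"
  proof
    assume "Suc (depth n x) = height n x"
    then have "shift x \<in> B n"
      using tower_facts(1)[OF x, of n] unfolding eq first_return_def by simp
    then show False using out by blast
  qed
  then show lt: "Suc (depth n x) < height n x" using tower_facts(2)[OF x, of n] by simp
  show "depth n (shift x) = Suc (depth n x)" "tower n (shift x) = tower n x"
    unfolding eq using tower_move[OF x lt] by blast+
qed

lemma max_edge_iff_shift:
  assumes x: "x \<in> S" and xn: "shift x \<in> B n"
  shows "max_edge diagram n (edge n x) \<longleftrightarrow> shift x \<in> B (Suc n)"
proof
  assume s: "shift x \<in> B (Suc n)"
  have T: "height (Suc n) x = Suc (depth (Suc n) x)"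
  proof -
    have "(shift ^^ Suc (depth (Suc n) x)) (tower_base (Suc n) x) \<in> B (Suc n)"
      using s tower_facts(3)[OF x, of "Suc n"] by simp
    then have "\<not> Suc (depth (Suc n) x) < height (Suc n) x"
      using tower_facts(1)[OF x, of "Suc n"] unfolding first_return_def by blast
    then show ?thesis using tower_facts(2)[OF x, of "Suc n"] by simp
  qed
  have "offset n y \<le> offset n x" if "y \<in> S" "tower (Suc n) y = tower (Suc n) x" for y
    using offset_visit(1,3)[OF x that] T by simp
  then show "max_edge diagram n (edge n x)" using x by (simp add: diagram_max_edge)
next
  assume m: "max_edge diagram n (edge n x)"
  show "shift x \<in> B (Suc n)"
  proof (rule ccontr)
    assume out: "shift x \<notin> B (Suc n)"
    note pos = shift_position[OF x out]
    have sx: "shift x \<in> S" using shift_in_S x by simp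
    have "depth n (shift x) = 0" using depth_eq_0_iff[OF sx] xn by simp
    then have "offset n (shift x) = Suc (depth (Suc n) x)" using pos(1) by (simp add: offset_def)
    moreover have "offset n (shift x) \<le> offset n x"
      using m pos(2) sx x by (simp add: diagram_max_edge)
    ultimately show False by (simp add: offset_def)
  qed
qed

lemma max_prefix_iff:
  assumes x: "x \<in> S"
  shows "(\<forall>i<n. max_edge diagram i (edge i x)) \<longleftrightarrow> shift x \<in> B n"
proof (induction n)
  case (Suc n)
  then show ?case using max_edge_iff_shift[OF x, of n] B_Suc[of "shift x" n] by (auto simp: less_Suc_eq)
qed (use x B_0 shift_in_S in simp)

section \<open>The paths of the diagram\<close>

definition path :: "(int \<Rightarrow> 'a) \<Rightarrow> nat \<Rightarrow> nat" where
  "path x n = edge n x"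

lemma path_in_path_space: "x \<in> S \<Longrightarrow> path x \<in> path_space diagram"
  by (simp add: path_space_def path_def diagram_src diagram_rng)

lemma openin_position:
  "openin (subshift_topology A S) {x \<in> S. tower n x = v \<and> depth n x = b}"
proof (subst openin_subopen, intro ballI)
  let ?T = "subshift_topology A S"
  fix x assume "x \<in> {x \<in> S. tower n x = v \<and> depth n x = b}"
  then have x: "x \<in> S" "tower n x = v" "depth n x = b" by auto
  define u t where "u = tower_base n x" and "t = height n x"
  have u: "first_return shift (B n) u t" "b < t" "u = translate (- int b) x" "u \<in> S"
    using tower_facts[OF x(1), of n] x(3) by (auto simp: u_def t_def tower_base_def)
  let ?G = "{z \<in> S. first_return shift (B n) z t \<and> word z t = word u t}"
  let ?N = "{y \<in> topspace ?T. translate (- int b) y \<in> ?G}"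
  have "openin ?T ?N"
    by (rule openin_continuous_map_preimage[OF continuous_translate[OF S_facts(1,5)]
      openin_first_return[OF S B_facts(1,2)]])
  moreover have "x \<in> ?N" using x(1) u S_facts(2) by simp
  moreover have "?N \<subseteq> {x \<in> S. tower n x = v \<and> depth n x = b}"
  proof
    fix y assume y: "y \<in> ?N"
    define z where "z = translate (- int b) y"
    have z: "first_return shift (B n) z t" "word z t = word u t" using y by (auto simp: z_def)
    have "(shift ^^ b) z = y" by (simp add: z_def funpow_shift_translate translate_translate)
    then have pos: "depth n y = b" "tower_base n y = z" using tower_position[OF z(1) u(2)] by auto
    have "return_word (B n) z = return_word (B n) u"
      unfolding return_word_def return_time_eq[OF z(1)] return_time_eq[OF u(1)] by (rule z(2))
    then have "tower n y = tower n x" unfolding tower_def pos(2) u_def[symmetric] by simp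
    then have "tower n y = v" using x(2) by simp
    then show "y \<in> {x \<in> S. tower n x = v \<and> depth n x = b}" using y pos(1) S_facts(2) by simp
  qed
  ultimately show "\<exists>N. openin ?T N \<and> x \<in> N \<and> N \<subseteq> {x \<in> S. tower n x = v \<and> depth n x = b}" by blast
qed

lemma openin_edge: "openin (subshift_topology A S) {x \<in> S. edge n x = e}"
proof -
  let ?P = "\<lambda>n q. {x \<in> S. tower n x = fst q \<and> depth n x = snd q}"
  have "{x \<in> S. edge n x = e} =
      (\<Union>(q, q')\<in>{(q, q'). to_nat (fst q', snd q' - snd q) = e}. ?P n q \<inter> ?P (Suc n) q')"
    by (auto simp: edge_def offset_def)
  also have "openin (subshift_topology A S) \<dots>"
    using openin_position by (intro openin_Union) (auto intro!: openin_Int)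
  finally show ?thesis .
qed

lemma closedin_edge: "closedin (subshift_topology A S) {x \<in> S. edge n x = e}"
proof -
  have "topspace (subshift_topology A S) - {x \<in> S. edge n x = e} = (\<Union>f\<in>- {e}. {x \<in> S. edge n x = f})"
    using S_facts(2) by auto
  then have "openin (subshift_topology A S) (topspace (subshift_topology A S) - {x \<in> S. edge n x = e})"
    using openin_edge by auto
  then show ?thesis using S_facts(2) by (auto simp: closedin_def)
qed

lemma tower_0 [simp]: "tower 0 x = 0"
  by (simp add: tower_def)

text \<open>
  A path is built from finite pieces: if \<open>x\<close> follows the first \<open>n\<close> edges
  and some \<open>x'\<close> starts its \<open>n\<close>-th edge in the same tower, then a point
  over the base of the tower of \<open>x'\<close>, at the height of \<open>x\<close>, follows one
  edge more.
\<close>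

lemma finite_path:
  assumes y: "y \<in> path_space diagram"
  shows "\<exists>x\<in>S. (\<forall>i<n. edge i x = y i) \<and> tower n x = br_src diagram n (y n)"
proof (induction n)
  case 0
  obtain x where "x \<in> S" "y 0 = edge 0 x" using path_spaceD(1)[OF y, of 0] by auto
  then show ?case by (intro bexI[of _ x]) (auto simp: diagram_src)
next
  case (Suc n)
  then obtain x where x: "x \<in> S" "\<forall>i<n. edge i x = y i" "tower n x = br_src diagram n (y n)" by blast
  obtain x' where x': "x' \<in> S" "y n = edge n x'" using path_spaceD(1)[OF y, of n] by auto
  have eq: "tower n x' = tower n x" using x(3) x' by (simp add: diagram_src)
  define z where "z = (shift ^^ depth n x) (tower_base n x')"
  have "depth n x < height n x'"
    using tower_facts(2)[OF x(1), of n] same_tower(1)[OF x(1) x'(1) eq[symmetric]] by simp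
  note z = tower_move[OF x'(1) this, folded z_def]
  have "edge i z = edge i x" if "i < n" for i
    using position_edges[OF z(5) x(1) _ _ that] z eq by simp
  moreover have "edge n z = y n"
    using edge_tower_base[OF z(5), of n] edge_tower_base[OF x'(1), of n] z(2) x'(2) by simp
  ultimately have "\<forall>i<Suc n. edge i z = y i" using x(2) by (auto simp: less_Suc_eq)
  moreover have "tower (Suc n) z = br_src diagram (Suc n) (y (Suc n))"
    using path_spaceD(2)[OF y, of n] diagram_rng[OF z(5), of n] \<open>edge n z = y n\<close> by simp
  ultimately show ?case using z(5) by blast
qed

lemma path_surj: "path ` S = path_space diagram"
proof (intro equalityI subsetI)
  fix y assume y: "y \<in> path_space diagram"
  define F where "F n = {x \<in> S. \<forall>i<n. edge i x = y i}" for n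
  have "(\<Inter>n. F n) \<noteq> {}"
  proof (rule compact_space_imp_nest[OF S_facts(3)])
    fix n
    show "closedin (subshift_topology A S) (F n)"
    proof (induction n)
      case 0
      then show ?case using closedin_topspace[of "subshift_topology A S"] S_facts(2) by (simp add: F_def)
    next
      case (Suc n)
      have "F (Suc n) = F n \<inter> {x \<in> S. edge n x = y n}" by (auto simp: F_def less_Suc_eq)
      then show ?case using closedin_Int[OF Suc.IH closedin_edge] by simp
    qed
    show "F n \<noteq> {}" using finite_path[OF y, of n] by (auto simp: F_def)
    show "decseq F" by (rule decseq_SucI) (auto simp: F_def)
  qed
  then obtain x where x: "x \<in> (\<Inter>n. F n)" by blast
  then have "x \<in> S" "path x = y" by (auto simp: F_def path_def fun_eq_iff)
  then show "y \<in> path ` S" by blast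
qed (use path_in_path_space in auto)

text \<open>
  Two points with the same path agree on the coordinates that their common tower covers. If the
  towers do not cover all coordinates on one side, then the distance to the base, or to the next
  visit of \<open>B n\<close>, stays bounded, and both points are the same translate of
  \<open>p\<close>.
\<close>

lemma path_inj:
  assumes x: "x \<in> S" and y: "y \<in> S" and eq: "path x = path y"
  shows "x = y"
proof (rule ccontr)
  assume "x \<noteq> y"
  then obtain i where i: "x i \<noteq> y i" by blast
  have edges: "tower (Suc n) x = tower (Suc n) y" "offset n x = offset n y" for n
    using fun_cong[OF eq, of n] by (simp_all add: path_def edge_eq_iff)
  have depth: "depth n x = depth n y" for n
  proof (induction n)
    case 0
    have "depth 0 z = 0" if "z \<in> S" for z using depth_eq_0_iff[OF that, of 0] that B_0 by simp
    then show ?case using x y by simp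
  next
    case (Suc n)
    then show ?case using edges(2)[of n] depth_mono[OF x, of n] depth_mono[OF y, of n] by (simp add: offset_def)
  qed
  define b h where "b n = depth n x" and "h n = height n x" for n
  have bh: "b n < h n" for n using tower_facts(2)[OF x] by (simp add: b_def h_def)
  have hy: "height (Suc n) y = h (Suc n)" for n using same_tower(1)[OF x y edges(1)] by (simp add: h_def)
  have letters: "x k = y k" if "- int (b (Suc n)) \<le> k" "k < int (h (Suc n)) - int (b (Suc n))" for k n
  proof -
    have w: "word (tower_base (Suc n) x) (h (Suc n)) = word (tower_base (Suc n) y) (h (Suc n))"
      using same_tower(2)[OF x y edges(1)] by (simp add: h_def[symmetric] hy)
    define j where "j = nat (k + int (b (Suc n)))"
    have "j < h (Suc n)" "int j = k + int (b (Suc n))" using that by (auto simp: j_def)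
    then show ?thesis using w by (auto simp: word_eq_iff tower_base_def translate_def b_def simp flip: depth)
  qed
  have limit: "x = y"
    if "\<And>n. \<exists>m\<ge>n. translate c x \<in> B m \<and> translate c y \<in> B m" for c
  proof -
    have "translate c z = p" if "z = x \<or> z = y" for z
    proof (rule B_facts(6))
      fix n
      obtain m where "m \<ge> n" "translate c x \<in> B m" "translate c y \<in> B m"
        using \<open>\<And>n. \<exists>m\<ge>n. translate c x \<in> B m \<and> translate c y \<in> B m\<close> by blast
      then show "translate c z \<in> B n" using B_facts(3)[of n m] that by blast
    qed
    then have "translate c x = translate c y" by simp
    then have "translate (- c) (translate c x) = translate (- c) (translate c y)" by simp
    then show ?thesis by (simp add: translate_translate)
  qed
  show False
  proof (cases "i < 0")
    case True
    have bound: "b (Suc n) \<le> nat (- i)" for n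
      using letters[of n i] i bh[of "Suc n"] True by (metis le_nat_iff nat_le_linear not_le int_nat_eq neg_le_iff_le minus_minus less_trans of_nat_less_iff diff_gt_0_iff_gt)
    obtain c where c: "\<And>n. \<exists>m\<ge>n. b (Suc m) = c"
      using bounded_value_recurs[of "\<lambda>n. b (Suc n)", OF bound] by blast
    have "x = y"
    proof (rule limit[of "- int c"])
      fix n
      obtain m where m: "m \<ge> n" "b (Suc m) = c" using c by blast
      then have "translate (- int c) x \<in> B (Suc m)" "translate (- int c) y \<in> B (Suc m)"
        using tower_facts(4)[OF x, of "Suc m"] tower_facts(4)[OF y, of "Suc m"] depth[of "Suc m"]
        by (simp_all add: tower_base_def b_def)
      then show "\<exists>m\<ge>n. translate (- int c) x \<in> B m \<and> translate (- int c) y \<in> B m"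
        using m(1) by (intro exI[of _ "Suc m"]) simp
    qed
    then show False using \<open>x \<noteq> y\<close> by simp
  next
    case False
    have bound: "h (Suc n) - b (Suc n) \<le> nat i" for n
      using letters[of n i] i bh[of "Suc n"] False by force
    obtain c where c: "\<And>n. \<exists>m\<ge>n. h (Suc m) - b (Suc m) = c"
      using bounded_value_recurs[of "\<lambda>n. h (Suc n) - b (Suc n)", OF bound] by blast
    have "x = y"
    proof (rule limit[of "int c"])
      fix n
      obtain m where m: "m \<ge> n" "h (Suc m) - b (Suc m) = c" using c by blast
      have tr: "(shift ^^ h (Suc m)) (tower_base (Suc m) z) = translate (int c) z"
        if "depth (Suc m) z = b (Suc m)" for z
        using m(2) bh[of "Suc m"] that
        by (simp add: tower_base_def funpow_shift_translate translate_translate of_nat_diff flip: m(2))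
      have "translate (int c) x \<in> B (Suc m)" "translate (int c) y \<in> B (Suc m)"
        using tower_facts(1)[OF x, of "Suc m"] tower_facts(1)[OF y, of "Suc m"] tr[of x] tr[of y] hy[of m] depth[of "Suc m"]
        by (auto simp: first_return_def b_def h_def)
      then show "\<exists>m\<ge>n. translate (int c) x \<in> B m \<and> translate (int c) y \<in> B m"
        using m(1) by (intro exI[of _ "Suc m"]) simp
    qed
    then show False using \<open>x \<noteq> y\<close> by simp
  qed
qed

lemma finite_tower: "finite (tower n ` S)" "n > 0 \<Longrightarrow> card (tower n ` S) \<le> card (return_words (B n))"
proof -
  have sub: "tower n ` S \<subseteq> to_nat_on (return_words (B n)) ` return_words (B n)" if "n > 0"
  proof
    fix v assume "v \<in> tower n ` S"
    then obtain x where x: "x \<in> S" "v = tower n x" by blast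
    have "return_word (B n) (tower_base n x) \<in> return_words (B n)"
      using tower_facts(1)[OF x(1), of n] unfolding return_words_def return_word_def height_def by blast
    then show "v \<in> to_nat_on (return_words (B n)) ` return_words (B n)" using x(2) that by (simp add: tower_def)
  qed
  show "finite (tower n ` S)"
  proof (cases "n > 0")
    case True
    then show ?thesis using finite_surj[OF finite_words sub] by blast
  next
    case False
    then show ?thesis by (auto intro: finite_subset[of _ "{0}"])
  qed
  show "card (tower n ` S) \<le> card (return_words (B n))" if "n > 0"
    by (rule surj_card_le[OF finite_words[OF that] sub[OF that]])
qed

lemma ordered_diagram: "ordered_bratteli diagram"
  unfolding ordered_bratteli_def bratteli_diagram_def
proof (intro conjI allI ballI)
  show "\<exists>v0. br_verts diagram 0 = {v0}"
    using p_in_S by (auto intro!: exI[of _ 0])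
  fix n
  show "finite (br_verts diagram n)" using finite_tower by simp
  show "br_verts diagram n \<noteq> {}" "br_edges diagram n \<noteq> {}" using p_in_S by auto
  have "finite (edge n ` S)"
    using finite_range_locally_constant[OF S_facts(3), of "edge n"] openin_edge S_facts(2) by simp
  then show "finite (br_edges diagram n)" by simp
  show "br_src diagram n ` br_edges diagram n \<subseteq> br_verts diagram n"
    "br_rng diagram n ` br_edges diagram n \<subseteq> br_verts diagram (Suc n)"
    by (auto simp: diagram_src diagram_rng)
  show "\<exists>e\<in>br_edges diagram n. br_src diagram n e = v" if "v \<in> br_verts diagram n" for v
    using that by (auto simp: diagram_src)
  show "\<exists>e\<in>br_edges diagram n. br_rng diagram n e = v" if "v \<in> br_verts diagram (Suc n)" for v
    using that by (auto simp: diagram_rng)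
  fix v
  let ?F = "br_fiber diagram n v" and ?R = "br_ord diagram n v"
  have R: "(e, f) \<in> ?R \<longleftrightarrow> (\<exists>x\<in>S. \<exists>y\<in>S. e = edge n x \<and> f = edge n y \<and>
      tower (Suc n) x = v \<and> tower (Suc n) y = v \<and> offset n x \<le> offset n y)" for e f
    by (auto simp: diagram_def)
  show "linear_order_on ?F ?R"
    unfolding order_on_defs
  proof (intro conjI)
    show "refl_on ?F ?R"
    proof (rule refl_onI)
      fix e assume "e \<in> ?F"
      then obtain x where "x \<in> S" "e = edge n x" "tower (Suc n) x = v" by (auto simp: diagram_fiber)
      then show "(e, e) \<in> ?R" unfolding R by (intro bexI[of _ x]) auto
    qed
    show "?R \<subseteq> ?F \<times> ?F" by (auto simp: R diagram_fiber)
    show "trans ?R"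
    proof (rule transI)
      fix e f g assume "(e, f) \<in> ?R" "(f, g) \<in> ?R"
      then obtain x y y' z where "x \<in> S" "z \<in> S" "e = edge n x" "g = edge n z" "tower (Suc n) x = v"
        "tower (Suc n) z = v" "edge n y = edge n y'" "offset n x \<le> offset n y" "offset n y' \<le> offset n z"
        unfolding R by metis
      then show "(e, g) \<in> ?R" unfolding R edge_eq_iff by (metis order_trans)
    qed
    show "antisym ?R" by (rule antisymI) (auto simp: R edge_eq_iff)
    show "total_on ?F ?R"
      unfolding total_on_def
    proof (intro ballI impI)
      fix e f assume "e \<in> ?F" "f \<in> ?F"
      then obtain x y where "x \<in> S" "e = edge n x" "tower (Suc n) x = v" "y \<in> S" "f = edge n y" "tower (Suc n) y = v"
        unfolding diagram_fiber by blast
      then show "(e, f) \<in> ?R \<or> (f, e) \<in> ?R" unfolding R using linear[of "offset n x" "offset n y"] by blast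
    qed
  qed
qed

lemma simple_diagram: "br_simple diagram"
  unfolding br_simple_def
proof (intro exI[of _ id] conjI allI ballI)
  fix n u v assume "u \<in> br_verts diagram (id n)" "v \<in> br_verts diagram (id (Suc n))"
  then obtain x y where x: "x \<in> S" "u = tower n x" and y: "y \<in> S" "v = tower (Suc n) y" by auto
  define z where "z = tower_base (Suc n) y"
  have z: "first_return shift (B (Suc n)) z (height (Suc n) y)" using tower_facts(1)[OF y(1)] by (simp add: z_def)
  then obtain i where i: "i < height (Suc n) y" "(shift ^^ i) z \<in> B n"
    "return_word (B n) ((shift ^^ i) z) = return_word (B n) (tower_base n x)"
    using full[OF tower_facts(4)[OF x(1)], of z n "height (Suc n) y"] by (auto simp: first_return_def)
  note mv = tower_move[OF y(1) i(1), folded z_def]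
  have "tower n ((shift ^^ i) z) = u" using i(2,3) x(2) by (simp add: tower_def tower_base_eq)
  then have "br_path diagram n u (Suc n) v [edge n ((shift ^^ i) z)]"
    using mv y(2) by (simp add: br_path_def diagram_src diagram_rng)
  then show "\<exists>p. br_path diagram (id n) u (id (Suc n)) v p" by auto
qed (simp_all add: strict_mono_def)

lemma min_path_iff: "x \<in> S \<Longrightarrow> min_path diagram (path x) \<longleftrightarrow> x = p"
proof -
  assume x: "x \<in> S"
  have "min_path diagram (path x) \<longleftrightarrow> (\<forall>n. \<forall>i<n. min_edge diagram i (edge i x))"
    using path_in_path_space[OF x] by (auto simp: min_path_def path_def)
  also have "\<dots> \<longleftrightarrow> (\<forall>n. x \<in> B n)" by (simp add: min_prefix_iff[OF x])
  also have "\<dots> \<longleftrightarrow> x = p" using B_facts(4,6) by blast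
  finally show ?thesis .
qed

lemma max_path_iff: "x \<in> S \<Longrightarrow> max_path diagram (path x) \<longleftrightarrow> shift x = p"
proof -
  assume x: "x \<in> S"
  have "max_path diagram (path x) \<longleftrightarrow> (\<forall>n. \<forall>i<n. max_edge diagram i (edge i x))"
    using path_in_path_space[OF x] by (auto simp: max_path_def path_def)
  also have "\<dots> \<longleftrightarrow> (\<forall>n. shift x \<in> B n)" by (simp add: max_prefix_iff[OF x])
  also have "\<dots> \<longleftrightarrow> shift x = p" using B_facts(4,6) by blast
  finally show ?thesis .
qed

lemma unique_min_path: "min_path diagram y \<longleftrightarrow> y = path p"
proof
  assume y: "min_path diagram y"
  then obtain x where "x \<in> S" "y = path x" using path_surj by (metis imageE min_path_def)
  then show "y = path p" using min_path_iff y by simp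
qed (use min_path_iff p_in_S in simp)

lemma properly_ordered_diagram: "properly_ordered diagram"
proof -
  have "p \<in> shift ` S" using p_in_S S_facts(5) by simp
  then obtain q where q: "q \<in> S" "shift q = p" by blast
  have inj: "x = q" if "shift x = p" for x
  proof -
    have "translate (- 1) (shift x) = translate (- 1) (shift q)" using that q(2) by simp
    then show ?thesis by (simp add: translate_def shift_def)
  qed
  have "max_path diagram y \<longleftrightarrow> y = path q" for y
  proof
    assume y: "max_path diagram y"
    then obtain x where x: "x \<in> S" "y = path x" using path_surj by (metis imageE max_path_def)
    then show "y = path q" using max_path_iff y inj by simp
  qed (use max_path_iff q in simp)
  then show ?thesis
    using ordered_diagram simple_diagram unique_min_path by (simp add: properly_ordered_def)
qed

text \<open>
  If \<open>n\<close> is the last level at which \<open>shift x\<close> enters the base, then the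
  shift moves \<open>x\<close> up by one within its towers above level \<open>n\<close> and to the
  next tower of level \<open>n\<close>.
\<close>

lemma vershik_path:
  assumes x: "x \<in> S"
  shows "vershik_map diagram (path x) = path (shift x)"
proof (cases "max_path diagram (path x)")
  case True
  then have "shift x = p" using max_path_iff x by simp
  moreover have "(THE y. min_path diagram y) = path p" by (rule the_equality) (auto simp: unique_min_path)
  ultimately show ?thesis using True by (simp add: vershik_map_def)
next
  case False
  have sx: "shift x \<in> S" using shift_in_S x by simp
  have "\<exists>n. shift x \<notin> B n" using False max_path_iff[OF x] B_facts(6) by blast
  define m where "m = (LEAST n. shift x \<notin> B n)"
  have m: "shift x \<notin> B m" unfolding m_def using \<open>\<exists>n. shift x \<notin> B n\<close> by (rule LeastI_ex)
  have "m \<noteq> 0"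
  proof
    assume "m = 0"
    then show False using m sx B_0 by simp
  qed
  then obtain n where n: "m = Suc n" using not0_implies_Suc by blast
  have in_n: "shift x \<in> B n" using not_less_Least[of n "\<lambda>n. shift x \<notin> B n"] n by (auto simp: m_def)
  have out: "shift x \<notin> B i" if "i > n" for i
    using m B_facts(3)[of "Suc n" i] that unfolding n by auto
  have pos: "depth i (shift x) = Suc (depth i x)" "tower i (shift x) = tower i x" if "i > n" for i
    using shift_position[OF x out[OF that]] by auto
  have b0: "depth n (shift x) = 0" using depth_eq_0_iff[OF sx] in_n by simp
  have off: "offset n (shift x) = Suc (depth (Suc n) x)" using pos(1)[of "Suc n"] b0 by (simp add: offset_def)
  show ?thesis
  proof (rule vershik_map_eqI[OF ordered_diagram path_in_path_space[OF x], of n])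
    show "\<not> max_edge diagram n (path x n)" using max_edge_iff_shift[OF x in_n] m n by (simp add: path_def)
    show "max_edge diagram i (path x i)" if "i < n" for i
      using max_prefix_iff[OF x, of n] in_n that by (simp add: path_def)
    show "vershik_step diagram n (path x) (path (shift x))"
      unfolding vershik_step_def
    proof (intro conjI allI impI)
      show "path (shift x) \<in> path_space diagram" by (rule path_in_path_space[OF sx])
      show "min_edge diagram i (path (shift x) i)" if "i < n" for i
        using min_prefix_iff[OF sx, of n] in_n that by (simp add: path_def)
      show "path (shift x) i = path x i" if "i > n" for i
        using pos[of i] pos[of "Suc i"] that by (simp add: path_def edge_eq_iff offset_def)
      have t: "tower (Suc n) (shift x) = tower (Suc n) x" using pos(2) by simp
      have less: "offset n x < offset n (shift x)" using off by (simp add: offset_def)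
      have "offset n (shift x) \<le> offset n y"
        if "y \<in> S" "tower (Suc n) y = tower (Suc n) x" "offset n x \<le> offset n y" "offset n y \<noteq> offset n x" for y
        using offset_visit(3)[OF x that(1,2)] that(3,4) off by linarith
      then show "succ_edge diagram n (path x n) (path (shift x) n)"
        using x sx t less
        by (auto simp: succ_edge_def Let_def path_def diagram_rng diagram_fiber diagram_ord edge_eq_iff
          intro!: bexI[of _ "shift x"])
    qed
  qed
qed

lemma conjugate_diagram:
  "topologically_conjugate (path_space_topology diagram) (vershik_map diagram) (subshift_topology A S) shift"
proof (rule topologically_conjugate_sym)
  let ?T = "subshift_topology A S" and ?I = "path_space_topology diagram"
  show "shift ` topspace ?T \<subseteq> topspace ?T" using S_facts(2,5) by simp
  have I: "path_space diagram \<subseteq> Pi UNIV (br_edges diagram)" unfolding path_space_def by blast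
  have tsI: "topspace ?I = path_space diagram"
    unfolding path_space_topology_def by (rule topspace_seq_topology[OF I])
  have "continuous_map ?T ?I path"
    unfolding path_space_topology_def continuous_map_seq_topology_iff[OF I] S_facts(2)
    using path_surj openin_edge by (auto simp: path_def)
  moreover have "inj_on path S" by (rule inj_onI) (rule path_inj)
  ultimately have "homeomorphic_map ?T ?I path"
    using S_facts(2,3) tsI path_surj Hausdorff_seq_topology
    by (intro continuous_imp_homeomorphic_map) (auto simp: path_space_topology_def)
  then show "topologically_conjugate ?T shift ?I (vershik_map diagram)"
    unfolding topologically_conjugate_def S_facts(2) using vershik_path by auto
qed

end

text \<open>
  Near \<open>p\<close> a return word determines the visits to a clopen set \<open>E\<close> that
  occur during the return: coordinates before the start and after the return are those of
  \<open>p\<close>, as far as a window of \<open>E\<close> reaches.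
\<close>

lemma bratteli_topological_rank_le:
  fixes S :: "(int \<Rightarrow> 'a) set"
  assumes S: "minimal_subshift A S" and few: "few_return_words (subshift_topology A S) K"
  shows "bratteli_topological_rank (subshift_topology A S) shift \<le> enat K"
proof -
  let ?T = "subshift_topology A S"
  note D = minimal_subshiftD[OF S]
  obtain C p where C: "shrinking_sets ?T C p"
    and inf: "\<exists>\<^sub>\<infinity>n. finite (return_words (C n)) \<and> card (return_words (C n)) \<le> K"
    using few by (auto simp: few_return_words_def)
  have pS: "p \<in> S" using shrinking_setsD(5)[OF C] D(2) by simp
  define det where "det E U \<longleftrightarrow> (\<forall>y\<in>U. \<forall>z\<in>U. \<forall>t. (shift ^^ t) y \<in> U \<longrightarrow> (shift ^^ t) z \<in> U \<longrightarrow>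
     word y t = word z t \<longrightarrow> (\<forall>i\<le>t. (shift ^^ i) y \<in> E \<longleftrightarrow> (shift ^^ i) z \<in> E))" for E U :: "(int \<Rightarrow> 'a) set"
  define vis where "vis E U \<longleftrightarrow> (\<forall>x\<in>E. \<forall>y\<in>U. \<forall>t>0. (shift ^^ t) y \<in> U \<longrightarrow>
     (\<exists>i<t. (shift ^^ i) y \<in> E \<and> return_word E ((shift ^^ i) y) = return_word E x))" for E U :: "(int \<Rightarrow> 'a) set"
  have ex_nbhd: "\<exists>U. openin ?T U \<and> p \<in> U \<and> (\<forall>E'\<subseteq>U. det E E' \<and> vis E E')" if E: "openin ?T E" "closedin ?T E" "p \<in> E" for E
  proof -
    have ES: "E \<subseteq> S" using openin_subset[OF E(1)] D(2) by simp
    obtain F where F: "finite F" "\<And>x y. x \<in> S \<Longrightarrow> y \<in> S \<Longrightarrow> agree_on F x y \<Longrightarrow> x \<in> E \<longleftrightarrow> y \<in> E"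
      using clopen_window[OF S E(1,2)] by metis
    define L where "L = Max (insert 0 (abs ` F))"
    have L: "- L \<le> k \<and> k \<le> L" if "k \<in> F" for k
    proof -
      have "\<bar>k\<bar> \<le> L" unfolding L_def using F(1) that by (intro Max_ge) auto
      then show ?thesis by linarith
    qed
    let ?U1 = "{x \<in> S. agree_on {- L..L} p x}"
    have U1: "openin ?T ?U1"
      unfolding subshift_topology_eq by (rule openin_cylinder[OF D(1)]) simp
    have det: "det E ?U1"
      unfolding det_def
    proof (intro ballI allI impI)
      fix y z t i assume y: "y \<in> ?U1" and z: "z \<in> ?U1" and ty: "(shift ^^ t) y \<in> ?U1"
        and tz: "(shift ^^ t) z \<in> ?U1" and w: "word y t = word z t" and i: "i \<le> t"
      have "y (k + int i) = z (k + int i)" if k: "k \<in> F" for k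
      proof -
        define j where "j = k + int i"
        consider "j < 0" | "0 \<le> j" "j < int t" | "j \<ge> int t" by linarith
        then show ?thesis
        proof cases
          case 1
          then have "j \<in> {- L..L}" using L[OF k] by (auto simp: j_def)
          then have "p j = y j" "p j = z j" using y z unfolding agree_on_def by blast+
          then show ?thesis by (simp add: j_def)
        next
          case 2
          then have "nat j < t" "int (nat j) = j" by auto
          then have "y j = z j" using w unfolding word_eq_iff by metis
          then show ?thesis by (simp add: j_def)
        next
          case 3
          then have "j - int t \<in> {- L..L}" using L[OF k] i by (auto simp: j_def)
          then have "p (j - int t) = ((shift ^^ t) y) (j - int t)" "p (j - int t) = ((shift ^^ t) z) (j - int t)"
            using ty tz unfolding agree_on_def by blast+
          then show ?thesis by (simp add: funpow_shift j_def)
        qed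
      qed
      then have "agree_on F ((shift ^^ i) y) ((shift ^^ i) z)" by (simp add: agree_on_def funpow_shift)
      then show "(shift ^^ i) y \<in> E \<longleftrightarrow> (shift ^^ i) z \<in> E"
        using F(2)[OF D(8) D(8)] y z by simp
    qed
    have ret: "first_return shift E x (return_time E x)" if "x \<in> E" for x
      using first_return_minimal[OF D(6,7) E(1) that] return_time_eq by metis
    \<comment> \<open>the bases of the towers over \<open>E\<close>\<close>
    define W where "W w = {x \<in> E. return_word E x = w}" for w
    have W: "openin ?T (W w)" for w
    proof -
      have "W w = {z \<in> S. first_return shift E z (length w) \<and> word z (length w) = w}"
      proof (intro equalityI subsetI)
        fix x assume x: "x \<in> W w"
        then have "length w = return_time E x" by (auto simp: W_def return_word_def)
        then show "x \<in> {z \<in> S. first_return shift E z (length w) \<and> word z (length w) = w}"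
          using x ES ret[of x] by (auto simp: W_def return_word_def)
      next
        fix x assume x: "x \<in> {z \<in> S. first_return shift E z (length w) \<and> word z (length w) = w}"
        then have "return_time E x = length w" using return_time_eq by blast
        then show "x \<in> W w" using x by (auto simp: W_def return_word_def first_return_def)
      qed
      then show ?thesis using openin_first_return[OF S E(1,2)] by simp
    qed
    have "finite (return_word E ` E)"
    proof -
      define g where "g x = (if x \<in> E then Some (return_word E x) else None)" for x
      have "openin ?T {x \<in> topspace ?T. g x = v}" for v
      proof (cases v)
        case None
        have "{x \<in> topspace ?T. g x = v} = topspace ?T - E" by (auto simp: g_def None)
        then show ?thesis using E(2) by (simp add: closedin_def)
      next
        case (Some w)
        have "{x \<in> topspace ?T. g x = v} = W w" using ES D(2) by (auto simp: g_def Some W_def)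
        then show ?thesis using W by simp
      qed
      then have "finite (g ` topspace ?T)" by (rule finite_range_locally_constant[OF D(3)])
      moreover have "Some ` return_word E ` E \<subseteq> g ` topspace ?T" using ES D(2) by (force simp: g_def)
      ultimately have "finite (Some ` return_word E ` E)" by (rule finite_subset[rotated])
      then show ?thesis by (rule finite_imageD) simp
    qed
    then have "finite (W ` return_word E ` E)" by simp
    moreover have "openin ?T V \<and> V \<noteq> {}" if "V \<in> W ` return_word E ` E" for V
      using that W by (auto simp: W_def)
    moreover have "p \<in> topspace ?T" using pS D(2) by simp
    ultimately have "\<exists>V. openin ?T V \<and> p \<in> V \<and> (\<forall>y t q. y \<in> V \<longrightarrow> t > 0 \<longrightarrow>
        (shift ^^ t) y \<in> V \<longrightarrow> q \<in> W ` return_word E ` E \<longrightarrow> (\<exists>i<t. (shift ^^ i) y \<in> q))"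
      by (intro visit_all_before_return[OF D(6,7,4)])
    then obtain V where V: "openin ?T V" "p \<in> V" "\<forall>y t q. y \<in> V \<longrightarrow> t > 0 \<longrightarrow>
        (shift ^^ t) y \<in> V \<longrightarrow> q \<in> W ` return_word E ` E \<longrightarrow> (\<exists>i<t. (shift ^^ i) y \<in> q)"
      by (elim exE conjE)
    have "openin ?T (?U1 \<inter> V)" using U1 V(1) by (rule openin_Int)
    moreover have "p \<in> ?U1 \<inter> V" using pS V(2) by (simp add: agree_on_def)
    moreover have "det E E' \<and> vis E E'" if E': "E' \<subseteq> ?U1 \<inter> V" for E'
    proof
      have "E' \<subseteq> ?U1" using E' by blast
      then show "det E E'" using det unfolding det_def by (meson subsetD)
      show "vis E E'"
        unfolding vis_def
      proof (intro ballI allI impI)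
        fix x y t assume *: "x \<in> E" "y \<in> E'" "0 < t" "(shift ^^ t) y \<in> E'"
        then have "y \<in> V" "(shift ^^ t) y \<in> V" using E' by blast+
        then obtain i where "i < t" "(shift ^^ i) y \<in> W (return_word E x)"
          using V(3)[rule_format, of y t "W (return_word E x)"] *(1,3) by blast
        then show "\<exists>i<t. (shift ^^ i) y \<in> E \<and> return_word E ((shift ^^ i) y) = return_word E x"
          by (auto simp: W_def)
      qed
    qed
    ultimately show ?thesis by blast
  qed
  obtain B where Bs: "shrinking_sets ?T B p" "B 0 = topspace ?T"
    "\<forall>n. det (B n) (B (Suc n)) \<and> vis (B n) (B (Suc n))"
    "\<forall>n>0. finite (return_words (B n)) \<and> card (return_words (B n)) \<le> K"
  proof -
    have "\<exists>B. shrinking_sets ?T B p \<and> B 0 = topspace ?T \<and>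
      (\<forall>n. det (B n) (B (Suc n)) \<and> vis (B n) (B (Suc n))) \<and>
      (\<forall>n>0. finite (return_words (B n)) \<and> card (return_words (B n)) \<le> K)"
      by (rule rapidly_shrinking[OF D(3) C inf]) (rule ex_nbhd)
    then show thesis using that by (elim exE conjE)
  qed
  interpret two_sided_cuts A S B p
  proof
    show "minimal_subshift A S" "shrinking_sets ?T B p" by (rule S, rule Bs(1))
    show "B 0 = S" using Bs(2) D(2) by simp
    show "finite (return_words (B n))" if "n > 0" for n using Bs(4) that by blast
    show "(shift ^^ i) y \<in> B n \<longleftrightarrow> (shift ^^ i) z \<in> B n"
      if y: "first_return shift (B (Suc n)) y t" and z: "first_return shift (B (Suc n)) z t"
        and w: "word y t = word z t" and i: "i \<le> t" for n y z t i
      using Bs(3)[rule_format, of n, THEN conjunct1, unfolded det_def] y z w i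
      unfolding first_return_def by blast
    show "\<exists>i<t. (shift ^^ i) y \<in> B n \<and> return_word (B n) ((shift ^^ i) y) = return_word (B n) x"
      if "x \<in> B n" "y \<in> B (Suc n)" "t > 0" "(shift ^^ t) y \<in> B (Suc n)" for n x y t
      by (rule Bs(3)[rule_format, THEN conjunct2, unfolded vis_def, rule_format, OF that])
  qed
  have "card (br_verts diagram n) \<le> K" if "n > 0" for n
    using finite_tower(2)[OF that] Bs(4)[rule_format, OF that] by simp
  then have "\<exists>\<^sub>\<infinity>n. card (br_verts diagram n) \<le> K" unfolding INFM_nat by (metis lessI zero_less_Suc)
  then have "br_rank diagram \<le> enat K" unfolding br_rank_def liminf_enat_le_iff_frequently .
  moreover have "bratteli_topological_rank ?T shift \<le> br_rank diagram"
    unfolding bratteli_topological_rank_def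
    by (rule Inf_lower) (use properly_ordered_diagram conjugate_diagram in blast)
  ultimately show ?thesis by (rule order_trans[rotated])
qed


section \<open>The rank of the one-sided factor\<close>

lemma few_return_words_of_rank:
  fixes X :: "(nat \<Rightarrow> 'a) set"
  assumes X: "minimal_subshift A X" and rank: "topological_rank (subshift_topology A X) shift \<le> enat K"
  shows "few_return_words (subshift_topology A X) K"
proof -
  have "Inf {gm_rank r | (G :: nat graph_seq) b r c. gm_covering G b r c \<and> gm_simple G r c \<and>
      topologically_conjugate (inverse_limit_topology G) (inverse_limit_map G) (subshift_topology A X) shift}
      < enat (Suc K)"
    using rank unfolding topological_rank_def by (rule le_less_trans) simp
  then obtain G :: "nat graph_seq" and b r c where gm: "gm_covering G b r c"
    "topologically_conjugate (inverse_limit_topology G) (inverse_limit_map G) (subshift_topology A X) shift"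
    and "gm_rank r < enat (Suc K)"
    unfolding Inf_less_iff by blast
  then have "gm_rank r \<le> enat K" by (cases "gm_rank r") auto
  then show ?thesis by (rule few_return_words_of_covering[OF X gm(1) _ gm(2)])
qed

lemma few_return_words_of_bratteli_rank:
  fixes S :: "(int \<Rightarrow> 'a) set"
  assumes S: "minimal_subshift A S" and rank: "bratteli_topological_rank (subshift_topology A S) shift \<le> enat K"
  shows "few_return_words (subshift_topology A S) K"
proof -
  have "Inf {br_rank B | (B :: (nat, nat) bratteli). properly_ordered B \<and>
      topologically_conjugate (path_space_topology B) (vershik_map B) (subshift_topology A S) shift}
      < enat (Suc K)"
    using rank unfolding bratteli_topological_rank_def by (rule le_less_trans) simp
  then obtain B :: "(nat, nat) bratteli" where B: "properly_ordered B"
    "topologically_conjugate (path_space_topology B) (vershik_map B) (subshift_topology A S) shift"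
    and "br_rank B < enat (Suc K)"
    unfolding Inf_less_iff by blast
  then have "br_rank B \<le> enat K" by (cases "br_rank B") auto
  then show ?thesis by (rule few_return_words_of_bratteli[OF S B(1) _ B(2)])
qed

lemma bratteli_rank_le_one_sided_rank:
  assumes "minimal_two_sided_subshift A S"
  shows "bratteli_topological_rank (subshift_topology A S) shift
    \<le> topological_rank (subshift_topology A (one_sided_factor S)) shift"
proof (cases "topological_rank (subshift_topology A (one_sided_factor S)) shift")
  case (enat K)
  note S = minimal_two_sided_subshift_imp[OF assms]
  have "few_return_words (subshift_topology A (future ` S)) K"
    by (rule few_return_words_of_rank[OF S(2)]) (use enat in \<open>simp add: one_sided_factor_eq\<close>)
  then have "few_return_words (subshift_topology A S) K" by (rule few_return_words_two_sided[OF S])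
  then show ?thesis using bratteli_topological_rank_le[OF S(1)] enat by simp
qed simp

lemma one_sided_rank_eq_bratteli_rank:
  fixes S :: "(int \<Rightarrow> 'a::countable) set"
  assumes "minimal_two_sided_subshift A S"
  shows "topological_rank (subshift_topology A (one_sided_factor S)) shift
    = bratteli_topological_rank (subshift_topology A S) shift"
proof (rule antisym[OF _ bratteli_rank_le_one_sided_rank[OF assms]])
  note S = minimal_two_sided_subshift_imp[OF assms]
  show "topological_rank (subshift_topology A (one_sided_factor S)) shift
    \<le> bratteli_topological_rank (subshift_topology A S) shift"
  proof (cases "bratteli_topological_rank (subshift_topology A S) shift")
    case (enat K)
    have "few_return_words (subshift_topology A S) K"
      by (rule few_return_words_of_bratteli_rank[OF S(1)]) (use enat in simp)
    then have "few_return_words (subshift_topology A (future ` S)) K" by (rule few_return_words_one_sided[OF S])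
    then show ?thesis using topological_rank_le[OF S(2)] enat by (simp add: one_sided_factor_eq)
  qed simp
qed

lemma bratteli_topological_rank_conjugate_le:
  assumes "topologically_conjugate T f U g"
  shows "bratteli_topological_rank U g \<le> bratteli_topological_rank T f"
  unfolding bratteli_topological_rank_def
  by (rule Inf_superset_mono) (use topologically_conjugate_trans[OF _ assms] in blast)

text \<open>
  Renaming the letters is a continuous bijection from a compact space, hence a conjugacy onto its
  image, and this image is closed.
\<close>

lemma relabel_subshift:
  fixes S :: "(int \<Rightarrow> 'a) set" and g :: "'a \<Rightarrow> 'b"
  assumes S: "minimal_two_sided_subshift A S" and g: "inj_on g A"
  defines "S' \<equiv> (\<lambda>x i. g (x i)) ` S"
  shows "minimal_two_sided_subshift (g ` A) S'"
    "topologically_conjugate (subshift_topology A S) shift (subshift_topology (g ` A) S') shift"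
proof -
  let ?T = "subshift_topology A S" and ?T' = "subshift_topology (g ` A) S'" and ?h = "\<lambda>x i. g (x i)"
  have fin: "finite A" and sh: "shift ` S = S"
    using S by (auto simp: minimal_two_sided_subshift_def two_sided_subshift_def)
  note D = minimal_subshiftD[OF minimal_two_sided_subshift_imp(1)[OF S]]
  have S': "S' \<subseteq> Pi UNIV (\<lambda>_. g ` A)" using D(1) by (auto simp: S'_def)
  have ts: "topspace ?T' = S'" unfolding subshift_topology_eq by (rule topspace_seq_topology[OF S'])
  have comm: "?h (shift x) = shift (?h x)" for x :: "int \<Rightarrow> 'a" by (simp add: shift_def)
  have opn: "openin ?T {x \<in> S. g (x i) = v}" for i v
  proof -
    have "{x \<in> S. g (x i) = v} = (\<Union>a\<in>{a. g a = v}. {x \<in> S. x i = a})" by auto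
    then show ?thesis using openin_coordinate[OF D(1)] by (auto simp: subshift_topology_eq)
  qed
  have cont: "continuous_map ?T ?T' ?h"
    using opn unfolding subshift_topology_eq continuous_map_seq_topology_iff[OF S'] topspace_seq_topology[OF D(1)]
    by (auto simp: S'_def)
  moreover have "inj_on ?h S"
  proof (rule inj_onI)
    fix x y assume xy: "x \<in> S" "y \<in> S" "?h x = ?h y"
    have "x i = y i" for i
      using fun_cong[OF xy(3), of i] subsetD[OF D(1) xy(1)] subsetD[OF D(1) xy(2)] by (intro inj_onD[OF g]) auto
    then show "x = y" by auto
  qed
  ultimately have hom: "homeomorphic_map ?T ?T' ?h"
    using D(2,3) ts Hausdorff_seq_topology
    by (intro continuous_imp_homeomorphic_map) (auto simp: subshift_topology_eq S'_def)
  then show "topologically_conjugate ?T shift ?T' shift"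
    unfolding topologically_conjugate_def using comm by blast
  have "shift ` S' = S'"
  proof -
    have "shift ` S' = ?h ` shift ` S" by (simp add: S'_def image_image comm)
    then show ?thesis by (simp only: sh S'_def)
  qed
  moreover have "closedin (full_shift_topology (g ` A)) S'"
  proof -
    have "compactin ?T' S'"
      using image_compactin[OF _ cont, of S] D(2,3) unfolding compact_space_def S'_def by simp
    then have "compactin (full_shift_topology (g ` A)) S'"
      by (simp add: subshift_topology_def compactin_subtopology)
    then show ?thesis
      by (rule compactin_imp_closedin[rotated])
        (simp add: full_shift_topology_def Hausdorff_space_product_topology)
  qed
  moreover have "minimal_system ?T' shift"
    by (rule minimal_system_image[OF D(6) _ cont]) (use D(2,5) ts comm in \<open>auto simp: S'_def\<close>)
  ultimately show "minimal_two_sided_subshift (g ` A) S'"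
    using fin by (simp add: minimal_two_sided_subshift_def two_sided_subshift_def)
qed

theorem corollary5p2:
  fixes A :: "'a set" and S :: "(int \<Rightarrow> 'a) set" and K :: enat
  assumes "minimal_two_sided_subshift A S"
    and "bratteli_topological_rank (subshift_topology A S) shift = K"
  shows "topological_rank (subshift_topology A (one_sided_factor S)) shift \<ge> K \<and>
    (\<exists>(A' :: nat set) (S' :: (int \<Rightarrow> nat) set).
       minimal_two_sided_subshift A' S' \<and>
       topologically_conjugate (subshift_topology A' S') shift (subshift_topology A S) shift \<and>
       topological_rank (subshift_topology A' (one_sided_factor S')) shift = K)"
proof
  show "topological_rank (subshift_topology A (one_sided_factor S)) shift \<ge> K"
    using bratteli_rank_le_one_sided_rank[OF assms(1)] assms(2) by simp
  have "finite A" using assms(1) by (simp add: minimal_two_sided_subshift_def two_sided_subshift_def)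
  then have inj: "inj_on (to_nat_on A) A" by (intro inj_on_to_nat_on countable_finite)
  define S' :: "(int \<Rightarrow> nat) set" where "S' = (\<lambda>x i. to_nat_on A (x i)) ` S"
  let ?A' = "to_nat_on A ` A"
  note S' = relabel_subshift[OF assms(1) inj, folded S'_def]
  have conj: "topologically_conjugate (subshift_topology ?A' S') shift (subshift_topology A S) shift"
  proof (rule topologically_conjugate_sym[OF S'(2)])
    note D = minimal_subshiftD[OF minimal_two_sided_subshift_imp(1)[OF assms(1)]]
    show "shift ` topspace (subshift_topology A S) \<subseteq> topspace (subshift_topology A S)" using D(2,5) by simp
  qed
  have "bratteli_topological_rank (subshift_topology ?A' S') shift = K"
    using bratteli_topological_rank_conjugate_le[OF conj] bratteli_topological_rank_conjugate_le[OF S'(2)] assms(2)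
    by simp
  then have "topological_rank (subshift_topology ?A' (one_sided_factor S')) shift = K"
    using one_sided_rank_eq_bratteli_rank[OF S'(1)] by simp
  then show "\<exists>(A' :: nat set) (S' :: (int \<Rightarrow> nat) set).
       minimal_two_sided_subshift A' S' \<and>
       topologically_conjugate (subshift_topology A' S') shift (subshift_topology A S) shift \<and>
       topological_rank (subshift_topology A' (one_sided_factor S')) shift = K"
    using S'(1) conj by blast
qed

end
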